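(* Assume the smooth-parameterization hypotheses stated in the context, and let $S^\theta_{s,t}(x;y)$ be the common raw flow. Let $\Theta_0\subset\operatorname{int}\Theta_1$ be compact and choose $\rho>0$ such that $(\Theta_0)_\rho:=\{\vartheta:\operatorname{dist}(\vartheta,\Theta_0)\le\rho\}\subset\operatorname{int}\Theta_1$. For $\eta=(v,w)\in\mathbb R^d\times\mathbb R$, whenever $\theta+[0,1]v\subset\operatorname{int}\Theta_1$, set $$\mathcal T^{\theta,y}_{s,t}(x;\eta)=D_\theta S^\theta_{s,t}(x;y)[v]+w\,\partial_yS^\theta_{s,t}(x;y),$$ $$\mathcal R^{\theta,y}_{s,t}(x;\eta)=S^{\theta+v}_{s,t}(x;y+w)-S^\theta_{s,t}(x;y)-\mathcal T^{\theta,y}_{s,t}(x;\eta).$$ With $(K_R)$ the compact capacity core described in the context, for every $R,m<\infty$, $$\lim_{\delta\downarrow0}\ \sup_{\substack{x\in K_R,\ \theta\in\Theta_0,\ |y|\le m,\ 0\le s\le t\le T\\0<|\eta|\le\min\{\delta,\rho,1\}}}\frac{|\mathcal R^{\theta,y}_{s,t}(x;\eta)|}{|\eta|}=0.$$ For every $1\le p<\infty$ (and every $m<\infty$), the corresponding expansion is uniform over the nondominated model class: $$\lim_{\delta\downarrow0}\ \sup_{\substack{P\in\mathfrak M_\Lambda,\ \theta\in\Theta_0,\ |y|\le m,\ 0\le s\le T\\0<|\eta|\le\min\{\delta,\rho,1\}}}\frac1{|\eta|}\Bigl(E^P\Bigl[\sup_{s\le t\le T}|\mathcal R^{\theta,y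}_{s,t}(X;\eta)|^p\Bigr]\Bigr)^{1/p}=0.$$
   Context: Fix $T,\Lambda>0$. $\Omega=C_0([0,T];\mathbb R)$ is the space of continuous real paths on $[0,T]$ starting at $0$, with the uniform topology; $X_t(x)=x_t$ is the coordinate process. $\mathfrak M_\Lambda$ is the set of Borel probability measures $P$ on $\Omega$ under which $X$ is a square-integrable martingale with respect to the usual augmentation of its natural filtration and such that the continuous predictable version $\langle X\rangle^P$ of its bracket satisfies, on one $P$-full set, $\langle X\rangle^P_t-\langle X\rangle^P_s\le\Lambda(t-s)$ for all $0\le s\le t\le T$. Bracket functional. $\mathcal A_\Lambda=\{q\in C([0,T]):q_0=0,\ 0\le q_t-q_s\le\Lambda(t-s)\text{ for }s\le t\}$ with the supremum norm. With $t_k^n=kT2^{-n}$, put $V^n_t(x)=\sum_{k:\,t^n_{k+1}\le t}(x_{t^n_{k+1}}-x_{t^n_k})^2$; for nonnegative increasing $a$ with $a_0=0$ put $(\mathcal R_\Lambda a)_t=\inf_{0\le u\le t}\{a_u+\Lambda(t-u)\}$; $q^n(x)=\mathcal R_\Lambda V^n(x)$ and $Q_t(x)=\limsup_nq^n_t(x)$. One has $Q(x)\in\mathcal A_\Lambda$ for every $x\in\Omega$. Compact capacity core. $(K_R)_{R\ge1}$ is an increasing sequence of compact subsets of $\Omega$ with $\sup_{P\in\mathfrak M_\Lambda}P(K_R^c)\to0$ and $q^n\to Q$ uniformly on every $K_R$ (such a sequence exists; in particular $Q|_{K_R}$ is continuous). Smooth-parameterization hypotheses. $\Theta\subset\mathbb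 R^d$ is compact, and there are an open $U\subset\mathbb R^d$ and a compact $\Theta_1\subset U$ with $\Theta\subset\operatorname{int}\Theta_1$, and a $C^1$ map $U\to C_b^2(\mathbb R)\times C_b^3(\mathbb R)$, $\theta\mapsto(b_\theta,\sigma_\theta)$, such that for some $L<\infty$, $0<\underline\sigma\le\overline\sigma<\infty$: $\sup_{\theta\in\Theta_1}(\|b_\theta\|_{C_b^2}+\|\sigma_\theta\|_{C_b^3})\le L$, $\underline\sigma\le\sigma_\theta(y)\le\overline\sigma$ for $\theta\in\Theta_1$, $y\in\mathbb R$, and $\sup_{\theta\in\Theta_1}(\|D_\theta b_\theta\|_{\mathcal L(\mathbb R^d,C_b^2)}+\|D_\theta\sigma_\theta\|_{\mathcal L(\mathbb R^d,C_b^3)})<\infty$. Flow (for $\theta\in\Theta_1$). $F_\theta(y)=\int_0^y dr/\sigma_\theta(r)$, $G_\theta=F_\theta^{-1}$, $\widehat b_\theta(z)=b_\theta(G_\theta(z))/\sigma_\theta(G_\theta(z))$, $\widehat c_\theta(z)=-\tfrac12\sigma_\theta'(G_\theta(z))$. For $x\in\Omega$, $q\in\mathcal A_\Lambda$, $0\le s\le T$, $y\in\mathbb R$, $Z=Z^{\theta,s,y}(x,q)$ is the unique continuous solution of $Z_t=F_\theta(y)+x_t-x_s+\int_s^t\widehat b_\theta(Z_r)\,dr+\int_s^t\widehat c_\theta(Z_r)\,dq_r$, $s\le t\le T$; $\Phi^\theta_{s,t}(x,q;y)=G_\theta(Z_t^{\theta,s,y}(x,q))$ and $S^\theta_{s,t}(x;y)=\Phi^\theta_{s,t}(x,Q(x);y)$.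 This is $C^1$ in $y$ and differentiable in $\theta\in\operatorname{int}\Theta_1$; $D_\theta S^\theta_{s,t}(x;y)[v]=D_\theta\Phi^\theta_{s,t}(x,q;y)[v]|_{q=Q(x)}$. *)

theory Defs
  imports "HOL-Probability.Probability"
begin

section \<open>The Banach spaces of bounded \<open>C\<^sup>k\<close> functions on the line\<close>

text \<open>The order \<open>k\<close> is a numeral type, so that \<open>2 Cb\<close> and \<open>3 Cb\<close> are the spaces
  \<open>C\<^sub>b\<^sup>2\<close> and \<open>C\<^sub>b\<^sup>3\<close>, with norm the sum of the sup norms of the derivatives of order at most \<open>k\<close>.\<close>

definition is_Cb :: "nat \<Rightarrow> (real \<Rightarrow> real) \<Rightarrow> bool" where
  "is_Cb k f \<longleftrightarrow>
     (\<forall>j<k. \<forall>x. (deriv ^^ j) f field_differentiable at x) \<and>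
     (\<forall>j\<le>k. continuous_on UNIV ((deriv ^^ j) f) \<and> bounded (range ((deriv ^^ j) f)))"

lemma iter_deriv_zero: "(deriv ^^ j) (\<lambda>x::real. 0::real) = (\<lambda>x. 0)"
  by (induction j) auto

lemma iter_deriv_lincomb:
  assumes "is_Cb k f" "is_Cb k g" "j \<le> k"
  shows "(deriv ^^ j) (\<lambda>x. a * f x + c * g x) = (\<lambda>x. a * (deriv ^^ j) f x + c * (deriv ^^ j) g x)"
  using assms(3)
proof (induction j)
  case (Suc j)
  have f: "(deriv ^^ j) f field_differentiable at x" and g: "(deriv ^^ j) g field_differentiable at x" for x
    using assms Suc.prems by (auto simp: is_Cb_def)
  have "deriv (\<lambda>x. a * (deriv ^^ j) f x + c * (deriv ^^ j) g x) x
      = a * deriv ((deriv ^^ j) f) x + c * deriv ((deriv ^^ j) g) x" for x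
    by (intro DERIV_imp_deriv DERIV_add DERIV_cmult
          field_differentiable_derivI[OF f] field_differentiable_derivI[OF g])
  then have "deriv (\<lambda>x. a * (deriv ^^ j) f x + c * (deriv ^^ j) g x)
      = (\<lambda>x. a * deriv ((deriv ^^ j) f) x + c * deriv ((deriv ^^ j) g) x)" by blast
  then show ?case using Suc by simp
qed simp

lemma is_Cb_zero: "is_Cb k (\<lambda>x. 0)"
  by (auto simp: is_Cb_def iter_deriv_zero)

lemma is_Cb_lincomb:
  assumes "is_Cb k f" "is_Cb k g"
  shows "is_Cb k (\<lambda>x. a * f x + c * g x)"
  unfolding is_Cb_def
proof safe
  fix j x assume "j < k"
  then show "(deriv ^^ j) (\<lambda>x. a * f x + c * g x) field_differentiable at x"
    using assms by (auto simp: iter_deriv_lincomb[OF assms] is_Cb_def intro!: derivative_intros)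
next
  fix j assume "j \<le> k"
  then show "continuous_on UNIV ((deriv ^^ j) (\<lambda>x. a * f x + c * g x))"
    using assms by (auto simp: iter_deriv_lincomb[OF assms] is_Cb_def intro!: continuous_intros)
next
  fix j assume j: "j \<le> k"
  obtain A B where "\<And>x. \<bar>(deriv ^^ j) f x\<bar> \<le> A" "\<And>x. \<bar>(deriv ^^ j) g x\<bar> \<le> B"
    using assms j unfolding is_Cb_def bounded_iff by (metis rangeI real_norm_def)
  then have "\<bar>a * (deriv ^^ j) f x + c * (deriv ^^ j) g x\<bar> \<le> \<bar>a\<bar> * A + \<bar>c\<bar> * B" for x
    by (intro order_trans[OF abs_triangle_ineq] add_mono) (auto simp: abs_mult mult_left_mono)
  then show "bounded (range ((deriv ^^ j) (\<lambda>x. a * f x + c * g x)))"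
    using j by (auto simp: iter_deriv_lincomb[OF assms] bounded_iff)
qed

typedef ('k::finite) Cb = "{f. is_Cb CARD('k) f}"
  morphisms Cb_apply Abs_Cb
  using is_Cb_zero by blast

setup_lifting type_definition_Cb

declare [[coercion "Cb_apply :: 'k::finite Cb \<Rightarrow> real \<Rightarrow> real"]]

lemma Cb_lincomb_mem:
  "is_Cb k f \<Longrightarrow> is_Cb k g \<Longrightarrow> is_Cb k (\<lambda>x. f x + g x)"
  "is_Cb k f \<Longrightarrow> is_Cb k g \<Longrightarrow> is_Cb k (\<lambda>x. f x - g x)"
  "is_Cb k f \<Longrightarrow> is_Cb k (\<lambda>x. - f x)"
  "is_Cb k f \<Longrightarrow> is_Cb k (\<lambda>x. c * f x)"
  using is_Cb_lincomb[of k f g 1 1] is_Cb_lincomb[of k f g 1 "-1"]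
    is_Cb_lincomb[of k f f "-1" 0] is_Cb_lincomb[of k f f c 0] by simp_all

definition Cb_jet :: "nat \<Rightarrow> 'k::finite Cb \<Rightarrow> real \<Rightarrow>\<^sub>C real" where
  "Cb_jet j f = Bcontfun ((deriv ^^ j) (Cb_apply f))"

instantiation Cb :: (finite) real_normed_vector
begin

lift_definition zero_Cb :: "'a Cb" is "\<lambda>x. 0" by (rule is_Cb_zero)
lift_definition plus_Cb :: "'a Cb \<Rightarrow> 'a Cb \<Rightarrow> 'a Cb" is "\<lambda>f g x. f x + g x" by (rule Cb_lincomb_mem)
lift_definition minus_Cb :: "'a Cb \<Rightarrow> 'a Cb \<Rightarrow> 'a Cb" is "\<lambda>f g x. f x - g x" by (rule Cb_lincomb_mem)
lift_definition uminus_Cb :: "'a Cb \<Rightarrow> 'a Cb" is "\<lambda>f x. - f x" by (rule Cb_lincomb_mem)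
lift_definition scaleR_Cb :: "real \<Rightarrow> 'a Cb \<Rightarrow> 'a Cb" is "\<lambda>c f x. c * f x" by (rule Cb_lincomb_mem)

definition norm_Cb :: "'a Cb \<Rightarrow> real" where
  "norm_Cb f = (\<Sum>j\<le>CARD('a). SUP x. \<bar>(deriv ^^ j) (Cb_apply f) x\<bar>)"

definition dist_Cb :: "'a Cb \<Rightarrow> 'a Cb \<Rightarrow> real" where "dist_Cb f g = norm (f - g)"
definition sgn_Cb :: "'a Cb \<Rightarrow> 'a Cb" where "sgn_Cb f = inverse (norm f) *\<^sub>R f"
definition uniformity_Cb :: "('a Cb \<times> 'a Cb) filter" where
  "uniformity_Cb = (INF e\<in>{0<..}. principal {(f, g). dist f g < e})"
definition open_Cb :: "'a Cb set \<Rightarrow> bool" where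
  "open_Cb S = (\<forall>f\<in>S. \<forall>\<^sub>F (f', g) in uniformity. f' = f \<longrightarrow> g \<in> S)"

lemma apply_Cb_jet:
  fixes f :: "'a Cb"
  assumes "j \<le> CARD('a)"
  shows "apply_bcontfun (Cb_jet j f) = (deriv ^^ j) (Cb_apply f)"
  using assms Cb_apply[of f] unfolding Cb_jet_def
  by (subst Bcontfun_inverse) (auto simp: is_Cb_def bcontfun_def)

lemma norm_Cb_jet: "norm (f :: 'a Cb) = (\<Sum>j\<le>CARD('a). norm (Cb_jet j f))"
  unfolding norm_Cb_def
proof (intro sum.cong refl)
  fix j assume "j \<in> {..CARD('a)}"
  then show "(SUP x. \<bar>(deriv ^^ j) (Cb_apply f) x\<bar>) = norm (Cb_jet j f)"
    by (simp add: norm_conv_dist dist_bcontfun.rep_eq apply_Cb_jet del: dist_0_norm)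
qed

lemma Cb_jet_lincomb:
  fixes f g h :: "'a Cb"
  assumes "j \<le> CARD('a)" and "Cb_apply h = (\<lambda>x. a * f x + c * g x)"
  shows "Cb_jet j h = a *\<^sub>R Cb_jet j f + c *\<^sub>R Cb_jet j g"
  using assms Cb_apply[of f] Cb_apply[of g]
  by (intro bcontfun_eqI) (simp add: apply_Cb_jet iter_deriv_lincomb)

instance
proof
  fix f g h :: "'a Cb" and a c :: real
  show "f + g + h = f + (g + h)" "f + g = g + f" "0 + f = f" "- f + f = 0" "f - g = f + - g"
    "a *\<^sub>R (f + g) = a *\<^sub>R f + a *\<^sub>R g" "(a + c) *\<^sub>R f = a *\<^sub>R f + c *\<^sub>R f"
    "a *\<^sub>R c *\<^sub>R f = (a * c) *\<^sub>R f" "1 *\<^sub>R f = f"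
    by (transfer; simp add: fun_eq_iff algebra_simps)+
  have "norm f = 0 \<Longrightarrow> f = 0"
  proof -
    assume "norm f = 0"
    then have "norm (Cb_jet 0 f) = 0"
      unfolding norm_Cb_jet by (subst (asm) sum_nonneg_eq_0_iff) auto
    then have "Cb_apply f = (\<lambda>x. 0)"
      using apply_Cb_jet[of 0 f] by simp
    then show "f = 0" by transfer simp
  qed
  moreover have "norm (0 :: 'a Cb) = 0"
    by (simp add: norm_Cb_def zero_Cb.rep_eq iter_deriv_zero)
  ultimately show "norm f = 0 \<longleftrightarrow> f = 0" by blast
  have "Cb_jet j (f + g) = Cb_jet j f + Cb_jet j g" if "j \<le> CARD('a)" for j
    using Cb_jet_lincomb[OF that, of "f + g" 1 f 1 g] by (simp add: plus_Cb.rep_eq)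
  then show "norm (f + g) \<le> norm f + norm g"
    by (simp add: norm_Cb_jet flip: sum.distrib) (auto intro!: sum_mono norm_triangle_ineq)
  have "Cb_jet j (a *\<^sub>R f) = a *\<^sub>R Cb_jet j f" if "j \<le> CARD('a)" for j
    using Cb_jet_lincomb[OF that, of "a *\<^sub>R f" a f 0 f] by (simp add: scaleR_Cb.rep_eq)
  then show "norm (a *\<^sub>R f) = \<bar>a\<bar> * norm f"
    by (simp add: norm_Cb_jet sum_distrib_left)
qed (rule dist_Cb_def sgn_Cb_def open_Cb_def uniformity_Cb_def)+

end

definition C1_map_on :: "'a::real_normed_vector set \<Rightarrow> ('a \<Rightarrow> 'b::real_normed_vector) \<Rightarrow> bool" where
  "C1_map_on U f \<longleftrightarrow>
     (\<exists>D :: 'a \<Rightarrow> 'a \<Rightarrow>\<^sub>L 'b.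
        (\<forall>u\<in>U. (f has_derivative blinfun_apply (D u)) (at u)) \<and> continuous_on U D)"


section \<open>Path space and the martingale class\<close>

text \<open>A path on \<open>[0,T]\<close> is represented by its extension to the line that is constant on
  \<open>(-\<infinity>,0]\<close> and on \<open>[T,\<infinity>)\<close>. This is an isometry of \<open>C\<^sub>0([0,T])\<close> onto a closed subspace of
  the bounded continuous functions, so compactness and the Borel sets are the usual ones.\<close>

type_synonym path = "real \<Rightarrow>\<^sub>C real"

definition paths :: "real \<Rightarrow> path set" where
  "paths T = {x :: path. x 0 = 0 \<and> (\<forall>t. x t = x (max 0 (min T t)))}"

definition path_borel :: "real \<Rightarrow> path measure" where
  "path_borel T = restrict_space borel (paths T)"

definition natural_filtration :: "real \<Rightarrow> real \<Rightarrow> path measure" where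
  "natural_filtration T t =
     sigma (paths T) {{x \<in> paths T. apply_bcontfun x s \<in> B} |s B. s \<in> {0..t} \<and> B \<in> sets borel}"

text \<open>Completed by the subsets of \<open>P\<close>-null sets and made right-continuous. The index is frozen
  at \<open>T\<close>, so the \<open>\<sigma>\<close>-algebra at time \<open>T\<close> is just the completed one.\<close>

definition usual_augmentation :: "real \<Rightarrow> path measure \<Rightarrow> real \<Rightarrow> path measure" where
  "usual_augmentation T P t =
     sigma (paths T)
       (\<Inter>u\<in>{t<..}. sigma_sets (paths T)
          (sets (natural_filtration T (min u T)) \<union> null_sets (completion P)))"

definition martingale :: "real \<Rightarrow> path measure \<Rightarrow> (real \<Rightarrow> path \<Rightarrow> real) \<Rightarrow> bool" where
  "martingale T P Y \<longleftrightarrow>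
     (\<forall>t\<in>{0..T}. Y t \<in> borel_measurable (usual_augmentation T P t) \<and>
                  integrable (completion P) (Y t)) \<and>
     (\<forall>s t. 0 \<le> s \<and> s \<le> t \<and> t \<le> T \<longrightarrow>
        (AE x in completion P.
           real_cond_exp (completion P) (usual_augmentation T P s) (Y t) x = Y s x))"

definition square_integrable_martingale ::
    "real \<Rightarrow> path measure \<Rightarrow> (real \<Rightarrow> path \<Rightarrow> real) \<Rightarrow> bool" where
  "square_integrable_martingale T P Y \<longleftrightarrow>
     martingale T P Y \<and> (\<forall>t\<in>{0..T}. integrable (completion P) (\<lambda>x. (Y t x)\<^sup>2))"

definition predictable_sigma :: "real \<Rightarrow> path measure \<Rightarrow> (real \<times> path) measure" where
  "predictable_sigma T P =
     sigma ({0..T} \<times> paths T)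
       ({{0} \<times> A |A. A \<in> sets (usual_augmentation T P 0)} \<union>
        {{s<..t} \<times> A |s t A. 0 \<le> s \<and> s < t \<and> t \<le> T \<and> A \<in> sets (usual_augmentation T P s)})"

text \<open>\<open>A\<close> is a continuous predictable version of the bracket of the coordinate process. It is
  unique up to indistinguishability.\<close>

definition is_bracket :: "real \<Rightarrow> path measure \<Rightarrow> (real \<Rightarrow> path \<Rightarrow> real) \<Rightarrow> bool" where
  "is_bracket T P A \<longleftrightarrow>
     (\<lambda>(t, x). A t x) \<in> borel_measurable (predictable_sigma T P) \<and>
     (\<forall>x\<in>paths T. A 0 x = 0 \<and> continuous_on {0..T} (\<lambda>t. A t x) \<and> mono_on {0..T} (\<lambda>t. A t x)) \<and>
     martingale T P (\<lambda>t x. (apply_bcontfun x t)\<^sup>2 - A t x)"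

definition model_class :: "real \<Rightarrow> real \<Rightarrow> path measure set" where
  "model_class T \<Lambda> =
     {P. prob_space P \<and> sets P = sets (path_borel T) \<and>
         square_integrable_martingale T P (\<lambda>t x. apply_bcontfun x t) \<and>
         (\<exists>A. is_bracket T P A \<and>
              (AE x in P. \<forall>s t. 0 \<le> s \<and> s \<le> t \<and> t \<le> T \<longrightarrow> A t x - A s x \<le> \<Lambda> * (t - s)))}"


section \<open>The bracket functional and the capacity core\<close>

definition dyadic_variation :: "real \<Rightarrow> nat \<Rightarrow> path \<Rightarrow> real \<Rightarrow> real" where
  "dyadic_variation T n x t =
     (\<Sum>k | real (Suc k) * T / 2 ^ n \<le> t.
        (x (real (Suc k) * T / 2 ^ n) - x (real k * T / 2 ^ n))\<^sup>2)"

definition lip_regularization :: "real \<Rightarrow> (real \<Rightarrow> real) \<Rightarrow> real \<Rightarrow> real" where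
  "lip_regularization \<Lambda> a t = (INF u\<in>{0..t}. a u + \<Lambda> * (t - u))"

definition bracket_approx :: "real \<Rightarrow> real \<Rightarrow> nat \<Rightarrow> path \<Rightarrow> real \<Rightarrow> real" where
  "bracket_approx T \<Lambda> n x = lip_regularization \<Lambda> (dyadic_variation T n x)"

text \<open>The limsup is taken in the extended reals; it is finite for
  \<open>0 \<le> t \<le> T\<close> because \<open>0 \<le> bracket_approx T \<Lambda> n x t \<le> \<Lambda> * t\<close>.\<close>

definition bracket_functional :: "real \<Rightarrow> real \<Rightarrow> path \<Rightarrow> real \<Rightarrow> real" where
  "bracket_functional T \<Lambda> x t = real_of_ereal (limsup (\<lambda>n. ereal (bracket_approx T \<Lambda> n x t)))"

definition capacity_core :: "real \<Rightarrow> real \<Rightarrow> (nat \<Rightarrow> path set) \<Rightarrow> bool" where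
  "capacity_core T \<Lambda> K \<longleftrightarrow>
     (\<forall>R\<ge>1. compact (K R) \<and> K R \<subseteq> paths T \<and> K R \<subseteq> K (Suc R)) \<and>
     (\<lambda>R. SUP P\<in>model_class T \<Lambda>. emeasure P (paths T - K R)) \<longlonglongrightarrow> 0 \<and>
     (\<forall>R\<ge>1. uniform_limit (K R \<times> {0..T})
        (\<lambda>n (x, t). bracket_approx T \<Lambda> n x t) (\<lambda>(x, t). bracket_functional T \<Lambda> x t) sequentially)"


section \<open>The flow\<close>

text \<open>The interval integral is oriented, so this is also right for negative \<open>y\<close>.\<close>

definition lamperti :: "(real \<Rightarrow> real) \<Rightarrow> real \<Rightarrow> real" where
  "lamperti \<sigma> y = (LBINT r=ereal 0..ereal y. 1 / \<sigma> r)"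

definition lamperti_inv :: "(real \<Rightarrow> real) \<Rightarrow> real \<Rightarrow> real" where
  "lamperti_inv \<sigma> = inv (lamperti \<sigma>)"

definition b_hat :: "(real \<Rightarrow> real) \<Rightarrow> (real \<Rightarrow> real) \<Rightarrow> real \<Rightarrow> real" where
  "b_hat b \<sigma> z = b (lamperti_inv \<sigma> z) / \<sigma> (lamperti_inv \<sigma> z)"

definition c_hat :: "(real \<Rightarrow> real) \<Rightarrow> real \<Rightarrow> real" where
  "c_hat \<sigma> z = - (1 / 2) * deriv \<sigma> (lamperti_inv \<sigma> z)"

text \<open>The Lebesgue--Stieltjes measure \<open>dq\<close> on \<open>[0,T]\<close>, for \<open>q\<close> continuous and nondecreasing there:
  freezing \<open>q\<close> outside \<open>[0,T]\<close> puts no mass outside.\<close>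

definition stieltjes :: "real \<Rightarrow> (real \<Rightarrow> real) \<Rightarrow> real measure" where
  "stieltjes T q = interval_measure (\<lambda>r. q (max 0 (min T r)))"

definition flow_equation ::
    "real \<Rightarrow> (real \<Rightarrow> real) \<Rightarrow> (real \<Rightarrow> real) \<Rightarrow> real \<Rightarrow> path \<Rightarrow> (real \<Rightarrow> real) \<Rightarrow> real \<Rightarrow> (real \<Rightarrow> real) \<Rightarrow> bool" where
  "flow_equation T b \<sigma> s x q y Z \<longleftrightarrow>
     continuous_on {s..T} Z \<and>
     (\<forall>t\<in>{s..T}. Z t = lamperti \<sigma> y + x t - x s
        + (LBINT r:{s..t}. b_hat b \<sigma> (Z r))
        + (LINT r:{s..t}|stieltjes T q. c_hat \<sigma> (Z r)))"

text \<open>Extensionality on \<open>[s,T]\<close> makes the solution unique as a total function.\<close>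

definition flow_solution ::
    "real \<Rightarrow> (real \<Rightarrow> real) \<Rightarrow> (real \<Rightarrow> real) \<Rightarrow> real \<Rightarrow> path \<Rightarrow> (real \<Rightarrow> real) \<Rightarrow> real \<Rightarrow> real \<Rightarrow> real" where
  "flow_solution T b \<sigma> s x q y =
     (THE Z. Z \<in> extensional {s..T} \<and> flow_equation T b \<sigma> s x q y Z)"

definition flow ::
    "real \<Rightarrow> (real \<Rightarrow> real) \<Rightarrow> (real \<Rightarrow> real) \<Rightarrow> real \<Rightarrow> real \<Rightarrow> path \<Rightarrow> (real \<Rightarrow> real) \<Rightarrow> real \<Rightarrow> real" where
  "flow T b \<sigma> s t x q y = lamperti_inv \<sigma> (flow_solution T b \<sigma> s x q y t)"

definition raw_flow ::
    "real \<Rightarrow> real \<Rightarrow> (real \<Rightarrow> real) \<Rightarrow> (real \<Rightarrow> real) \<Rightarrow> real \<Rightarrow> real \<Rightarrow> path \<Rightarrow> real \<Rightarrow> real" where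
  "raw_flow T \<Lambda> b \<sigma> s t x y = flow T b \<sigma> s t x (bracket_functional T \<Lambda> x) y"


section \<open>Tangent process and remainder\<close>

definition tangent ::
    "real \<Rightarrow> real \<Rightarrow> ('d::real_normed_vector \<Rightarrow> 2 Cb) \<Rightarrow> ('d \<Rightarrow> 3 Cb) \<Rightarrow>
     'd \<Rightarrow> real \<Rightarrow> real \<Rightarrow> real \<Rightarrow> path \<Rightarrow> 'd \<times> real \<Rightarrow> real" where
  "tangent T \<Lambda> b \<sigma> \<theta> y s t x \<eta> =
     frechet_derivative
       (\<lambda>\<theta>'. flow T (b \<theta>') (\<sigma> \<theta>') s t x (bracket_functional T \<Lambda> x) y) (at \<theta>) (fst \<eta>)
     + snd \<eta> * deriv (\<lambda>z. raw_flow T \<Lambda> (b \<theta>) (\<sigma> \<theta>) s t x z) y"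

definition remainder ::
    "real \<Rightarrow> real \<Rightarrow> ('d::real_normed_vector \<Rightarrow> 2 Cb) \<Rightarrow> ('d \<Rightarrow> 3 Cb) \<Rightarrow>
     'd \<Rightarrow> real \<Rightarrow> real \<Rightarrow> real \<Rightarrow> path \<Rightarrow> 'd \<times> real \<Rightarrow> real" where
  "remainder T \<Lambda> b \<sigma> \<theta> y s t x \<eta> =
     raw_flow T \<Lambda> (b (\<theta> + fst \<eta>)) (\<sigma> (\<theta> + fst \<eta>)) s t x (y + snd \<eta>)
     - raw_flow T \<Lambda> (b \<theta>) (\<sigma> \<theta>) s t x y
     - tangent T \<Lambda> b \<sigma> \<theta> y s t x \<eta>"

text \<open>Empty for empty \<open>A\<close>, whereas \<^const>\<open>infdist\<close> to the empty set is 0 by convention.\<close>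

definition closed_nbhd :: "'a::metric_space set \<Rightarrow> real \<Rightarrow> 'a set" where
  "closed_nbhd A \<rho> = {x. A \<noteq> {} \<and> infdist x A \<le> \<rho>}"

text \<open>Powers with positive exponent; the value at infinity is infinity.\<close>

definition ennreal_powr :: "ennreal \<Rightarrow> real \<Rightarrow> ennreal" where
  "ennreal_powr a r = (if a = top then top else ennreal (enn2real a powr r))"

end

theory Submission
  imports Defs
begin

text \<open>The bound on the remainder is pathwise. For every path \<open>x\<close> the functional \<open>q = Q(x)\<close> is
  \<open>\<Lambda>\<close>-Lipschitz, so \<open>dq = g dr\<close> with \<open>0 \<le> g \<le> \<Lambda>\<close>, and the flow equation becomes an integral equation
  with the single drift \<open>b_hat + g * c_hat\<close>. The transformed coefficients are jointly \<open>C\<^sup>1\<close> in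
  parameter and state and globally Lipschitz in the state; their parameter increments grow linearly in
  the state. Gronwall's inequality for the flow minus its linearization gives a remainder that is
  \<open>o(norm \<eta>)\<close> uniformly on bounded sets of paths, hence on compact sets, and at most
  \<open>c * (1 + norm x) * norm \<eta>\<close> on all paths.

  It remains to integrate the linear growth away from a bounded set, uniformly over the models. Because
  \<open>E[(X\<^sub>t - X\<^sub>s)\<^sup>2 | F\<^sub>s] \<le> \<Lambda> * (t - s)\<close>, the conditional Kolmogorov inequality shows that each further
  displacement of the path by \<open>a = sqrt (2 * \<Lambda> * T)\<close> costs a factor \<open>1/2\<close> in probability (the
  John-Nirenberg argument, run on time grids and passed to the limit by continuity of the paths). So
  \<open>norm X\<close> has a uniformly bounded exponential moment. No measurability of the remainder is needed,
  since the nonnegative integral is monotone for arbitrary functions.\<close>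

section \<open>Volterra integral equations on the line\<close>

text \<open>The obstacle is the linear growth: two Lamperti transforms both vanish at 0, but their
  slopes differ by the order of the parameter increment, so the transforms and their inverses drift
  apart proportionally to the state. An expansion radius is therefore sought only for paths with
  \<open>norm x\<close> below a given bound; elsewhere a crude bound has to be paid for by tails,
  and an exponential moment pays for every exponent \<open>p\<close> at once. Uniformity over the
  models rests on the order of quantifiers. All constants and radii of the flow estimates are fixed
  before the density \<open>g\<close>, the path and the starting time, and they use only
  \<open>0 \<le> g r \<le> \<Lambda>\<close>. So one expansion of finitely many jointly smooth
  functions on a compact set serves every path of bounded norm. The size of the tangent is not read
  off the linearized equation. Once the tangent is known to be linear and the remainder to be small
  near 0, the Lipschitz bound of the flow itself gives the size by scaling.\<close>

lemma has_integral_exp_shift: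
  fixes \<kappa> s t :: real
  assumes "0 < \<kappa>" "s \<le> t"
  shows "((\<lambda>r. exp (\<kappa> * (r - s))) has_integral (exp (\<kappa> * (t - s)) - 1) / \<kappa>) {s..t}"
proof -
  have "((\<lambda>r. exp (\<kappa> * (r - s))) has_integral
      exp (\<kappa> * (t - s)) / \<kappa> - exp (\<kappa> * (s - s)) / \<kappa>) {s..t}"
    using assms
    by (intro fundamental_theorem_of_calculus)
      (auto intro!: derivative_eq_intros simp: has_real_derivative_iff_has_vector_derivative[symmetric])
  then show ?thesis by (simp add: diff_divide_distrib)
qed

text \<open>The weight \<open>exp (\<kappa> * (r - s))\<close> with \<open>\<kappa> = 2 * K + 1\<close> makes the Volterra operator with Lipschitz
  constant \<open>K\<close> a contraction with factor \<open>1/2\<close>.\<close>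

lemma weighted_integral_bound:
  fixes h :: "real \<Rightarrow> real"
  assumes "s \<le> t" "0 \<le> K" "0 \<le> M"
    and "h integrable_on {s..t}"
    and h: "\<And>r. r \<in> {s..t} \<Longrightarrow> \<bar>h r\<bar> \<le> \<beta> + K * (M * exp ((2 * K + 1) * (r - s)))"
  shows "\<bar>integral {s..t} h\<bar> \<le> \<beta> * (t - s) + M / 2 * exp ((2 * K + 1) * (t - s))"
proof -
  let ?\<kappa> = "2 * K + 1"
  have \<kappa>: "0 < ?\<kappa>" using \<open>0 \<le> K\<close> by simp
  have 1: "((\<lambda>r. \<beta> + (K * M) * exp (?\<kappa> * (r - s))) has_integral
      \<beta> * (t - s) + (K * M) * ((exp (?\<kappa> * (t - s)) - 1) / ?\<kappa>)) {s..t}"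
    using has_integral_exp_shift[OF \<kappa> \<open>s \<le> t\<close>] has_integral_const_real[of \<beta> s t] \<open>s \<le> t\<close>
    by (intro has_integral_add has_integral_mult_right) (auto simp: mult.commute)
  have "norm (integral {s..t} h) \<le> integral {s..t} (\<lambda>r. \<beta> + (K * M) * exp (?\<kappa> * (r - s)))"
    using assms 1 by (intro integral_norm_bound_integral) (auto simp: mult.assoc)
  also have "\<dots> = \<beta> * (t - s) + M * (K / ?\<kappa>) * (exp (?\<kappa> * (t - s)) - 1)"
    using integral_unique[OF 1] by simp
  also have "\<dots> \<le> \<beta> * (t - s) + M * (1 / 2) * exp (?\<kappa> * (t - s))"
  proof -
    have "K / ?\<kappa> \<le> 1 / 2" using \<open>0 \<le> K\<close> by (simp add: field_simps)
    then show ?thesis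
      using assms by (intro add_left_mono mult_mono) auto
  qed
  finally show ?thesis by simp
qed

text \<open>Absorption instead of iteration: at a maximum point \<open>t0\<close> of
  \<open>\<bar>u r\<bar>\<close> divided by the exponential weight, the integral contributes at most
  half of \<open>\<bar>u t0\<bar>\<close>, which moves to the left and leaves the factor 2. The
  integrand \<open>h\<close> is only integrable, because the drifts to come contain a merely
  measurable density.\<close>

lemma gronwall:
  fixes u h :: "real \<Rightarrow> real"
  assumes "continuous_on {s..T} u" "0 \<le> \<alpha>" "0 \<le> \<beta>" "0 \<le> K"
    and h: "h integrable_on {s..T}" "\<And>r. r \<in> {s..T} \<Longrightarrow> \<bar>h r\<bar> \<le> \<beta> + K * \<bar>u r\<bar>"
    and u: "\<And>t. t \<in> {s..T} \<Longrightarrow> \<bar>u t\<bar> \<le> \<alpha> + \<bar>integral {s..t} h\<bar>"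
    and t: "t \<in> {s..T}"
  shows "\<bar>u t\<bar> \<le> 2 * (\<alpha> + \<beta> * (T - s)) * exp ((2 * K + 1) * (T - s))"
proof -
  let ?e = "\<lambda>r. exp ((2 * K + 1) * (r - s))"
  have "continuous_on {s..T} (\<lambda>r. \<bar>u r\<bar> / ?e r)"
    using assms(1) by (intro continuous_intros) auto
  from continuous_attains_sup[OF compact_Icc _ this] t obtain t0
    where t0: "t0 \<in> {s..T}" and "\<forall>r\<in>{s..T}. \<bar>u r\<bar> / ?e r \<le> \<bar>u t0\<bar> / ?e t0"
    by blast
  moreover define M where "M = \<bar>u t0\<bar> / ?e t0"
  ultimately have M: "\<bar>u r\<bar> \<le> M * ?e r" if "r \<in> {s..T}" for r
    using that by (simp add: divide_le_eq)
  have "0 \<le> M" unfolding M_def by simp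
  have "\<bar>h r\<bar> \<le> \<beta> + K * (M * ?e r)" if "r \<in> {s..t0}" for r
    using that t0 h(2)[of r] M[of r] mult_left_mono[OF M \<open>0 \<le> K\<close>, of r] by force
  moreover have "h integrable_on {s..t0}"
    using integrable_on_subinterval[OF h(1)] t0 by auto
  ultimately have "\<bar>integral {s..t0} h\<bar> \<le> \<beta> * (t0 - s) + M / 2 * ?e t0"
    using t0 \<open>0 \<le> K\<close> \<open>0 \<le> M\<close> by (intro weighted_integral_bound) auto
  moreover have "\<beta> * (t0 - s) \<le> \<beta> * (T - s)" using t0 \<open>0 \<le> \<beta>\<close> by (intro mult_left_mono) auto
  moreover have "M * ?e t0 = \<bar>u t0\<bar>" by (simp add: M_def)
  ultimately have "M * ?e t0 \<le> 2 * (\<alpha> + \<beta> * (T - s))"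
    using u[OF t0] by (simp add: field_simps)
  moreover have "M * 1 \<le> M * ?e t0" using t0 \<open>0 \<le> M\<close> \<open>0 \<le> K\<close> by (intro mult_left_mono) auto
  ultimately have "M \<le> 2 * (\<alpha> + \<beta> * (T - s))" by simp
  moreover have "?e t \<le> ?e T" using t \<open>0 \<le> K\<close> by (auto intro!: mult_left_mono)
  ultimately have "M * ?e t \<le> 2 * (\<alpha> + \<beta> * (T - s)) * ?e T"
    using \<open>0 \<le> M\<close> by (intro mult_mono) auto
  with M[OF t] show ?thesis by simp
qed

lemma clamp_bcontfun:
  fixes \<phi> :: "real \<Rightarrow> real"
  assumes "s \<le> T" "continuous_on {s..T} \<phi>"
  shows "(\<lambda>t. \<phi> (max s (min T t))) \<in> bcontfun"
proof -
  have c: "continuous_on UNIV (\<lambda>t. \<phi> (max s (min T t)))"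
    using assms by (intro continuous_on_compose2[OF assms(2)] continuous_intros) auto
  have "compact (\<phi> ` {s..T})" using assms by (intro compact_continuous_image) auto
  then have "bounded (range (\<lambda>t. \<phi> (max s (min T t))))"
    using assms by (elim bounded_subset[OF compact_imp_bounded]) auto
  with c show ?thesis by (auto simp: bcontfun_def)
qed

text \<open>The unknown is rescaled to \<open>exp (- \<kappa> * (r - s)) * Z r\<close>. In this
  variable the integral operator halves sup distances on all of \<open>{s..T}\<close>, so Banach's
  theorem gives a global solution without patching short intervals.\<close>

lemma picard:
  fixes f :: "real \<Rightarrow> real \<Rightarrow> real"
  assumes sT: "s \<le> T" and "0 \<le> K" and g: "continuous_on {s..T} g"
    and int: "\<And>u. continuous_on {s..T} u \<Longrightarrow> (\<lambda>r. f r (u r)) integrable_on {s..T}"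
    and lip: "\<And>r z z'. r \<in> {s..T} \<Longrightarrow> \<bar>f r z - f r z'\<bar> \<le> K * \<bar>z - z'\<bar>"
  shows "\<exists>Z. continuous_on {s..T} Z \<and> (\<forall>t\<in>{s..T}. Z t = g t + integral {s..t} (\<lambda>r. f r (Z r)))"
proof -
  define \<kappa> where "\<kappa> = 2 * K + 1"
  define I where "I u t = g t + integral {s..t} (\<lambda>r. f r (exp (\<kappa> * (r - s)) * apply_bcontfun u r))" for u t
  define \<Psi> where "\<Psi> u t = I u t / exp (\<kappa> * (t - s))" for u t
  have e: "continuous_on {s..T} (\<lambda>r. exp (\<kappa> * (r - s)) * apply_bcontfun u r)" for u
    by (intro continuous_intros) auto
  have cI: "continuous_on {s..T} (I u)" for u
    unfolding I_def by (intro continuous_intros g indefinite_integral_continuous_1 int e)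
  have "continuous_on {s..T} (\<Psi> u)" for u
    unfolding \<Psi>_def by (intro continuous_intros cI) auto
  note bc = clamp_bcontfun[OF sT this]
  \<comment> \<open>Clamping the time argument makes the image a bounded continuous function on the
    whole line, so that the fixed point theorem applies to the complete type of such
    functions.\<close>
  define \<Phi> where "\<Phi> u = Bcontfun (\<lambda>t. \<Psi> u (max s (min T t)))" for u
  have \<Phi>: "apply_bcontfun (\<Phi> u) t = \<Psi> u (max s (min T t))" for u t
    unfolding \<Phi>_def by (simp add: Bcontfun_inverse bc)
  have "dist (\<Phi> u) (\<Phi> v) \<le> 1 / 2 * dist u v" for u v
  proof (rule dist_bound)
    fix t0
    define t where "t = max s (min T t0)"
    have t: "t \<in> {s..T}" using sT by (auto simp: t_def)
    have "\<bar>integral {s..t} (\<lambda>r. f r (exp (\<kappa> * (r - s)) * apply_bcontfun u r)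
          - f r (exp (\<kappa> * (r - s)) * apply_bcontfun v r))\<bar> \<le> 0 * (t - s) + dist u v / 2 * exp ((2 * K + 1) * (t - s))"
    proof (rule weighted_integral_bound)
      show "(\<lambda>r. f r (exp (\<kappa> * (r - s)) * apply_bcontfun u r)
          - f r (exp (\<kappa> * (r - s)) * apply_bcontfun v r)) integrable_on {s..t}"
        using t by (intro integrable_on_subinterval[OF integrable_diff[OF int[OF e] int[OF e]]]) auto
    next
      fix r assume r: "r \<in> {s..t}"
      have "\<bar>f r (exp (\<kappa> * (r - s)) * apply_bcontfun u r) - f r (exp (\<kappa> * (r - s)) * apply_bcontfun v r)\<bar>
          \<le> K * (exp (\<kappa> * (r - s)) * \<bar>apply_bcontfun u r - apply_bcontfun v r\<bar>)"
        using lip[of r "exp (\<kappa> * (r - s)) * apply_bcontfun u r" "exp (\<kappa> * (r - s)) * apply_bcontfun v r"] r t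
        by (simp add: abs_mult flip: right_diff_distrib)
      also have "\<dots> \<le> K * (exp (\<kappa> * (r - s)) * dist u v)"
        using dist_bounded[of u r v] \<open>0 \<le> K\<close> by (intro mult_left_mono) (auto simp: dist_real_def)
      finally show "\<bar>f r (exp (\<kappa> * (r - s)) * apply_bcontfun u r) - f r (exp (\<kappa> * (r - s)) * apply_bcontfun v r)\<bar>
          \<le> 0 + K * (dist u v * exp ((2 * K + 1) * (r - s)))" by (simp add: \<kappa>_def mult.commute)
    qed (use t \<open>0 \<le> K\<close> in auto)
    also have "integral {s..t} (\<lambda>r. f r (exp (\<kappa> * (r - s)) * apply_bcontfun u r)
          - f r (exp (\<kappa> * (r - s)) * apply_bcontfun v r)) = I u t - I v t"
      unfolding I_def using t
      by (subst integral_diff) (auto intro!: integrable_on_subinterval[OF int[OF e]])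
    finally have "\<bar>I u t - I v t\<bar> / exp (\<kappa> * (t - s)) \<le> dist u v / 2"
      by (simp add: divide_le_eq \<kappa>_def)
    then show "dist (apply_bcontfun (\<Phi> u) t0) (apply_bcontfun (\<Phi> v) t0) \<le> 1 / 2 * dist u v"
      by (simp add: \<Phi> dist_real_def \<Psi>_def t_def[symmetric] flip: diff_divide_distrib)
  qed
  then obtain u where u: "\<Phi> u = u"
    using banach_fix_type[of "1/2" \<Phi>] by auto
  define Z where "Z r = exp (\<kappa> * (r - s)) * apply_bcontfun u r" for r
  have "Z t = I u t" if "t \<in> {s..T}" for t
    using that \<Phi>[of u t] by (simp add: u Z_def \<Psi>_def max_absorb2 min_absorb2)
  with e[of u] show ?thesis
    by (intro exI[of _ Z]) (auto simp: Z_def I_def)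
qed

lemma picard_unique:
  fixes f :: "real \<Rightarrow> real \<Rightarrow> real"
  assumes "0 \<le> K"
    and int: "\<And>u. continuous_on {s..T} u \<Longrightarrow> (\<lambda>r. f r (u r)) integrable_on {s..T}"
    and lip: "\<And>r z z'. r \<in> {s..T} \<Longrightarrow> \<bar>f r z - f r z'\<bar> \<le> K * \<bar>z - z'\<bar>"
    and Z: "continuous_on {s..T} Z" "\<And>t. t \<in> {s..T} \<Longrightarrow> Z t = g t + integral {s..t} (\<lambda>r. f r (Z r))"
    and Z': "continuous_on {s..T} Z'" "\<And>t. t \<in> {s..T} \<Longrightarrow> Z' t = g t + integral {s..t} (\<lambda>r. f r (Z' r))"
    and t: "t \<in> {s..T}"
  shows "Z t = Z' t"
proof -
  let ?h = "\<lambda>r. f r (Z r) - f r (Z' r)"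
  have "\<bar>Z t - Z' t\<bar> \<le> 2 * (0 + 0 * (T - s)) * exp ((2 * K + 1) * (T - s))"
  proof (rule gronwall[where u = "\<lambda>t. Z t - Z' t" and h = ?h])
    show "?h integrable_on {s..T}" by (intro integrable_diff int Z(1) Z'(1))
    show "\<bar>?h r\<bar> \<le> 0 + K * \<bar>Z r - Z' r\<bar>" if "r \<in> {s..T}" for r using lip[OF that] by simp
    fix t assume t: "t \<in> {s..T}"
    then have "{s..t} \<subseteq> {s..T}" by auto
    note int' = integrable_on_subinterval[OF int this]
    show "\<bar>Z t - Z' t\<bar> \<le> 0 + \<bar>integral {s..t} ?h\<bar>"
      using Z(2)[OF t] Z'(2)[OF t] by (subst integral_diff) (auto intro!: int' Z(1) Z'(1))
  qed (use t Z(1) Z'(1) \<open>0 \<le> K\<close> in \<open>auto intro!: continuous_intros\<close>)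
  then show ?thesis by simp
qed

section \<open>Stieltjes measures of Lipschitz functions\<close>

text \<open>Lebesgue measure will be recognized by its values on open boxes, while Stieltjes
  measures are given on closed intervals; continuity of \<open>F\<close> makes the two endpoints
  null.\<close>

lemma interval_measure_box:
  fixes F :: "real \<Rightarrow> real"
  assumes "a \<le> b" "mono F" "continuous_on UNIV F"
  shows "emeasure (interval_measure F) {a<..<b} = ennreal (F b - F a)"
proof -
  have mono: "x \<le> y \<Longrightarrow> F x \<le> F y" for x y using \<open>mono F\<close> by (auto dest: monoD)
  have Icc: "emeasure (interval_measure F) {u..v} = ennreal (F v - F u)" if "u \<le> v" for u v
    using that mono assms(3) by (intro emeasure_interval_measure_Icc)
  show ?thesis
  proof (cases "a = b")
    case False
    have "emeasure (interval_measure F) {a..b} = emeasure (interval_measure F) ({a<..<b} \<union> {a, b})"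
      using \<open>a \<le> b\<close> by (intro arg_cong[where f = "emeasure _"]) auto
    also have "\<dots> = emeasure (interval_measure F) {a<..<b}"
    proof (rule emeasure_Un_null_set)
      have "{a} \<in> null_sets (interval_measure F)" "{b} \<in> null_sets (interval_measure F)"
        using Icc[of a a] Icc[of b b] by (auto simp: null_sets_def)
      then have "{a} \<union> {b} \<in> null_sets (interval_measure F)" by (rule null_sets.Un)
      then show "{a, b} \<in> null_sets (interval_measure F)" by (simp add: insert_is_Un[of a "{b}"])
    qed simp
    finally show ?thesis using Icc[OF \<open>a \<le> b\<close>] by simp
  qed simp
qed

text \<open>The upper slope bound says exactly that \<open>\<Lambda> * r - F r\<close> is
  nondecreasing too, so it has a Stieltjes measure of its own. The sum of the two measures, divided
  by \<open>\<Lambda>\<close>, gives each box its length and hence is \<open>lborel\<close>.\<close>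

lemma interval_measure_complement:
  fixes F :: "real \<Rightarrow> real"
  assumes "0 < \<Lambda>" and F: "\<And>x y. x \<le> y \<Longrightarrow> 0 \<le> F y - F x \<and> F y - F x \<le> \<Lambda> * (y - x)"
    and A: "A \<in> sets borel"
  shows "emeasure (interval_measure F) A + emeasure (interval_measure (\<lambda>r. \<Lambda> * r - F r)) A = ennreal \<Lambda> * emeasure lborel A"
proof -
  let ?G = "\<lambda>r. \<Lambda> * r - F r"
  let ?\<mu> = "emeasure (interval_measure F)" and ?\<nu> = "emeasure (interval_measure ?G)"
  have "\<Lambda>-lipschitz_on UNIV F"
  proof (rule lipschitz_onI)
    fix x y show "dist (F x) (F y) \<le> \<Lambda> * dist x y"
      using F[of x y] F[of y x] by (cases "x \<le> y") (auto simp: dist_real_def)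
  qed (use \<open>0 < \<Lambda>\<close> in simp)
  then have c: "continuous_on UNIV F" by (rule lipschitz_on_continuous_on)
  have "mono F" using F by (auto intro!: monoI)
  moreover have "mono ?G"
  proof (rule monoI)
    fix x y :: real assume "x \<le> y"
    with F[of x y] show "?G x \<le> ?G y" by (simp add: right_diff_distrib)
  qed
  ultimately have m: "mono F" "mono ?G" by auto
  define N where "N = measure_of UNIV (sets borel)
    (\<lambda>A. (?\<mu> A + ?\<nu> A) / ennreal \<Lambda>)"
  have sN: "sets N = sets borel" by (simp add: N_def sigma_algebra.sets_measure_of_eq[OF sets.sigma_algebra_axioms, of borel, simplified])
  have N: "emeasure N B = (?\<mu> B + ?\<nu> B) / ennreal \<Lambda>"
    if B: "B \<in> sets borel" for B
  proof (rule emeasure_measure_of[OF N_def])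
    show "countably_additive (sets N)
      (\<lambda>A. (?\<mu> A + ?\<nu> A) / ennreal \<Lambda>)"
      unfolding countably_additive_def
    proof safe
      fix A :: "nat \<Rightarrow> real set" assume A: "range A \<subseteq> sets N" "disjoint_family A"
      then have "(\<Sum>i. ?\<mu> (A i)) = ?\<mu> (\<Union> (range A))"
        "(\<Sum>i. ?\<nu> (A i)) = ?\<nu> (\<Union> (range A))"
        by (auto intro!: suminf_emeasure simp: sN)
      then show "(\<Sum>i. (?\<mu> (A i) + ?\<nu> (A i)) / ennreal \<Lambda>)
          = (?\<mu> (\<Union> (range A)) + ?\<nu> (\<Union> (range A))) / ennreal \<Lambda>"
        by (simp add: suminf_add[symmetric])
    qed
  qed (use B in \<open>auto simp: sN positive_def\<close>)
  have "lborel = N"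
  proof (rule lborel_eqI)
    fix l u :: real assume "\<And>b. b \<in> Basis \<Longrightarrow> l \<bullet> b \<le> u \<bullet> b"
    then have "l \<le> u" by simp
    have "emeasure N {l<..<u} = (ennreal (F u - F l) + ennreal (?G u - ?G l)) / ennreal \<Lambda>"
      using \<open>l \<le> u\<close> m c by (subst N) (auto intro!: interval_measure_box continuous_intros arg_cong2[where f="\<lambda>a b. (a + b) / ennreal \<Lambda>"])
    also have "\<dots> = ennreal ((F u - F l + (?G u - ?G l)) / \<Lambda>)"
      using F[OF \<open>l \<le> u\<close>] \<open>0 < \<Lambda>\<close>
      by (subst ennreal_plus[symmetric], simp, simp add: right_diff_distrib)
        (rule divide_ennreal, auto simp: \<open>l \<le> u\<close> simp flip: right_diff_distrib)
    also have "(F u - F l + (?G u - ?G l)) / \<Lambda> = u - l"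
      using \<open>0 < \<Lambda>\<close> by (simp add: right_diff_distrib[symmetric])
    finally show "emeasure N (box l u) = ennreal (prod ((\<bullet>) (u - l)) Basis)"
      by (simp add: box_real)
  qed (simp add: sN)
  then have "ennreal \<Lambda> * emeasure lborel A = ennreal \<Lambda> * ((?\<mu> A + ?\<nu> A) / ennreal \<Lambda>)"
    using N[OF A] by simp
  also have "\<dots> = ?\<mu> A + ?\<nu> A"
    using \<open>0 < \<Lambda>\<close> by (subst ennreal_times_divide, subst mult.commute, intro ennreal_mult_divide_eq) auto
  finally show ?thesis by simp
qed

text \<open>The measures of \<open>F\<close> and of its complement are both dominated by a multiple
  of Lebesgue measure, so both have Radon-Nikodym densities. Uniqueness of densities makes these add
  up to \<open>\<Lambda>\<close> almost everywhere, which bounds each of them.\<close>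

lemma interval_measure_density:
  fixes F :: "real \<Rightarrow> real"
  assumes "0 < \<Lambda>" and F: "\<And>x y. x \<le> y \<Longrightarrow> 0 \<le> F y - F x \<and> F y - F x \<le> \<Lambda> * (y - x)"
  obtains g where "g \<in> borel_measurable borel" "\<And>r. 0 \<le> g r \<and> g r \<le> \<Lambda>"
    "interval_measure F = density lborel (\<lambda>r. ennreal (g r))"
proof -
  let ?G = "\<lambda>r. \<Lambda> * r - F r"
  have sum: "emeasure (interval_measure F) A + emeasure (interval_measure ?G) A = ennreal \<Lambda> * emeasure lborel A"
    if "A \<in> sets borel" for A
    by (rule interval_measure_complement[OF \<open>0 < \<Lambda>\<close> F that])
  have RN: "\<exists>f \<in> borel_measurable lborel. density lborel f = interval_measure H" if "H = F \<or> H = ?G" for H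
  proof (rule sigma_finite_measure.Radon_Nikodym[OF lborel.sigma_finite_measure_axioms])
    show "absolutely_continuous lborel (interval_measure H)"
      unfolding absolutely_continuous_def
    proof
      fix A :: "real set" assume A: "A \<in> null_sets lborel"
      then have "emeasure (interval_measure F) A + emeasure (interval_measure ?G) A = 0"
        using sum[of A] by (simp add: null_sets_def)
      then show "A \<in> null_sets (interval_measure H)" using that A by (auto simp: null_sets_def)
    qed
  qed simp
  from RN[of F] RN[of ?G] obtain f h where f: "f \<in> borel_measurable lborel" "density lborel f = interval_measure F"
    and h: "h \<in> borel_measurable lborel" "density lborel h = interval_measure ?G"
    by auto
  have "density lborel (\<lambda>r. f r + h r) = density lborel (\<lambda>_. ennreal \<Lambda>)"
  proof (rule measure_eqI)
    fix A assume "A \<in> sets (density lborel (\<lambda>r. f r + h r))"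
    then have A: "A \<in> sets borel" by simp
    have "emeasure (density lborel (\<lambda>r. f r + h r)) A = emeasure (density lborel f) A + emeasure (density lborel h) A"
      using A f(1) h(1) by (simp add: emeasure_density distrib_right nn_integral_add)
    also have "\<dots> = ennreal \<Lambda> * emeasure lborel A" using sum[OF A] f(2) h(2) by simp
    finally show "emeasure (density lborel (\<lambda>r. f r + h r)) A = emeasure (density lborel (\<lambda>_. ennreal \<Lambda>)) A"
      using A by (simp add: emeasure_density nn_integral_cmult_indicator)
  qed simp
  then have "AE r in lborel. f r + h r = ennreal \<Lambda>"
    using f(1) h(1)
    by (subst (asm) sigma_finite_measure.density_unique_iff[OF lborel.sigma_finite_measure_axioms]) auto
  \<comment> \<open>Truncating at \<open>\<Lambda>\<close> changes the density on a null set only,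
    but makes it real and bounded at every point.\<close>
  then have "AE r in lborel. f r = ennreal (min \<Lambda> (enn2real (f r)))"
  proof eventually_elim
    fix r assume "f r + h r = ennreal \<Lambda>"
    moreover have "f r \<le> f r + h r" by (intro add_increasing2) auto
    ultimately have "f r \<le> ennreal \<Lambda>" by simp
    then obtain c where "f r = ennreal c" "0 \<le> c" "c \<le> \<Lambda>"
      using \<open>0 < \<Lambda>\<close> by (cases "f r") (auto simp: top_unique)
    then show "f r = ennreal (min \<Lambda> (enn2real (f r)))" by simp
  qed
  then have "density lborel f = density lborel (\<lambda>r. ennreal (min \<Lambda> (enn2real (f r))))"
    using f(1) by (intro density_cong) auto
  with f \<open>0 < \<Lambda>\<close> show thesis by (intro that[of "\<lambda>r. min \<Lambda> (enn2real (f r))"]) auto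
qed

lemma set_integrable_bounded_times_continuous:
  fixes g h :: "real \<Rightarrow> real"
  assumes [measurable]: "g \<in> borel_measurable borel" and "\<And>r. \<bar>g r\<bar> \<le> C" and "continuous_on {s..t} h"
  shows "set_integrable lborel {s..t} (\<lambda>r. g r * h r)"
proof -
  have [measurable]: "(\<lambda>r. indicator {s..t} r *\<^sub>R h r) \<in> borel_measurable borel"
    using assms(3) by (intro borel_measurable_continuous_on_indicator) auto
  have "set_integrable lborel {s..t} (\<lambda>r. C * h r)"
    using assms(3) by (intro set_integrable_mult_right borel_integrable_atLeastAtMost') auto
  then show ?thesis
  proof (rule set_integrable_bound)
    have "(\<lambda>r. g r * (indicator {s..t} r *\<^sub>R h r)) \<in> borel_measurable lborel" by measurable
    then show "set_borel_measurable lborel {s..t} (\<lambda>r. g r * h r)"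
      by (simp add: set_borel_measurable_def mult.left_commute)
    have "\<bar>g r\<bar> * \<bar>h r\<bar> \<le> \<bar>C\<bar> * \<bar>h r\<bar>" for r
      using assms(2)[of r] by (intro mult_right_mono) auto
    then show "AE r in lborel. r \<in> {s..t} \<longrightarrow> norm (g r * h r) \<le> norm (C * h r)"
      by (auto simp: abs_mult)
  qed
qed

text \<open>The density depends on \<open>q\<close> alone: it is fixed once for a path and then
  serves all integrands, intervals, parameters and starting points.\<close>

lemma stieltjes_density:
  assumes "0 < \<Lambda>" "0 \<le> T"
    and q: "\<And>s t. 0 \<le> s \<Longrightarrow> s \<le> t \<Longrightarrow> t \<le> T \<Longrightarrow> 0 \<le> q t - q s \<and> q t - q s \<le> \<Lambda> * (t - s)"
  obtains g where "g \<in> borel_measurable borel" "\<And>r. 0 \<le> g r \<and> g r \<le> \<Lambda>"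
    "\<And>h s t. continuous_on {s..t} h \<Longrightarrow>
      (LINT r:{s..t}|stieltjes T q. h r) = integral {s..t} (\<lambda>r. g r * h r)"
proof -
  let ?c = "\<lambda>r. max 0 (min T r)"
  have H: "0 \<le> q (?c y) - q (?c x) \<and> q (?c y) - q (?c x) \<le> \<Lambda> * (y - x)" if "x \<le> y" for x y
  proof -
    have "0 \<le> q (?c y) - q (?c x) \<and> q (?c y) - q (?c x) \<le> \<Lambda> * (?c y - ?c x)"
      using that \<open>0 \<le> T\<close> by (intro q) auto
    moreover have "\<Lambda> * (?c y - ?c x) \<le> \<Lambda> * (y - x)"
      using that \<open>0 < \<Lambda>\<close> by (intro mult_left_mono) auto
    ultimately show ?thesis by linarith
  qed
  obtain g where g: "g \<in> borel_measurable borel" "\<And>r. 0 \<le> g r \<and> g r \<le> \<Lambda>"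
    and "interval_measure (\<lambda>r. q (?c r)) = density lborel (\<lambda>r. ennreal (g r))"
    by (rule interval_measure_density[OF \<open>0 < \<Lambda>\<close> H]) (assumption | rule that)+
  then have d: "stieltjes T q = density lborel (\<lambda>r. ennreal (g r))" by (simp add: stieltjes_def)
  have "(LINT r:{s..t}|stieltjes T q. h r) = integral {s..t} (\<lambda>r. g r * h r)"
    if h: "continuous_on {s..t} h" for h s t
  proof -
    have m: "(\<lambda>r. indicator {s..t} r *\<^sub>R h r) \<in> borel_measurable lborel"
      using borel_measurable_continuous_on_indicator[OF _ h] by simp
    have "(LINT r:{s..t}|stieltjes T q. h r) = (LBINT r. g r *\<^sub>R (indicator {s..t} r *\<^sub>R h r))"
      unfolding set_lebesgue_integral_def d using g m by (intro integral_density) auto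
    also have "\<dots> = (LBINT r:{s..t}. g r * h r)"
      unfolding set_lebesgue_integral_def by (simp add: mult.left_commute)
    also have "\<dots> = integral {s..t} (\<lambda>r. g r * h r)"
    proof (rule set_borel_integral_eq_integral)
      have "\<bar>g r\<bar> \<le> \<Lambda>" for r using g(2)[of r] by auto
      then show "set_integrable lborel {s..t} (\<lambda>r. g r * h r)"
        using g(1) h by (intro set_integrable_bounded_times_continuous)
    qed
    finally show ?thesis .
  qed
  with g that show thesis by blast
qed

section \<open>The bracket functional\<close>

lemma lip_regularization_le:
  assumes "0 \<le> \<Lambda>" "0 \<le> u" "u \<le> t" "\<And>u. 0 \<le> a u"
  shows "lip_regularization \<Lambda> a t \<le> a u + \<Lambda> * (t - u)"
  unfolding lip_regularization_def
proof (rule cINF_lower)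
  have "0 \<le> a v + \<Lambda> * (t - v)" if "v \<in> {0..t}" for v using that assms by (auto intro!: add_nonneg_nonneg mult_nonneg_nonneg)
  then show "bdd_below ((\<lambda>u. a u + \<Lambda> * (t - u)) ` {0..t})" by (intro bdd_belowI[of _ 0]) auto
qed (use assms in auto)

text \<open>This is the infimal convolution of \<open>a\<close> with the slope
  \<open>\<Lambda>\<close>. For monotonicity in time, a candidate \<open>u \<le> s\<close> is used
  at time \<open>s\<close> as it stands, and a candidate \<open>u > s\<close> is replaced by
  \<open>s\<close>, where \<open>a\<close> is not larger.\<close>

lemma lip_regularization_lipschitz:
  assumes "0 \<le> \<Lambda>" "\<And>u. 0 \<le> a u" "mono a" "0 \<le> s" "s \<le> t"
  shows "lip_regularization \<Lambda> a s \<le> lip_regularization \<Lambda> a t"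
    and "lip_regularization \<Lambda> a t \<le> lip_regularization \<Lambda> a s + \<Lambda> * (t - s)"
    and "0 \<le> lip_regularization \<Lambda> a t"
proof -
  show "lip_regularization \<Lambda> a s \<le> lip_regularization \<Lambda> a t"
    unfolding lip_regularization_def[of _ _ t]
  proof (rule cINF_greatest)
    fix u assume u: "u \<in> {0..t}"
    show "lip_regularization \<Lambda> a s \<le> a u + \<Lambda> * (t - u)"
    proof (cases "u \<le> s")
      case True
      then have "lip_regularization \<Lambda> a s \<le> a u + \<Lambda> * (s - u)"
        using assms u by (intro lip_regularization_le) auto
      also have "\<dots> \<le> a u + \<Lambda> * (t - u)" using assms by (auto intro!: mult_left_mono)
      finally show ?thesis .
    next
      case False
      then have "lip_regularization \<Lambda> a s \<le> a s + \<Lambda> * (s - s)"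
        using assms by (intro lip_regularization_le) auto
      also have "\<dots> \<le> a u + \<Lambda> * (t - u)"
        using monoD[OF \<open>mono a\<close>, of s u] mult_nonneg_nonneg[of \<Lambda> "t - u"] assms(1) False u
        by (auto simp del: mult_nonneg_nonneg)
      finally show ?thesis .
    qed
  qed (use assms in auto)
  have "lip_regularization \<Lambda> a t - \<Lambda> * (t - s) \<le> lip_regularization \<Lambda> a s"
    unfolding lip_regularization_def[of _ _ s]
  proof (rule cINF_greatest)
    fix u assume u: "u \<in> {0..s}"
    then have "lip_regularization \<Lambda> a t \<le> a u + \<Lambda> * (t - u)"
      using assms by (intro lip_regularization_le) auto
    then show "lip_regularization \<Lambda> a t - \<Lambda> * (t - s) \<le> a u + \<Lambda> * (s - u)"
      by (simp add: algebra_simps)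
  qed (use assms in auto)
  then show "lip_regularization \<Lambda> a t \<le> lip_regularization \<Lambda> a s + \<Lambda> * (t - s)" by simp
  show "0 \<le> lip_regularization \<Lambda> a t"
    unfolding lip_regularization_def using assms by (intro cINF_greatest) auto
qed

text \<open>Finiteness of the index set is the point: a sum over an infinite set would be 0 by
  convention, and enlarging the set could then lower the value.\<close>

lemma dyadic_variation_mono:
  assumes "0 < T"
  shows "mono (dyadic_variation T n x)"
proof (rule monoI)
  fix s t :: real assume "s \<le> t"
  have "finite {k. real (Suc k) * T / 2 ^ n \<le> t}"
  proof (rule finite_subset)
    show "{k. real (Suc k) * T / 2 ^ n \<le> t} \<subseteq> {..nat \<lceil>t * 2 ^ n / T\<rceil>}"
    proof safe
      fix k assume "real (Suc k) * T / 2 ^ n \<le> t"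
      then have "real k * T + T \<le> t * 2 ^ n" by (simp add: field_simps)
      then have "real k * T \<le> t * 2 ^ n" using assms by linarith
      then have "real k \<le> t * 2 ^ n / T" using assms by (simp add: field_simps)
      then show "k \<le> nat \<lceil>t * 2 ^ n / T\<rceil>" by linarith
    qed
  qed simp
  with \<open>s \<le> t\<close> show "dyadic_variation T n x s \<le> dyadic_variation T n x t"
    unfolding dyadic_variation_def by (intro sum_mono2) auto
qed

lemma dyadic_variation_0: "0 < T \<Longrightarrow> dyadic_variation T n x 0 = 0"
proof -
  assume "0 < T"
  then have "0 < real (Suc k) * T / 2 ^ n" for k by simp
  then have "{k. real (Suc k) * T / 2 ^ n \<le> 0} = {}" using not_le by blast
  then show ?thesis by (simp only: dyadic_variation_def sum.empty)
qed

text \<open>Each approximation is nondecreasing with slope at most \<open>\<Lambda>\<close>, and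
  both inequalities survive the limsup. Since \<open>real_of_ereal\<close> sends infinite values to
  0, the limsup is first bounded between 0 and \<open>\<Lambda> * u\<close>.\<close>

lemma bracket_functional_lipschitz:
  assumes "0 < T" "0 \<le> \<Lambda>" "0 \<le> s" "s \<le> t"
  shows "0 \<le> bracket_functional T \<Lambda> x t - bracket_functional T \<Lambda> x s
    \<and> bracket_functional T \<Lambda> x t - bracket_functional T \<Lambda> x s \<le> \<Lambda> * (t - s)"
proof -
  let ?l = "\<lambda>t. limsup (\<lambda>n. ereal (bracket_approx T \<Lambda> n x t))"
  have pos: "0 \<le> dyadic_variation T n x u" for n u
    unfolding dyadic_variation_def by (intro sum_nonneg) auto
  note lip = lip_regularization_lipschitz[OF \<open>0 \<le> \<Lambda>\<close>, of "dyadic_variation T _ x",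
      OF pos dyadic_variation_mono[OF \<open>0 < T\<close>], folded bracket_approx_def]
  have fin: "\<bar>?l u\<bar> \<noteq> \<infinity>" if "0 \<le> u" for u
  proof -
    have "bracket_approx T \<Lambda> n x u \<le> \<Lambda> * u" for n
      using lip_regularization_le[of \<Lambda> 0 u "dyadic_variation T n x"] that assms pos
      by (simp add: bracket_approx_def dyadic_variation_0)
    then have "?l u \<le> limsup (\<lambda>n. ereal (\<Lambda> * u))" by (intro Limsup_mono) auto
    then have "?l u \<le> ereal (\<Lambda> * u)" by (simp add: Limsup_const)
    have "limsup (\<lambda>n. 0) \<le> ?l u" using lip(3)[of u u] that by (intro Limsup_mono) auto
    then have "0 \<le> ?l u" by (simp add: Limsup_const)
    then show ?thesis using \<open>?l u \<le> ereal (\<Lambda> * u)\<close> by (cases "?l u") auto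
  qed
  obtain a b where ab: "?l s = ereal a" "?l t = ereal b"
    using fin[of s] fin[of t] assms by (cases "?l s"; cases "?l t") auto
  have "?l s \<le> ?l t" using lip(1)[of s t] assms by (intro Limsup_mono) auto
  moreover have "?l t \<le> limsup (\<lambda>n. ereal (bracket_approx T \<Lambda> n x s) + ereal (\<Lambda> * (t - s)))"
    using lip(2)[of s t] assms by (intro Limsup_mono) auto
  then have "?l t \<le> ?l s + ereal (\<Lambda> * (t - s))"
    by (subst (asm) Limsup_add_ereal_right) auto
  ultimately show ?thesis
    by (simp add: bracket_functional_def ab)
qed

section \<open>Continuously differentiable maps\<close>

text \<open>Between euclidean spaces, continuity of \<open>f' u h\<close> in \<open>u\<close> for
  each fixed \<open>h\<close> already gives continuity of the derivative in operator norm.\<close>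

lemma C1_map_onI:
  fixes f :: "'a::euclidean_space \<Rightarrow> 'b::euclidean_space"
  assumes d: "\<And>u. u \<in> S \<Longrightarrow> (f has_derivative f' u) (at u)"
    and c: "\<And>h. continuous_on S (\<lambda>u. f' u h)"
  shows "C1_map_on S f"
  unfolding C1_map_on_def
proof (intro exI conjI ballI)
  have app: "blinfun_apply (Blinfun (f' u)) = f' u" if "u \<in> S" for u
    using has_derivative_bounded_linear[OF d[OF that]] by (rule bounded_linear_Blinfun_apply)
  then show "(f has_derivative blinfun_apply (Blinfun (f' u))) (at u)" if "u \<in> S" for u
    using d that by simp
  show "continuous_on S (\<lambda>u. Blinfun (f' u))"
    by (rule continuous_on_blinfun_componentwise) (simp add: app c cong: continuous_on_cong)
qed

lemma C1_map_onE:
  assumes "C1_map_on S f"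
  obtains D where "\<And>u. u \<in> S \<Longrightarrow> (f has_derivative blinfun_apply (D u)) (at u)" "continuous_on S D"
  using assms unfolding C1_map_on_def by blast

lemma C1_map_on_subset: "C1_map_on S f \<Longrightarrow> R \<subseteq> S \<Longrightarrow> C1_map_on R f"
  unfolding C1_map_on_def by (auto intro: continuous_on_subset)

lemma C1_map_on_imp_continuous_on: "C1_map_on S f \<Longrightarrow> continuous_on S f"
  by (erule C1_map_onE) (auto intro!: continuous_at_imp_continuous_on has_derivative_continuous)

lemma C1_map_on_cong:
  assumes "open S" "C1_map_on S f" "\<And>u. u \<in> S \<Longrightarrow> f u = g u"
  shows "C1_map_on S g"
proof -
  obtain D where D: "\<And>u. u \<in> S \<Longrightarrow> (f has_derivative blinfun_apply (D u)) (at u)" "continuous_on S D"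
    by (rule C1_map_onE[OF assms(2)]) blast
  have "(g has_derivative blinfun_apply (D u)) (at u)" if "u \<in> S" for u
    by (rule has_derivative_transform_within_open[OF D(1) assms(1)]) (use that assms(3) in auto)
  with D(2) show ?thesis unfolding C1_map_on_def by (intro exI[of _ D] conjI ballI)
qed

lemma C1_map_on_linear: "bounded_linear f \<Longrightarrow> C1_map_on S f"
  unfolding C1_map_on_def
  by (intro exI[of _ "\<lambda>_. Blinfun f"])
    (auto simp: bounded_linear_Blinfun_apply intro!: bounded_linear_imp_has_derivative)

lemma C1_map_on_const: "C1_map_on S (\<lambda>_. c)"
  unfolding C1_map_on_def by (intro exI[of _ "\<lambda>_. 0"]) (auto simp: zero_blinfun.rep_eq)

lemma C1_map_on_compose:
  assumes "C1_map_on R f" "C1_map_on S g" "g ` S \<subseteq> R"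
  shows "C1_map_on S (\<lambda>u. f (g u))"
proof -
  obtain Df where f: "\<And>u. u \<in> R \<Longrightarrow> (f has_derivative blinfun_apply (Df u)) (at u)" "continuous_on R Df"
    by (rule C1_map_onE[OF assms(1)]) blast
  obtain Dg where g: "\<And>u. u \<in> S \<Longrightarrow> (g has_derivative blinfun_apply (Dg u)) (at u)" "continuous_on S Dg"
    by (rule C1_map_onE[OF assms(2)]) blast
  show ?thesis
    unfolding C1_map_on_def
  proof (intro exI conjI ballI)
    fix u assume "u \<in> S"
    then show "((\<lambda>u. f (g u)) has_derivative blinfun_apply (Df (g u) o\<^sub>L Dg u)) (at u)"
      using has_derivative_compose[OF g(1) f(1), of u] assms(3)
      by (auto simp: blinfun_compose.rep_eq o_def image_subset_iff)
  next
    show "continuous_on S (\<lambda>u. Df (g u) o\<^sub>L Dg u)"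
      using f(2) g(2) assms(3) C1_map_on_imp_continuous_on[OF assms(2)]
      by (intro bounded_bilinear.continuous_on[OF bounded_bilinear_blinfun_compose]
          continuous_on_compose2[OF f(2)]) auto
  qed
qed

lemma C1_map_on_Pair:
  fixes f :: "'a::euclidean_space \<Rightarrow> 'b::euclidean_space" and g :: "'a \<Rightarrow> 'c::euclidean_space"
  assumes "C1_map_on S f" "C1_map_on S g"
  shows "C1_map_on S (\<lambda>u. (f u, g u))"
proof -
  obtain Df where f: "\<And>u. u \<in> S \<Longrightarrow> (f has_derivative blinfun_apply (Df u)) (at u)" "continuous_on S Df"
    by (rule C1_map_onE[OF assms(1)]) blast
  obtain Dg where g: "\<And>u. u \<in> S \<Longrightarrow> (g has_derivative blinfun_apply (Dg u)) (at u)" "continuous_on S Dg"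
    by (rule C1_map_onE[OF assms(2)]) blast
  show ?thesis
    using f g by (intro C1_map_onI[of S _ "\<lambda>u h. (Df u h, Dg u h)"] has_derivative_Pair continuous_intros)
qed

lemma C1_map_on_mult:
  fixes f g :: "'a::euclidean_space \<Rightarrow> real"
  assumes "C1_map_on S f" "C1_map_on S g"
  shows "C1_map_on S (\<lambda>u. f u * g u)"
proof -
  have "C1_map_on UNIV (\<lambda>p::real \<times> real. fst p * snd p)"
    by (rule C1_map_onI[where f' = "\<lambda>p h. fst p * snd h + fst h * snd p"])
      (auto intro!: derivative_eq_intros continuous_intros)
  from C1_map_on_compose[OF this C1_map_on_Pair[OF assms]] show ?thesis by simp
qed

lemma C1_map_on_divide:
  fixes f g :: "'a::euclidean_space \<Rightarrow> real"
  assumes "C1_map_on S f" "C1_map_on S g" "\<And>u. u \<in> S \<Longrightarrow> g u \<noteq> 0"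
  shows "C1_map_on S (\<lambda>u. f u / g u)"
proof -
  have "C1_map_on {r. r \<noteq> 0} (inverse :: real \<Rightarrow> real)"
    by (rule C1_map_onI[where f' = "\<lambda>r h. - (inverse r * h * inverse r)"])
      (auto intro!: derivative_eq_intros continuous_intros)
  moreover have "g ` S \<subseteq> {r. r \<noteq> 0}" using assms(3) by auto
  ultimately have "C1_map_on S (\<lambda>u. inverse (g u))" by (rule C1_map_on_compose[OF _ assms(2)])
  from C1_map_on_mult[OF assms(1) this] show ?thesis by (simp add: divide_inverse)
qed

text \<open>Needed for the Lamperti transform, whose joint smoothness in parameter and state is read
  off an integral over the fixed interval from 0 to 1.\<close>

lemma C1_map_on_integral:
  fixes f :: "'a::euclidean_space \<times> real \<Rightarrow> real"
  assumes "open S" "C1_map_on (S \<times> UNIV) f"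
  shows "C1_map_on S (\<lambda>u. integral {0..1} (\<lambda>\<tau>. f (u, \<tau>)))"
proof -
  obtain D where D: "\<And>u. u \<in> S \<times> UNIV \<Longrightarrow> (f has_derivative blinfun_apply (D u)) (at u)" "continuous_on (S \<times> UNIV) D"
    by (rule C1_map_onE[OF assms(2)]) blast
  define E where "E u \<tau> = D (u, \<tau>) o\<^sub>L Blinfun (\<lambda>h::'a. (h, 0::real))" for u \<tau>
  have bl: "bounded_linear (\<lambda>h::'a. (h, 0::real))"
    by (intro bounded_linear_Pair bounded_linear_ident bounded_linear_zero)
  have dE: "((\<lambda>u. f (u, \<tau>)) has_derivative blinfun_apply (E u \<tau>)) (at u)" if "u \<in> S" for u \<tau>
  proof -
    have "((\<lambda>u. (u, \<tau>)) has_derivative (\<lambda>h. (h, 0))) (at u)"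
      by (auto intro!: derivative_eq_intros)
    from has_derivative_compose[OF this D(1)] that show ?thesis
      by (simp add: E_def blinfun_compose.rep_eq o_def bounded_linear_Blinfun_apply[OF bl])
  qed
  have cE: "continuous_on (R \<times> cbox 0 1) (\<lambda>(u, \<tau>). E u \<tau>)" if "R \<subseteq> S" for R
    unfolding E_def split_beta
    using that by (intro bounded_bilinear.continuous_on[OF bounded_bilinear_blinfun_compose]
        continuous_on_compose2[OF D(2)] continuous_intros) auto
  have "((\<lambda>u. integral (cbox 0 1) (\<lambda>\<tau>. f (u, \<tau>))) has_derivative blinfun_apply (integral (cbox 0 1) (E u))) (at u)"
    if "u \<in> S" for u
  proof -
    \<comment> \<open>The rule for differentiating under the integral sign works on a convex set,
      hence the restriction to a ball.\<close>
    obtain e where e: "e > 0" "ball u e \<subseteq> S" using assms(1) \<open>u \<in> S\<close> by (auto simp: open_contains_ball)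
    have cf: "continuous_on (cbox 0 1) (\<lambda>\<tau>. f (x, \<tau>))" if "x \<in> S" for x
      using that by (intro continuous_on_compose2[OF C1_map_on_imp_continuous_on[OF assms(2)]] continuous_intros) auto
    have "((\<lambda>u. integral (cbox 0 1) (\<lambda>\<tau>. f (u, \<tau>))) has_derivative blinfun_apply (integral (cbox 0 1) (E u))) (at u within ball u e)"
      using e by (intro leibniz_rule cE has_derivative_at_withinI[OF dE] integrable_continuous cf) auto
    then show ?thesis using at_within_open[of u "ball u e"] e by simp
  qed
  moreover have "continuous_on S (\<lambda>u. integral (cbox 0 1) (E u))"
    by (intro integral_continuous_on_param cE) auto
  ultimately show ?thesis
    unfolding C1_map_on_def box_real(2)[symmetric]
    by (intro exI[of _ "\<lambda>u. integral (cbox 0 1) (E u)"] conjI ballI)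
qed

text \<open>The derivative is uniformly continuous on a compact closed neighbourhood of
  \<open>C\<close>. The mean value inequality for \<open>f\<close> minus its linearization at
  \<open>u\<close>, on a ball around \<open>u\<close>, then gives one radius for all base
  points.\<close>

lemma C1_map_on_uniform_expansion:
  fixes f :: "'a::euclidean_space \<Rightarrow> real"
  assumes "open S" "compact C" "C \<subseteq> S" "0 < \<epsilon>"
    and f: "\<And>u. u \<in> S \<Longrightarrow> (f has_derivative blinfun_apply (D u)) (at u)" "continuous_on S D"
  shows "\<exists>\<delta>>0. \<forall>u\<in>C. \<forall>h. norm h \<le> \<delta> \<longrightarrow> \<bar>f (u + h) - f u - D u h\<bar> \<le> \<epsilon> * norm h"
proof -
  obtain e where e: "e > 0" "(\<Union>u\<in>C. cball u e) \<subseteq> S"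
    using compact_subset_open_imp_cball_epsilon_subset[OF assms(2,1,3)] by auto
  define B where "B = (\<Union>u\<in>C. cball u e)"
  \<comment> \<open>Written as the sum of \<open>C\<close> and a closed ball, the neighbourhood is
    visibly compact.\<close>
  have "B = {x + y |x y. x \<in> C \<and> y \<in> cball 0 e}"
  proof safe
    fix x assume "x \<in> B"
    then obtain u where "u \<in> C" "dist u x \<le> e" by (auto simp: B_def)
    then show "\<exists>u y. x = u + y \<and> u \<in> C \<and> y \<in> cball 0 e"
      by (intro exI[of _ u] exI[of _ "x - u"]) (auto simp: dist_norm norm_minus_commute)
  next
    fix u y :: 'a assume "u \<in> C" "y \<in> cball 0 e"
    then show "u + y \<in> B" unfolding B_def by (intro UN_I[of u]) (auto simp: dist_norm)
  qed
  then have "compact B" using compact_sums[OF assms(2) compact_cball[of 0 e]] by simp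
  moreover have "continuous_on B D" using f(2) e(2) by (auto simp: B_def elim: continuous_on_subset)
  ultimately have "uniformly_continuous_on B D" by (intro compact_uniformly_continuous)
  then obtain d where d: "d > 0" "\<And>x x'. x \<in> B \<Longrightarrow> x' \<in> B \<Longrightarrow> dist x' x < d \<Longrightarrow> dist (D x') (D x) < \<epsilon>"
    using \<open>0 < \<epsilon>\<close> unfolding uniformly_continuous_on_def by metis
  define \<delta> where "\<delta> = min e (d / 2)"
  have "\<bar>f (u + h) - f u - D u h\<bar> \<le> \<epsilon> * norm h" if "u \<in> C" "norm h \<le> \<delta>" for u h
  proof -
    have sub: "x \<in> B" "dist x u < d" if "x \<in> cball u (norm h)" for x
      using that \<open>u \<in> C\<close> \<open>norm h \<le> \<delta>\<close> d(1) by (auto simp: B_def \<delta>_def dist_commute intro!: bexI[of _ u])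
    have "u \<in> B" using sub(1)[of u] by simp
    have "norm ((\<lambda>x. f x - D u x) (u + h) - (\<lambda>x. f x - D u x) u) \<le> \<epsilon> * norm (u + h - u)"
    proof (rule differentiable_bound[where S = "cball u (norm h)"])
      fix x assume x: "x \<in> cball u (norm h)"
      then have "x \<in> S" using sub e(2) by (auto simp: B_def)
      have "((\<lambda>x. f x - D u x) has_derivative (\<lambda>k. D x k - D u k)) (at x)"
        by (intro has_derivative_diff f \<open>x \<in> S\<close> bounded_linear_imp_has_derivative blinfun.bounded_linear_right)
      then show "((\<lambda>x. f x - D u x) has_derivative (\<lambda>k. D x k - D u k)) (at x within cball u (norm h))"
        by (rule has_derivative_at_withinI)
      have "onorm (\<lambda>k. D x k - D u k) = norm (D x - D u)"
        by (simp add: norm_blinfun.rep_eq minus_blinfun.rep_eq)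
      also have "\<dots> \<le> \<epsilon>" using d(2)[OF \<open>u \<in> B\<close> sub[OF x]] by (simp add: dist_norm)
      finally show "onorm (\<lambda>k. D x k - D u k) \<le> \<epsilon>" .
    qed (auto simp: dist_norm)
    then show ?thesis by (simp add: blinfun.add_right)
  qed
  moreover have "\<delta> > 0" using e d by (simp add: \<delta>_def)
  ultimately show ?thesis by blast
qed

lemma has_derivative_directional_bound:
  fixes f :: "'a::real_normed_vector \<Rightarrow> real"
  assumes f: "(f has_derivative f') (at u)" and lip: "\<And>c. \<bar>f (u + c *\<^sub>R e) - f u\<bar> \<le> K * \<bar>c\<bar>"
  shows "\<bar>f' e\<bar> \<le> K"
proof -
  have "((\<lambda>c::real. f (u + c *\<^sub>R e)) has_derivative (\<lambda>c. f' (c *\<^sub>R e))) (at 0)"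
    by (rule has_derivative_compose[of "\<lambda>c. u + c *\<^sub>R e" "\<lambda>c. c *\<^sub>R e" 0 UNIV f f'])
      (use f in \<open>auto intro!: derivative_eq_intros\<close>)
  then have "DERIV (\<lambda>c::real. f (u + c *\<^sub>R e)) 0 :> f' e"
    using linear_scale[OF has_derivative_linear[OF f]]
    by (simp add: has_field_derivative_def mult_commute_abs)
  then have "((\<lambda>c. \<bar>(f (u + c *\<^sub>R e) - f u) / c\<bar>) \<longlongrightarrow> \<bar>f' e\<bar>) (at 0)"
    unfolding DERIV_def by (intro tendsto_rabs) simp
  moreover have "\<forall>\<^sub>F c in at 0. \<bar>(f (u + c *\<^sub>R e) - f u) / c\<bar> \<le> K"
    using lip by (auto simp: eventually_at_filter abs_divide divide_le_eq)
  ultimately show ?thesis by (intro tendsto_upperbound[of _ _ "at 0"]) auto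
qed

section \<open>Evaluation of bounded smooth functions and of their derivatives\<close>

lemma Cb_iter_deriv_abs_le:
  fixes f :: "'k::finite Cb"
  assumes "j \<le> CARD('k)"
  shows "\<bar>(deriv ^^ j) f y\<bar> \<le> norm f"
proof -
  have "\<bar>(deriv ^^ j) f y\<bar> \<le> norm (Cb_jet j f)"
    using norm_bounded[of "Cb_jet j f" y] by (simp add: apply_Cb_jet[OF assms])
  also have "\<dots> \<le> norm f"
    unfolding norm_Cb_jet using assms by (intro member_le_sum) auto
  finally show ?thesis .
qed

lemma Cb_has_derivative:
  fixes f :: "'k::finite Cb"
  assumes "j < CARD('k)"
  shows "((deriv ^^ j) f has_real_derivative (deriv ^^ Suc j) f y) (at y)"
  using Cb_apply[of f] assms by (auto simp: is_Cb_def intro: field_differentiable_derivI)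

lemma Cb_continuous_on:
  fixes f :: "'k::finite Cb"
  assumes "j \<le> CARD('k)"
  shows "continuous_on S ((deriv ^^ j) f)"
  using Cb_apply[of f] assms by (auto simp: is_Cb_def intro: continuous_on_subset)

lemma Cb_lipschitz:
  fixes f :: "'k::finite Cb"
  assumes "j < CARD('k)"
  shows "\<bar>(deriv ^^ j) f y - (deriv ^^ j) f z\<bar> \<le> norm f * \<bar>y - z\<bar>"
  using field_differentiable_bound[of UNIV "(deriv ^^ j) f" "(deriv ^^ Suc j) f" "norm f" y z]
    Cb_has_derivative[OF assms] Cb_iter_deriv_abs_le[of "Suc j" f] assms by auto

lemma Cb_iter_deriv_add:
  fixes f g :: "'k::finite Cb"
  assumes "j \<le> CARD('k)"
  shows "(deriv ^^ j) (f + g) y = (deriv ^^ j) f y + (deriv ^^ j) g y"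
  using iter_deriv_lincomb[of "CARD('k)" f g j 1 1] Cb_apply[of f] Cb_apply[of g] assms
  by (simp add: plus_Cb.rep_eq)

lemma Cb_iter_deriv_scaleR:
  fixes f :: "'k::finite Cb"
  assumes "j \<le> CARD('k)"
  shows "(deriv ^^ j) (c *\<^sub>R f) y = c * (deriv ^^ j) f y"
  using iter_deriv_lincomb[of "CARD('k)" f f j c 0] Cb_apply[of f] assms
  by (simp add: scaleR_Cb.rep_eq)

lemma Cb_iter_deriv_diff:
  fixes f g :: "'k::finite Cb"
  assumes "j \<le> CARD('k)"
  shows "(deriv ^^ j) (f - g) y = (deriv ^^ j) f y - (deriv ^^ j) g y"
  using Cb_iter_deriv_add[OF assms, of "f - g" g y] by simp

lemma Cb_eval_continuous_on:
  fixes f :: "'a::topological_space \<Rightarrow> 'k::finite Cb"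
  assumes j: "j \<le> CARD('k)" and "continuous_on S f" "continuous_on S g"
  shows "continuous_on S (\<lambda>u. (deriv ^^ j) (f u) (g u))"
  unfolding continuous_on_def
proof
  fix u assume u: "u \<in> S"
  let ?F = "at u within S"
  have f: "(f \<longlongrightarrow> f u) ?F" and g: "(g \<longlongrightarrow> g u) ?F"
    using assms u by (auto simp: continuous_on_def)
  have "((\<lambda>u'. (deriv ^^ j) (f u' - f u) (g u')) \<longlongrightarrow> 0) ?F"
  proof (rule Lim_null_comparison)
    show "((\<lambda>u'. norm (f u' - f u)) \<longlongrightarrow> 0) ?F"
      using tendsto_norm[OF tendsto_diff[OF f tendsto_const[of "f u"]]] by simp
  qed (simp add: Cb_iter_deriv_abs_le[OF j])
  moreover have "((\<lambda>u'. (deriv ^^ j) (f u) (g u')) \<longlongrightarrow> (deriv ^^ j) (f u) (g u)) ?F"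
    using Cb_continuous_on[OF j, of UNIV "f u"] by (intro isCont_tendsto_compose[OF _ g]) (simp add: continuous_on_eq_continuous_at)
  ultimately show "((\<lambda>u. (deriv ^^ j) (f u) (g u)) \<longlongrightarrow> (deriv ^^ j) (f u) (g u)) ?F"
    using tendsto_add by (force simp: Cb_iter_deriv_diff[OF j])
qed

text \<open>The remainder at \<open>(g, z)\<close> is the Taylor remainder of the fixed
  \<open>f\<close> between \<open>y\<close> and \<open>z\<close> plus the increment of
  \<open>g - f\<close> between these points. The latter is at most
  \<open>norm (g - f) * \<bar>z - y\<bar>\<close> and so of second order. Differentiating in the
  point costs one derivative, hence the strict bound on \<open>j\<close>.\<close>

lemma Cb_eval_has_derivative:
  fixes f :: "'k::finite Cb"
  assumes j: "j < CARD('k)"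
  shows "((\<lambda>p :: 'k Cb \<times> real. (deriv ^^ j) (Cb_apply (fst p)) (snd p)) has_derivative
    (\<lambda>h. (deriv ^^ j) (Cb_apply (fst h)) y + (deriv ^^ Suc j) f y * snd h)) (at (f, y))"
  unfolding has_derivative_at_within
proof (intro conjI)
  let ?e = "\<lambda>p :: 'k Cb \<times> real. (deriv ^^ j) (Cb_apply (fst p)) (snd p)"
  let ?D = "\<lambda>h :: 'k Cb \<times> real. (deriv ^^ j) (Cb_apply (fst h)) y + (deriv ^^ Suc j) f y * snd h"
  have j': "j \<le> CARD('k)" using j by simp
  show "bounded_linear ?D"
  proof (rule bounded_linear_intro)
    fix h :: "'k Cb \<times> real"
    have "norm (?D h) \<le> norm (fst h) + norm f * \<bar>snd h\<bar>"
      unfolding real_norm_def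
      using Cb_iter_deriv_abs_le[OF j', of "fst h" y] Cb_iter_deriv_abs_le[of "Suc j" f y] j
      by (intro order_trans[OF abs_triangle_ineq] add_mono) (auto simp: abs_mult intro!: mult_right_mono)
    also have "\<dots> \<le> norm h + norm f * norm h"
      using norm_fst_le[of "fst h" "snd h"] norm_snd_le[of "snd h" "fst h"] by (intro add_mono mult_left_mono) auto
    finally show "norm (?D h) \<le> norm h * (1 + norm f)"
      by (simp add: algebra_simps)
  qed (auto simp: Cb_iter_deriv_add[OF j'] Cb_iter_deriv_scaleR[OF j'] algebra_simps)
  let ?r = "\<lambda>z. \<bar>(deriv ^^ j) f z - (deriv ^^ j) f y - (deriv ^^ Suc j) f y * (z - y)\<bar> / \<bar>z - y\<bar>"
  have "((deriv ^^ j) f has_derivative (*) ((deriv ^^ Suc j) f y)) (at y)"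
    using Cb_has_derivative[OF j, of f y] by (simp add: has_field_derivative_def)
  then have r: "(?r \<longlongrightarrow> 0) (at y)" by (simp add: has_derivative_iff_norm)
  \<comment> \<open>The quotient has the value 0 at \<open>y\<close> because division by zero gives
    0. So it is continuous there, and composing it with \<open>snd\<close> does not require
    excluding the points with \<open>snd p = y\<close>.\<close>
  have "isCont ?r y" using r by (simp add: isCont_def)
  moreover have "((\<lambda>p::'k Cb \<times> real. snd p) \<longlongrightarrow> y) (at (f, y))"
    using tendsto_snd[OF tendsto_ident_at[of "(f, y)" UNIV]] by simp
  ultimately have r2: "((\<lambda>p::'k Cb \<times> real. ?r (snd p)) \<longlongrightarrow> 0) (at (f, y))"
    using isCont_tendsto_compose by force
  have n: "((\<lambda>p::'k Cb \<times> real. norm (fst p - f)) \<longlongrightarrow> 0) (at (f, y))"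
    using tendsto_norm[OF tendsto_diff[OF tendsto_fst[OF tendsto_ident_at[of "(f, y)" UNIV]] tendsto_const[of f]]] by simp
  show "((\<lambda>p. (?e p - ?e (f, y) - ?D (p - (f, y))) /\<^sub>R norm (p - (f, y))) \<longlongrightarrow> 0) (at (f, y))"
  proof (rule Lim_null_comparison)
    show "((\<lambda>p::'k Cb \<times> real. ?r (snd p) + norm (fst p - f)) \<longlongrightarrow> 0) (at (f, y))"
      using tendsto_add[OF r2 n] by simp
    show "\<forall>\<^sub>F p in at (f, y). norm ((?e p - ?e (f, y) - ?D (p - (f, y))) /\<^sub>R norm (p - (f, y)))
      \<le> ?r (snd p) + norm (fst p - f)"
    proof (rule always_eventually, rule allI)
      fix p :: "'k Cb \<times> real"
      obtain g z where p: "p = (g, z)" by (cases p)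
      define N where "N = norm (p - (f, y))"
      have N: "\<bar>z - y\<bar> \<le> N" "0 \<le> N"
        using norm_snd_le[of "z - y" "g - f"] by (simp_all add: N_def p)
      let ?rem = "(deriv ^^ j) g z - (deriv ^^ j) f y - ((deriv ^^ j) (g - f) y + (deriv ^^ Suc j) f y * (z - y))"
      have "\<bar>?rem\<bar>
        = \<bar>((deriv ^^ j) f z - (deriv ^^ j) f y - (deriv ^^ Suc j) f y * (z - y)) + ((deriv ^^ j) (g - f) z - (deriv ^^ j) (g - f) y)\<bar>"
        by (simp add: Cb_iter_deriv_diff[OF j'])
      also have "\<dots> \<le> ?r z * \<bar>z - y\<bar> + norm (g - f) * \<bar>z - y\<bar>"
        using Cb_lipschitz[OF j, of "g - f" z y]
        by (intro order_trans[OF abs_triangle_ineq] add_mono) auto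
      also have "\<dots> \<le> (?r z + norm (g - f)) * N"
        by (subst distrib_right[symmetric], rule mult_left_mono[OF N(1)]) auto
      finally have le: "\<bar>?rem\<bar>
        \<le> (?r z + norm (g - f)) * N" .
      have n: "norm (r /\<^sub>R N) = \<bar>r\<bar> / N" for r :: real
        using N(2) by (simp add: divide_inverse abs_mult mult.commute)
      have "\<bar>?rem\<bar> / N
        \<le> ?r z + norm (g - f)"
      proof (cases "N = 0")
        case True
        have "0 \<le> ?r z + norm (g - f)" by (intro add_nonneg_nonneg divide_nonneg_nonneg) auto
        then show ?thesis unfolding True div_by_0 .
      next
        case False
        then have "0 < N" using N(2) by linarith
        then show ?thesis using le by (simp only: pos_divide_le_eq)
      qed
      then show "norm ((?e p - ?e (f, y) - ?D (p - (f, y))) /\<^sub>R norm (p - (f, y)))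
          \<le> ?r (snd p) + norm (fst p - f)"
        unfolding N_def[symmetric] n by (simp only: p fst_conv snd_conv diff_Pair)
    qed
  qed
qed

text \<open>Turns a smooth curve of functions into a function smooth jointly in parameter and state.
  It is applied with \<open>j = 0\<close> to both coefficients and with \<open>j = 1\<close> to the
  derivative of \<open>\<sigma>\<close>.\<close>

lemma C1_map_on_Cb_eval:
  fixes f :: "'a::euclidean_space \<Rightarrow> 'k::finite Cb"
  assumes j: "j < CARD('k)" and "C1_map_on S f"
  shows "C1_map_on (S \<times> UNIV) (\<lambda>u. (deriv ^^ j) (Cb_apply (f (fst u))) (snd u))"
proof -
  obtain D where D: "\<And>u. u \<in> S \<Longrightarrow> (f has_derivative blinfun_apply (D u)) (at u)" "continuous_on S D"
    by (rule C1_map_onE[OF assms(2)]) blast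
  have f: "continuous_on S f" by (rule C1_map_on_imp_continuous_on[OF assms(2)])
  show ?thesis
  proof (rule C1_map_onI)
    fix u :: "'a \<times> real" assume u: "u \<in> S \<times> UNIV"
    have "((\<lambda>u. (f (fst u), snd u)) has_derivative (\<lambda>h. (D (fst u) (fst h), snd h))) (at u)"
    proof (intro has_derivative_Pair)
      show "((\<lambda>u::'a \<times> real. f (fst u)) has_derivative (\<lambda>h. D (fst u) (fst h))) (at u)"
        by (rule has_derivative_compose[of fst fst u UNIV f])
          (use u D(1) in \<open>auto intro!: derivative_eq_intros\<close>)
    qed (auto intro!: derivative_eq_intros)
    from has_derivative_compose[OF this Cb_eval_has_derivative[OF j]]
    show "((\<lambda>u. (deriv ^^ j) (Cb_apply (f (fst u))) (snd u)) has_derivative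
      (\<lambda>h. (deriv ^^ j) (Cb_apply (D (fst u) (fst h))) (snd u) + (deriv ^^ Suc j) (Cb_apply (f (fst u))) (snd u) * snd h)) (at u)"
      by simp
  next
    fix h :: "'a \<times> real"
    show "continuous_on (S \<times> UNIV) (\<lambda>u. (deriv ^^ j) (Cb_apply (D (fst u) (fst h))) (snd u) + (deriv ^^ Suc j) (Cb_apply (f (fst u))) (snd u) * snd h)"
      using j by (intro continuous_intros Cb_eval_continuous_on continuous_on_compose2[OF f] continuous_on_compose2[OF D(2)]) auto
  qed
qed

section \<open>The Lamperti transform and the transformed coefficients\<close>

locale elliptic =
  fixes s :: "real \<Rightarrow> real" and low high :: real
  assumes continuous_s: "continuous_on UNIV s"
    and low_pos: "0 < low"
    and s_bounds: "low \<le> s y" "s y \<le> high"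
begin

lemma s_pos: "0 < s y"
  using low_pos s_bounds(1)[of y] by linarith

lemma high_pos: "0 < high"
  using s_pos[of 0] s_bounds(2)[of 0] by linarith

lemma lamperti_0: "lamperti s 0 = 0"
  by (simp add: lamperti_def)

lemma lamperti_deriv: "(lamperti s has_real_derivative 1 / s y) (at y)"
proof -
  \<comment> \<open>Both 0 and \<open>y\<close> lie strictly inside this interval, so the derivative
    within the interval is a two-sided one.\<close>
  let ?a = "- \<bar>y\<bar> - 1" and ?b = "\<bar>y\<bar> + 1"
  have "((\<lambda>x. LBINT r=ereal 0..ereal x. 1 / s r) has_vector_derivative 1 / s y) (at y within {?a..?b})"
    using s_pos by (intro interval_integral_FTC2 continuous_intros continuous_on_subset[OF continuous_s])
      (auto simp: less_imp_neq[symmetric])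
  moreover have "at y within {?a..?b} = at y" by (rule at_within_Icc_at) auto
  moreover have "lamperti s = (\<lambda>x. LBINT r=ereal 0..ereal x. 1 / s r)"
    by (simp add: fun_eq_iff lamperti_def)
  ultimately show ?thesis by (simp add: has_real_derivative_iff_has_vector_derivative)
qed

text \<open>The mean value theorem regardless of the order of the points. Inserting the two bounds
  of \<open>s\<close> makes the transform Lipschitz with constant \<open>1 / low\<close> and
  expanding by at least \<open>1 / high\<close>.\<close>

lemma lamperti_increment:
  obtains r where "lamperti s z - lamperti s y = (z - y) / s r"
proof -
  consider "y < z" | "z < y" | "y = z" by linarith
  then show thesis
  proof cases
    case 1
    from MVT2[OF this lamperti_deriv] that show ?thesis by auto
  next
    case 2
    from MVT2[OF this lamperti_deriv] obtain r where "lamperti s y - lamperti s z = (y - z) * (1 / s r)" by auto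
    then have "lamperti s z - lamperti s y = (z - y) / s r" by (simp add: diff_divide_distrib)
    then show ?thesis by (rule that)
  qed (use that in auto)
qed

lemma lamperti_diff_le: "\<bar>lamperti s y - lamperti s z\<bar> \<le> \<bar>y - z\<bar> / low"
proof -
  obtain r where "lamperti s y - lamperti s z = (y - z) / s r" by (rule lamperti_increment)
  then show ?thesis using s_pos[of r] s_bounds(1)[of r] low_pos
    by (auto simp: abs_divide intro!: divide_left_mono)
qed

lemma lamperti_diff_ge: "\<bar>y - z\<bar> \<le> high * \<bar>lamperti s y - lamperti s z\<bar>"
proof -
  obtain r where r: "lamperti s y - lamperti s z = (y - z) / s r" by (rule lamperti_increment)
  have "\<bar>y - z\<bar> = s r * \<bar>lamperti s y - lamperti s z\<bar>" using s_pos[of r] by (simp add: r abs_divide)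
  also have "\<dots> \<le> high * \<bar>lamperti s y - lamperti s z\<bar>" by (intro mult_right_mono s_bounds) auto
  finally show ?thesis .
qed

lemma inj_lamperti: "inj (lamperti s)"
proof (rule injI)
  fix y z assume "lamperti s y = lamperti s z"
  then show "y = z" using lamperti_diff_ge[of y z] by simp
qed

lemma surj_lamperti: "surj (lamperti s)"
proof -
  have "\<exists>y. lamperti s y = z" for z
  proof -
    \<comment> \<open>The slope of the transform is at least \<open>1 / high\<close>, so from 0 it
      covers the height \<open>\<bar>z\<bar>\<close> within the distance
      \<open>high * \<bar>z\<bar>\<close>.\<close>
    define M where "M = high * \<bar>z\<bar>"
    have M: "0 \<le> M" using high_pos by (simp add: M_def)
    obtain r where "lamperti s M - lamperti s 0 = (M - 0) / s r" by (rule lamperti_increment)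
    moreover have "\<bar>z\<bar> \<le> M / s r" using s_pos[of r] mult_left_mono[OF s_bounds(2)[of r], of "\<bar>z\<bar>"]
      by (simp add: M_def pos_le_divide_eq mult.commute)
    ultimately have 1: "z \<le> lamperti s M" by (simp add: lamperti_0)
    obtain r where "lamperti s 0 - lamperti s (- M) = (0 - (- M)) / s r" by (rule lamperti_increment)
    moreover have "\<bar>z\<bar> \<le> M / s r" using s_pos[of r] mult_left_mono[OF s_bounds(2)[of r], of "\<bar>z\<bar>"]
      by (simp add: M_def pos_le_divide_eq mult.commute)
    ultimately have 2: "lamperti s (- M) \<le> z" by (simp add: lamperti_0)
    have "continuous_on {- M..M} (lamperti s)"
      by (intro continuous_at_imp_continuous_on ballI DERIV_isCont[OF lamperti_deriv])
    from IVT'[of "lamperti s" "-M" z M, OF 2 1 _ this] M show ?thesis by auto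
  qed
  then show ?thesis by (auto simp: surj_def) metis
qed

lemma lamperti_lamperti_inv [simp]: "lamperti s (lamperti_inv s z) = z"
  unfolding lamperti_inv_def by (rule surj_f_inv_f[OF surj_lamperti])

lemma lamperti_inv_lamperti [simp]: "lamperti_inv s (lamperti s y) = y"
  unfolding lamperti_inv_def by (rule inv_f_f[OF inj_lamperti])

lemma lamperti_inv_lipschitz: "\<bar>lamperti_inv s z - lamperti_inv s z'\<bar> \<le> high * \<bar>z - z'\<bar>"
  using lamperti_diff_ge[of "lamperti_inv s z" "lamperti_inv s z'"] by simp

lemma lamperti_inv_abs_le: "\<bar>lamperti_inv s z\<bar> \<le> high * \<bar>z\<bar>"
proof -
  have "lamperti_inv s 0 = 0" using lamperti_inv_lamperti[of 0] by (simp add: lamperti_0)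
  then show ?thesis using lamperti_inv_lipschitz[of z 0] by simp
qed

lemma lamperti_abs_le: "\<bar>lamperti s y\<bar> \<le> \<bar>y\<bar> / low"
  using lamperti_diff_le[of y 0] by (simp add: lamperti_0)

text \<open>With a fixed integration range, differentiation under the integral sign applies
  to both variables at once.\<close>

lemma lamperti_eq_integral: "lamperti s y = integral {0..1} (\<lambda>\<tau>. y / s (y * \<tau>))"
proof -
  have "((\<lambda>\<tau>. y / s (y * \<tau>)) has_integral lamperti s (y * 1) - lamperti s (y * 0)) {0..1}"
  proof (rule fundamental_theorem_of_calculus)
    fix \<tau> :: real
    have "((\<lambda>\<tau>. lamperti s (y * \<tau>)) has_real_derivative 1 / s (y * \<tau>) * y) (at \<tau>)"
      by (rule DERIV_chain2[OF lamperti_deriv]) (auto intro!: derivative_eq_intros)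
    then show "((\<lambda>\<tau>. lamperti s (y * \<tau>)) has_vector_derivative y / s (y * \<tau>)) (at \<tau> within {0..1})"
      by (simp add: has_real_derivative_iff_has_vector_derivative has_vector_derivative_at_within)
  qed simp
  then show ?thesis by (simp add: lamperti_0 integral_unique)
qed

end

section \<open>Comparison of the Lamperti transforms of two coefficients\<close>

lemma quotient_diff_le:
  fixes a a' c c' :: real
  assumes "0 < l" "l \<le> c" "l \<le> c'" "\<bar>a'\<bar> \<le> M"
  shows "\<bar>a / c - a' / c'\<bar> \<le> \<bar>a - a'\<bar> / l + M * \<bar>c - c'\<bar> / l\<^sup>2"
proof -
  have "a / c - a' / c' = (a - a') / c + a' * (c' - c) / (c * c')"
    using assms by (simp add: field_simps)
  also have "\<bar>\<dots>\<bar> \<le> \<bar>a - a'\<bar> / c + \<bar>a'\<bar> * \<bar>c - c'\<bar> / (c * c')"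
    using assms by (intro order_trans[OF abs_triangle_ineq]) (simp add: abs_mult abs_divide abs_minus_commute)
  also have "\<dots> \<le> \<bar>a - a'\<bar> / l + M * \<bar>c - c'\<bar> / l\<^sup>2"
    using assms by (intro add_mono frac_le mult_mono) (auto simp: power2_eq_square intro!: mult_mono)
  finally show ?thesis .
qed

locale elliptic_pair = e1: elliptic s low high + e2: elliptic s' low high
  for s s' :: "real \<Rightarrow> real" and low high :: real +
  fixes \<epsilon> :: real
  assumes close: "\<bar>s y - s' y\<bar> \<le> \<epsilon>"
begin

lemma eps_nonneg: "0 \<le> \<epsilon>" using close[of 0] by linarith

text \<open>The derivatives \<open>1 / s\<close> and \<open>1 / s'\<close> differ by at most
  \<open>\<epsilon> / low\<^sup>2\<close> and both transforms vanish at 0. This is the source of the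
  linear growth in the state.\<close>

lemma lamperti_param_diff: "\<bar>lamperti s y - lamperti s' y\<bar> \<le> \<epsilon> / low\<^sup>2 * \<bar>y\<bar>"
proof -
  have "norm ((\<lambda>y. lamperti s y - lamperti s' y) y - (\<lambda>y. lamperti s y - lamperti s' y) 0) \<le> \<epsilon> / low\<^sup>2 * norm (y - 0)"
  proof (rule field_differentiable_bound[of UNIV])
    fix r
    show "((\<lambda>y. lamperti s y - lamperti s' y) has_field_derivative 1 / s r - 1 / s' r) (at r within UNIV)"
      by (intro DERIV_diff e1.lamperti_deriv e2.lamperti_deriv)
    have "\<bar>1 / s r - 1 / s' r\<bar> \<le> \<bar>1 - 1\<bar> / low + 1 * \<bar>s r - s' r\<bar> / low\<^sup>2"
      by (intro quotient_diff_le e1.low_pos e1.s_bounds e2.s_bounds) auto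
    also have "\<dots> \<le> \<epsilon> / low\<^sup>2" using close[of r] by (auto intro!: divide_right_mono)
    finally show "norm (1 / s r - 1 / s' r) \<le> \<epsilon> / low\<^sup>2" by simp
  qed auto
  then show ?thesis by (simp add: e1.lamperti_0 e2.lamperti_0)
qed

text \<open>Applying the expanding map \<open>lamperti s\<close> to both inverses reduces the claim
  to the two transforms at the common point \<open>lamperti_inv s' z\<close>, because
  \<open>z\<close> is also the value of \<open>lamperti s'\<close> there.\<close>

lemma lamperti_inv_param_diff:
  "\<bar>lamperti_inv s z - lamperti_inv s' z\<bar> \<le> high\<^sup>2 / low\<^sup>2 * \<epsilon> * \<bar>z\<bar>"
proof -
  have "\<bar>lamperti_inv s z - lamperti_inv s' z\<bar> \<le> high * \<bar>lamperti s (lamperti_inv s z) - lamperti s (lamperti_inv s' z)\<bar>"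
    by (rule e1.lamperti_diff_ge)
  also have "\<dots> = high * \<bar>lamperti s (lamperti_inv s' z) - lamperti s' (lamperti_inv s' z)\<bar>"
    by (simp add: abs_minus_commute)
  also have "\<dots> \<le> high * (\<epsilon> / low\<^sup>2 * (high * \<bar>z\<bar>))"
    using e1.high_pos eps_nonneg
    by (intro mult_left_mono order_trans[OF lamperti_param_diff] e2.lamperti_inv_abs_le) auto
  finally show ?thesis by (simp add: power2_eq_square mult_ac)
qed

end

section \<open>The transformed coefficients as functions of parameter and state\<close>

locale coefficient_family =
  fixes A :: "'a::euclidean_space set" and b :: "'a \<Rightarrow> 2 Cb" and \<sigma> :: "'a \<Rightarrow> 3 Cb"
    and L low high :: real
  assumes open_A: "open A"
    and C1_b: "C1_map_on A b" and C1_\<sigma>: "C1_map_on A \<sigma>"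
    and norm_b: "\<And>\<theta>. \<theta> \<in> A \<Longrightarrow> norm (b \<theta>) \<le> L"
    and norm_\<sigma>: "\<And>\<theta>. \<theta> \<in> A \<Longrightarrow> norm (\<sigma> \<theta>) \<le> L"
    and low_pos: "0 < low"
    and \<sigma>_bounds: "\<And>\<theta> y. \<theta> \<in> A \<Longrightarrow> low \<le> \<sigma> \<theta> y" "\<And>\<theta> y. \<theta> \<in> A \<Longrightarrow> \<sigma> \<theta> y \<le> high"
begin

lemma elliptic_\<sigma>: "\<theta> \<in> A \<Longrightarrow> elliptic (\<sigma> \<theta>) low high"
  using Cb_continuous_on[of 0 UNIV "\<sigma> \<theta>"] low_pos \<sigma>_bounds by unfold_locales auto

lemma C1_b_eval: "C1_map_on (A \<times> UNIV) (\<lambda>u. b (fst u) (snd u))"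
  using C1_map_on_Cb_eval[OF _ C1_b, of 0] by simp

lemma C1_\<sigma>_eval: "C1_map_on (A \<times> UNIV) (\<lambda>u. \<sigma> (fst u) (snd u))"
  using C1_map_on_Cb_eval[OF _ C1_\<sigma>, of 0] by simp

lemma C1_\<sigma>'_eval: "C1_map_on (A \<times> UNIV) (\<lambda>u. deriv (\<sigma> (fst u)) (snd u))"
  using C1_map_on_Cb_eval[OF _ C1_\<sigma>, of 1] by simp

lemma C1_lamperti: "C1_map_on (A \<times> UNIV) (\<lambda>u. lamperti (\<sigma> (fst u)) (snd u))"
proof -
  let ?S = "(A \<times> UNIV) \<times> UNIV :: (('a \<times> real) \<times> real) set"
  have y: "C1_map_on ?S (\<lambda>p. snd (fst p))" "C1_map_on ?S (\<lambda>p. snd p)" "C1_map_on ?S (\<lambda>p. fst (fst p))"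
    by (auto intro!: C1_map_on_linear bounded_linear_compose[OF bounded_linear_snd bounded_linear_fst]
        bounded_linear_compose[OF bounded_linear_fst bounded_linear_fst] bounded_linear_snd)
  have g: "C1_map_on ?S (\<lambda>p. (fst (fst p), snd (fst p) * snd p))"
    by (intro C1_map_on_Pair C1_map_on_mult y)
  have c: "C1_map_on ?S (\<lambda>p. \<sigma> (fst (fst p)) (snd (fst p) * snd p))"
    using C1_map_on_compose[OF C1_\<sigma>_eval g] by (auto simp: image_subset_iff)
  have "C1_map_on ?S (\<lambda>p. snd (fst p) / \<sigma> (fst (fst p)) (snd (fst p) * snd p))"
    using elliptic.s_pos[OF elliptic_\<sigma>] by (intro C1_map_on_divide y c) (auto simp: less_imp_neq[symmetric])
  from C1_map_on_integral[OF _ this]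
  have *: "C1_map_on (A \<times> UNIV) (\<lambda>u. integral {0..1} (\<lambda>\<tau>. snd u / \<sigma> (fst u) (snd u * \<tau>)))"
    using open_A by (simp add: open_Times)
  have "integral {0..1} (\<lambda>\<tau>. snd u / \<sigma> (fst u) (snd u * \<tau>)) = lamperti (\<sigma> (fst u)) (snd u)"
    if "u \<in> A \<times> UNIV" for u
    using elliptic.lamperti_eq_integral[OF elliptic_\<sigma>] that by auto
  from C1_map_on_cong[OF _ * this] show ?thesis
    using open_A by (simp add: open_Times)
qed

lemma continuous_on_lamperti_inv: "continuous_on (A \<times> UNIV) (\<lambda>u. lamperti_inv (\<sigma> (fst u)) (snd u))"
  unfolding continuous_on_def
proof
  fix u :: "'a \<times> real" assume u: "u \<in> A \<times> UNIV"
  let ?G = "\<lambda>u. lamperti_inv (\<sigma> (fst u)) (snd u)" and ?F = "at u within A \<times> UNIV"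
  have "((\<lambda>u'. lamperti (\<sigma> (fst (fst u', ?G u))) (snd (fst u', ?G u))) \<longlongrightarrow> lamperti (\<sigma> (fst u)) (?G u)) ?F"
    using u C1_map_on_imp_continuous_on[OF C1_lamperti]
    by (intro continuous_on_tendsto_compose[OF C1_map_on_imp_continuous_on[OF C1_lamperti], of _ "(fst u, ?G u)", simplified fst_conv snd_conv] tendsto_intros)
      (auto simp: eventually_at_filter intro: always_eventually)
  then have "((\<lambda>u'. lamperti (\<sigma> (fst u')) (?G u)) \<longlongrightarrow> snd u) ?F"
    using elliptic.lamperti_lamperti_inv[OF elliptic_\<sigma>] u by auto
  then have "((\<lambda>u'. high * \<bar>snd u' - lamperti (\<sigma> (fst u')) (?G u)\<bar>) \<longlongrightarrow> high * \<bar>snd u - snd u\<bar>) ?F"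
    by (intro tendsto_intros)
  then have lim: "((\<lambda>u'. high * \<bar>snd u' - lamperti (\<sigma> (fst u')) (?G u)\<bar>) \<longlongrightarrow> 0) ?F" by simp
  have ev: "\<forall>\<^sub>F u' in ?F. norm (?G u' - ?G u) \<le> high * \<bar>snd u' - lamperti (\<sigma> (fst u')) (?G u)\<bar>"
    unfolding eventually_at_filter
  proof (rule always_eventually, safe)
    fix \<theta> z assume "\<theta> \<in> A"
    then interpret elliptic "\<sigma> \<theta>" low high by (rule elliptic_\<sigma>)
    show "norm (?G (\<theta>, z) - ?G u) \<le> high * \<bar>snd (\<theta>, z) - lamperti (\<sigma> (fst (\<theta>, z))) (?G u)\<bar>"
      using lamperti_diff_ge[of "lamperti_inv (\<sigma> \<theta>) z" "?G u"] by simp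
  qed
  have "((\<lambda>u'. ?G u' - ?G u) \<longlongrightarrow> 0) ?F" by (rule Lim_null_comparison[OF ev lim])
  then show "(?G \<longlongrightarrow> ?G u) ?F" by (rule LIM_zero_cancel)
qed

text \<open>The map from \<open>(\<theta>, y)\<close> to \<open>\<theta>\<close> and the transform
  of \<open>y\<close> has a triangular derivative with the entry
  \<open>1 / \<sigma> \<theta> y\<close> in the state direction, so it can be inverted by hand. The
  inverse map is already known and continuous, which leaves only the differentiation rule for
  inverses.\<close>

lemma C1_lamperti_inv: "C1_map_on (A \<times> UNIV) (\<lambda>u. lamperti_inv (\<sigma> (fst u)) (snd u))"
proof -
  let ?F = "\<lambda>u. lamperti (\<sigma> (fst u)) (snd u)" and ?G = "\<lambda>u. lamperti_inv (\<sigma> (fst u)) (snd u)"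
  obtain D where D: "\<And>u. u \<in> A \<times> UNIV \<Longrightarrow> (?F has_derivative blinfun_apply (D u)) (at u)" "continuous_on (A \<times> UNIV) D"
    by (rule C1_map_onE[OF C1_lamperti]) blast
  have D_snd: "D (\<theta>, y) (0, w) = w / \<sigma> \<theta> y" if "\<theta> \<in> A" for \<theta> y w
  proof -
    have "((\<lambda>r. (\<theta>, r)) has_derivative (\<lambda>w. (0, w))) (at y)" by (auto intro!: derivative_eq_intros)
    from has_derivative_compose[OF this D(1)] that
    have "((\<lambda>r. lamperti (\<sigma> \<theta>) r) has_derivative (\<lambda>w. D (\<theta>, y) (0, w))) (at y)" by simp
    moreover have "(lamperti (\<sigma> \<theta>) has_derivative (\<lambda>w. 1 / \<sigma> \<theta> y * w)) (at y)"
      using elliptic.lamperti_deriv[OF elliptic_\<sigma>[OF that], of y] unfolding has_field_derivative_def .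
    ultimately have "(\<lambda>w. D (\<theta>, y) (0, w)) = (\<lambda>w. 1 / \<sigma> \<theta> y * w)" by (rule has_derivative_unique)
    then show ?thesis by (simp add: fun_eq_iff)
  qed
  \<comment> \<open>The solution \<open>w\<close> of
    \<open>D (fst h, 0) + w / \<sigma> = snd h\<close>, the linear equation for the state component
    of the inverse.\<close>
  define G' where "G' u h = \<sigma> (fst u) (?G u) * (snd h - D (fst u, ?G u) (fst h, 0))" for u h
  show ?thesis
  proof (rule C1_map_onI[where f' = G'])
    fix u :: "'a \<times> real" assume u: "u \<in> A \<times> UNIV"
    let ?g = "\<lambda>u. (fst u, ?G u)"
    have bl: "bounded_linear (\<lambda>h. (fst h, G' u h))"
      unfolding G'_def
      by (intro bounded_linear_Pair bounded_linear_fst bounded_linear_const_mult bounded_linear_sub bounded_linear_snd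
          bounded_linear_compose[OF blinfun.bounded_linear_right] bounded_linear_zero)
    have "(?g has_derivative (\<lambda>h. (fst h, G' u h))) (at u)"
    proof (rule has_derivative_inverse_basic[where f = "\<lambda>u. (fst u, ?F u)" and f' = "\<lambda>h. (fst h, D (?g u) h)" and T = "A \<times> UNIV"])
      show "((\<lambda>u. (fst u, ?F u)) has_derivative (\<lambda>h. (fst h, D (?g u) h))) (at (?g u))"
        using u by (intro has_derivative_Pair D) (auto intro!: derivative_eq_intros)
      have "G' u (fst h, D (?g u) h) = snd h" for h
      proof -
        have "D (?g u) h = D (?g u) (fst h, 0) + D (?g u) (0, snd h)"
          by (simp add: blinfun.add_right[symmetric])
        then show ?thesis
          using u D_snd[of "fst u" "?G u" "snd h"] elliptic.s_pos[OF elliptic_\<sigma>, of "fst u" "?G u"]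
          by (auto simp: G'_def)
      qed
      then show "(\<lambda>h. (fst h, G' u h)) \<circ> (\<lambda>h. (fst h, D (?g u) h)) = id" by (simp add: fun_eq_iff)
      show "isCont ?g u"
      proof (rule continuous_on_interior)
        show "continuous_on (A \<times> UNIV) ?g" by (intro continuous_intros continuous_on_lamperti_inv)
        show "u \<in> interior (A \<times> UNIV)" using u open_A by (simp add: interior_open open_Times)
      qed
      show "(fst (?g z), ?F (?g z)) = z" if "z \<in> A \<times> UNIV" for z
        using that elliptic.lamperti_lamperti_inv[OF elliptic_\<sigma>] by auto
    qed (use u open_A bl in \<open>auto simp: open_Times\<close>)
    from has_derivative_snd[OF this] show "(?G has_derivative G' u) (at u)" by simp
  next
    fix h
    show "continuous_on (A \<times> UNIV) (\<lambda>u. G' u h)"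
      unfolding G'_def
      by (intro continuous_intros continuous_on_compose2[OF D(2)] continuous_on_lamperti_inv
          continuous_on_compose2[OF C1_map_on_imp_continuous_on[OF C1_\<sigma>_eval], of _ "\<lambda>u. (fst u, ?G u)", simplified fst_conv snd_conv]) auto
  qed
qed

lemma C1_lamperti_inv_Pair: "C1_map_on (A \<times> UNIV) (\<lambda>u. (fst u, lamperti_inv (\<sigma> (fst u)) (snd u)))"
  by (intro C1_map_on_Pair C1_lamperti_inv C1_map_on_linear bounded_linear_fst)

lemma C1_b_hat: "C1_map_on (A \<times> UNIV) (\<lambda>u. b_hat (b (fst u)) (\<sigma> (fst u)) (snd u))"
  unfolding b_hat_def
  using C1_map_on_compose[OF C1_b_eval C1_lamperti_inv_Pair] C1_map_on_compose[OF C1_\<sigma>_eval C1_lamperti_inv_Pair]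
    elliptic.s_pos[OF elliptic_\<sigma>]
  by (intro C1_map_on_divide) (auto simp: image_subset_iff less_imp_neq[symmetric])

lemma C1_c_hat: "C1_map_on (A \<times> UNIV) (\<lambda>u. c_hat (\<sigma> (fst u)) (snd u))"
  unfolding c_hat_def
  using C1_map_on_compose[OF C1_\<sigma>'_eval C1_lamperti_inv_Pair]
  by (intro C1_map_on_mult C1_map_on_const) (auto simp: image_subset_iff)

lemma L_nonneg: "\<theta> \<in> A \<Longrightarrow> 0 \<le> L"
  using norm_b[of \<theta>] norm_ge_zero[of "b \<theta>"] by linarith

lemma b_abs_le: "\<theta> \<in> A \<Longrightarrow> \<bar>b \<theta> y\<bar> \<le> L"
  using Cb_iter_deriv_abs_le[of 0 "b \<theta>" y] norm_b[of \<theta>] by simp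

lemma \<sigma>'_abs_le: "\<theta> \<in> A \<Longrightarrow> \<bar>deriv (\<sigma> \<theta>) y\<bar> \<le> L"
  using Cb_iter_deriv_abs_le[of 1 "\<sigma> \<theta>" y] norm_\<sigma>[of \<theta>] by simp

lemma coefficient_lipschitz:
  assumes "\<theta> \<in> A"
  shows "\<bar>b \<theta> y - b \<theta> z\<bar> \<le> L * \<bar>y - z\<bar>" "\<bar>\<sigma> \<theta> y - \<sigma> \<theta> z\<bar> \<le> L * \<bar>y - z\<bar>"
    "\<bar>deriv (\<sigma> \<theta>) y - deriv (\<sigma> \<theta>) z\<bar> \<le> L * \<bar>y - z\<bar>"
  using Cb_lipschitz[of 0 "b \<theta>" y z] Cb_lipschitz[of 0 "\<sigma> \<theta>" y z] Cb_lipschitz[of 1 "\<sigma> \<theta>" y z]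
    mult_right_mono[OF norm_b[OF assms], of "\<bar>y - z\<bar>"] mult_right_mono[OF norm_\<sigma>[OF assms], of "\<bar>y - z\<bar>"]
  by auto

lemma b_hat_abs_le: "\<theta> \<in> A \<Longrightarrow> \<bar>b_hat (b \<theta>) (\<sigma> \<theta>) z\<bar> \<le> L / low"
  unfolding b_hat_def abs_divide
  using b_abs_le \<sigma>_bounds low_pos L_nonneg by (intro frac_le) (auto intro: order_trans[OF _ abs_ge_self])

lemma c_hat_abs_le: "\<theta> \<in> A \<Longrightarrow> \<bar>c_hat (\<sigma> \<theta>) z\<bar> \<le> L"
  unfolding c_hat_def abs_mult using \<sigma>'_abs_le[of \<theta> "lamperti_inv (\<sigma> \<theta>) z"] L_nonneg[of \<theta>] by simp

text \<open>The first two terms come from the quotient in \<open>b_hat\<close>, through its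
  numerator and its denominator; the last one covers \<open>c_hat\<close>.\<close>

definition Lip :: real where "Lip = L / low + L * L / low\<^sup>2 + L"

lemma Lip_nonneg: "A \<noteq> {} \<Longrightarrow> 0 \<le> Lip"
  using L_nonneg low_pos by (auto simp: Lip_def)

text \<open>A common form for two uses. With equal parameters, \<open>\<delta>\<close> is the
  displacement of the back-transformed states; with different parameters it also contains the
  distance of the coefficients, measured in units of \<open>L\<close>.\<close>

lemma hat_diff_le:
  assumes "\<theta> \<in> A" "\<theta>' \<in> A"
    and d: "\<bar>b \<theta> (lamperti_inv (\<sigma> \<theta>) z) - b \<theta>' (lamperti_inv (\<sigma> \<theta>') z')\<bar> \<le> L * \<delta>"
      "\<bar>\<sigma> \<theta> (lamperti_inv (\<sigma> \<theta>) z) - \<sigma> \<theta>' (lamperti_inv (\<sigma> \<theta>') z')\<bar> \<le> L * \<delta>"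
      "\<bar>deriv (\<sigma> \<theta>) (lamperti_inv (\<sigma> \<theta>) z) - deriv (\<sigma> \<theta>') (lamperti_inv (\<sigma> \<theta>') z')\<bar> \<le> L * \<delta>"
    and "0 \<le> \<delta>"
  shows "\<bar>b_hat (b \<theta>) (\<sigma> \<theta>) z - b_hat (b \<theta>') (\<sigma> \<theta>') z'\<bar> \<le> Lip * \<delta>"
    and "\<bar>c_hat (\<sigma> \<theta>) z - c_hat (\<sigma> \<theta>') z'\<bar> \<le> Lip * \<delta>"
proof -
  have L: "0 \<le> L" by (rule L_nonneg[OF assms(1)])
  have "\<bar>b_hat (b \<theta>) (\<sigma> \<theta>) z - b_hat (b \<theta>') (\<sigma> \<theta>') z'\<bar> \<le> L * \<delta> / low + L * (L * \<delta>) / low\<^sup>2"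
    unfolding b_hat_def
    by (rule order_trans[OF quotient_diff_le[OF low_pos \<sigma>_bounds(1) \<sigma>_bounds(1) b_abs_le]])
      (use assms low_pos L in \<open>auto intro!: add_mono divide_right_mono mult_left_mono\<close>)
  also have "\<dots> = (L / low + L * L / low\<^sup>2) * \<delta>" by (simp add: algebra_simps)
  also have "\<dots> \<le> Lip * \<delta>" unfolding Lip_def using L \<open>0 \<le> \<delta>\<close> by (intro mult_right_mono) auto
  finally show "\<bar>b_hat (b \<theta>) (\<sigma> \<theta>) z - b_hat (b \<theta>') (\<sigma> \<theta>') z'\<bar> \<le> Lip * \<delta>" .
  have "\<bar>c_hat (\<sigma> \<theta>) z - c_hat (\<sigma> \<theta>') z'\<bar> \<le> L * \<delta>"
    using d(3) by (simp add: c_hat_def)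
  also have "\<dots> \<le> Lip * \<delta>" unfolding Lip_def using L low_pos \<open>0 \<le> \<delta>\<close> by (intro mult_right_mono) auto
  finally show "\<bar>c_hat (\<sigma> \<theta>) z - c_hat (\<sigma> \<theta>') z'\<bar> \<le> Lip * \<delta>" .
qed

lemma hat_lipschitz:
  assumes "\<theta> \<in> A"
  shows "\<bar>b_hat (b \<theta>) (\<sigma> \<theta>) z - b_hat (b \<theta>) (\<sigma> \<theta>) z'\<bar> \<le> Lip * high * \<bar>z - z'\<bar>"
    and "\<bar>c_hat (\<sigma> \<theta>) z - c_hat (\<sigma> \<theta>) z'\<bar> \<le> Lip * high * \<bar>z - z'\<bar>"
proof -
  interpret elliptic "\<sigma> \<theta>" low high by (rule elliptic_\<sigma>[OF assms])
  note * = order_trans[OF coefficient_lipschitz(1)[OF assms] mult_left_mono[OF lamperti_inv_lipschitz L_nonneg[OF assms]]]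
    order_trans[OF coefficient_lipschitz(2)[OF assms] mult_left_mono[OF lamperti_inv_lipschitz L_nonneg[OF assms]]]
    order_trans[OF coefficient_lipschitz(3)[OF assms] mult_left_mono[OF lamperti_inv_lipschitz L_nonneg[OF assms]]]
  show "\<bar>b_hat (b \<theta>) (\<sigma> \<theta>) z - b_hat (b \<theta>) (\<sigma> \<theta>) z'\<bar> \<le> Lip * high * \<bar>z - z'\<bar>"
    using hat_diff_le(1)[OF assms assms *] high_pos by (simp add: mult.assoc)
  show "\<bar>c_hat (\<sigma> \<theta>) z - c_hat (\<sigma> \<theta>) z'\<bar> \<le> Lip * high * \<bar>z - z'\<bar>"
    using hat_diff_le(2)[OF assms assms *] high_pos by (simp add: mult.assoc)
qed

end

section \<open>The flow and its linearization\<close>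

lemma C1_map_on_frechet_eq:
  assumes "C1_map_on S f"
  obtains D where "\<And>u. u \<in> S \<Longrightarrow> (f has_derivative blinfun_apply (D u)) (at u)" "continuous_on S D"
    "\<And>u. u \<in> S \<Longrightarrow> frechet_derivative f (at u) = blinfun_apply (D u)"
proof -
  obtain D where D: "\<And>u. u \<in> S \<Longrightarrow> (f has_derivative blinfun_apply (D u)) (at u)" "continuous_on S D"
    by (rule C1_map_onE[OF assms]) blast
  from D frechet_derivative_at[OF D(1), symmetric] show thesis by (rule that)
qed

lemma C1_map_on_has_frechet_derivative:
  assumes "C1_map_on S f" "u \<in> S"
  shows "(f has_derivative frechet_derivative f (at u)) (at u)"
proof -
  obtain D where D: "\<And>u. u \<in> S \<Longrightarrow> (f has_derivative blinfun_apply (D u)) (at u)"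
    "\<And>u. u \<in> S \<Longrightarrow> frechet_derivative f (at u) = blinfun_apply (D u)"
    by (rule C1_map_on_frechet_eq[OF assms(1)]) (rule that)
  from D(1)[OF assms(2)] show ?thesis by (simp add: D(2)[OF assms(2)])
qed

lemma C1_map_on_frechet_continuous:
  assumes "C1_map_on S f" "continuous_on X \<phi>" "\<phi> ` X \<subseteq> S" "continuous_on X \<psi>"
  shows "continuous_on X (\<lambda>r. frechet_derivative f (at (\<phi> r)) (\<psi> r))"
proof -
  obtain D where D: "continuous_on S D"
    "\<And>u. u \<in> S \<Longrightarrow> frechet_derivative f (at u) = blinfun_apply (D u)"
    by (rule C1_map_on_frechet_eq[OF assms(1)]) (rule that)
  have "continuous_on X (\<lambda>r. blinfun_apply (D (\<phi> r)) (\<psi> r))"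
    using assms by (intro continuous_intros continuous_on_compose2[OF D(1)])
  then show ?thesis
    using assms(3) by (simp add: D(2) image_subset_iff cong: continuous_on_cong)
qed

lemma C1_map_on_frechet_expansion:
  fixes f :: "'a::euclidean_space \<Rightarrow> real"
  assumes "open S" "compact C" "C \<subseteq> S" "0 < \<epsilon>" "C1_map_on S f"
  shows "\<exists>\<delta>>0. \<forall>u\<in>C. \<forall>h. norm h \<le> \<delta> \<longrightarrow> \<bar>f (u + h) - f u - frechet_derivative f (at u) h\<bar> \<le> \<epsilon> * norm h"
proof -
  obtain D where D: "\<And>u. u \<in> S \<Longrightarrow> (f has_derivative blinfun_apply (D u)) (at u)" "continuous_on S D"
    "\<And>u. u \<in> S \<Longrightarrow> frechet_derivative f (at u) = blinfun_apply (D u)"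
    by (rule C1_map_on_frechet_eq[OF assms(5)]) (rule that)
  from C1_map_on_uniform_expansion[OF assms(1-4) D(1,2)] assms(3) show ?thesis
    by (auto simp: D(3) subset_iff)
qed

section \<open>The flow equation and its Lipschitz dependence on parameter and starting
  point\<close>

locale flow_family = coefficient_family A b \<sigma> L low high
  for A :: "'a::euclidean_space set" and b \<sigma> L low high +
  fixes T \<Lambda> \<kappa> \<rho> :: real and \<Theta>0 :: "'a set"
  assumes T_pos: "0 < T" and \<Lambda>_pos: "0 < \<Lambda>" and \<rho>_pos: "0 < \<rho>" and \<kappa>_nonneg: "0 \<le> \<kappa>"
    and compact_\<Theta>0: "compact \<Theta>0"
    and cball_subset: "\<And>\<theta>. \<theta> \<in> \<Theta>0 \<Longrightarrow> cball \<theta> \<rho> \<subseteq> A"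
    and param_lipschitz: "\<And>\<theta> v. \<theta> \<in> \<Theta>0 \<Longrightarrow> norm v \<le> \<rho> \<Longrightarrow> norm (b (\<theta> + v) - b \<theta>) \<le> \<kappa> * norm v"
      "\<And>\<theta> v. \<theta> \<in> \<Theta>0 \<Longrightarrow> norm v \<le> \<rho> \<Longrightarrow> norm (\<sigma> (\<theta> + v) - \<sigma> \<theta>) \<le> \<kappa> * norm v"
begin

abbreviation "F \<equiv> \<lambda>u. lamperti (\<sigma> (fst u)) (snd u)"
abbreviation "G \<equiv> \<lambda>u. lamperti_inv (\<sigma> (fst u)) (snd u)"
abbreviation "B \<equiv> \<lambda>u. b_hat (b (fst u)) (\<sigma> (fst u)) (snd u)"
abbreviation "C \<equiv> \<lambda>u. c_hat (\<sigma> (fst u)) (snd u)"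

lemma in_A: "\<theta> \<in> \<Theta>0 \<Longrightarrow> norm v \<le> \<rho> \<Longrightarrow> \<theta> + v \<in> A" "\<theta> \<in> \<Theta>0 \<Longrightarrow> \<theta> \<in> A"
  using cball_subset[of \<theta>] \<rho>_pos by (auto simp: dist_norm subset_iff)

text \<open>Ellipticity bounds \<open>L\<close> from below, since
  \<open>low \<le> \<sigma> \<theta> 0 \<le> L\<close>; dividing by \<open>L\<close> in
  \<open>sens\<close> is therefore legitimate.\<close>

lemma L_pos: "\<theta> \<in> A \<Longrightarrow> 0 < L"
  using Cb_iter_deriv_abs_le[of 0 "\<sigma> \<theta>" 0] \<sigma>_bounds(1)[of \<theta> 0] norm_\<sigma>[of \<theta>] low_pos by simp

lemma high_pos: "\<theta> \<in> A \<Longrightarrow> 0 < high"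
  using elliptic.high_pos[OF elliptic_\<sigma>] .

lemma open_AU: "open (A \<times> (UNIV :: real set))"
  using open_A by (simp add: open_Times)

text \<open>The Lipschitz constant of the full drift in the state. In \<open>sens\<close>, the first
  term is the change of the coefficients at a fixed point, in the units of
  \<open>hat_diff_le\<close>, and the second is the displacement of the inverse transform per unit
  of \<open>\<bar>z\<bar>\<close>.\<close>

definition "rate = Lip * high * (1 + \<Lambda>)"
definition "sens = \<kappa> / L + high\<^sup>2 / low\<^sup>2 * \<kappa>"

lemma rate_nonneg: "\<theta> \<in> A \<Longrightarrow> 0 \<le> rate"
  using Lip_nonneg high_pos[of \<theta>] \<Lambda>_pos by (auto simp: rate_def intro!: mult_nonneg_nonneg)

lemma sens_nonneg: "\<theta> \<in> A \<Longrightarrow> 0 \<le> sens"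
  using L_pos[of \<theta>] \<kappa>_nonneg by (auto simp: sens_def)

lemma elliptic_pair_\<sigma>:
  assumes "\<theta> \<in> \<Theta>0" "norm v \<le> \<rho>"
  shows "elliptic_pair (\<sigma> (\<theta> + v)) (\<sigma> \<theta>) low high (\<kappa> * norm v)"
proof -
  interpret e1: elliptic "\<sigma> (\<theta> + v)" low high by (rule elliptic_\<sigma>[OF in_A(1)[OF assms]])
  interpret e2: elliptic "\<sigma> \<theta>" low high by (rule elliptic_\<sigma>[OF in_A(2)[OF assms(1)]])
  show ?thesis
  proof
    show "\<bar>\<sigma> (\<theta> + v) y - \<sigma> \<theta> y\<bar> \<le> \<kappa> * norm v" for y
      using Cb_iter_deriv_abs_le[of 0 "\<sigma> (\<theta> + v) - \<sigma> \<theta>" y] param_lipschitz(2)[OF assms]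
      by (simp add: minus_Cb.rep_eq)
  qed
qed

lemma param_diff:
  assumes "\<theta> \<in> \<Theta>0" "norm v \<le> \<rho>"
  shows "\<bar>B (\<theta> + v, z) - B (\<theta>, z)\<bar> \<le> Lip * (sens * (1 + \<bar>z\<bar>) * norm v)"
    and "\<bar>C (\<theta> + v, z) - C (\<theta>, z)\<bar> \<le> Lip * (sens * (1 + \<bar>z\<bar>) * norm v)"
    and "\<bar>F (\<theta> + v, z) - F (\<theta>, z)\<bar> \<le> \<kappa> / low\<^sup>2 * \<bar>z\<bar> * norm v"
    and "\<bar>G (\<theta> + v, z) - G (\<theta>, z)\<bar> \<le> high\<^sup>2 / low\<^sup>2 * \<kappa> * \<bar>z\<bar> * norm v"
proof -
  interpret elliptic_pair "\<sigma> (\<theta> + v)" "\<sigma> \<theta>" low high "\<kappa> * norm v" by (rule elliptic_pair_\<sigma>[OF assms])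
  note A = in_A(1)[OF assms] in_A(2)[OF assms(1)]
  let ?y = "lamperti_inv (\<sigma> (\<theta> + v)) z" and ?y' = "lamperti_inv (\<sigma> \<theta>) z"
  let ?\<delta> = "\<kappa> * norm v / L + high\<^sup>2 / low\<^sup>2 * (\<kappa> * norm v) * \<bar>z\<bar>"
  have \<delta>: "0 \<le> ?\<delta>" using L_pos[OF A(1)] \<kappa>_nonneg by auto
  \<comment> \<open>The intermediate value \<open>f'\<close> is the coefficient with the new
    parameter at the old point: moving the point costs \<open>L\<close>, changing the parameter
    costs \<open>\<kappa>\<close>.\<close>
  have gen: "\<bar>f - h\<bar> \<le> L * ?\<delta>" if "\<bar>f - f'\<bar> \<le> L * \<bar>?y - ?y'\<bar>" "\<bar>f' - h\<bar> \<le> \<kappa> * norm v" for f f' h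
  proof -
    have "\<bar>f - h\<bar> \<le> L * \<bar>?y - ?y'\<bar> + \<kappa> * norm v" using that by linarith
    also have "\<dots> \<le> L * (high\<^sup>2 / low\<^sup>2 * (\<kappa> * norm v) * \<bar>z\<bar>) + \<kappa> * norm v"
      using lamperti_inv_param_diff[of z] L_nonneg[OF A(1)] by (intro add_right_mono mult_left_mono)
    also have "\<dots> = L * ?\<delta>" using L_pos[OF A(1)] by (simp add: field_simps)
    finally show ?thesis .
  qed
  have "\<bar>b (\<theta> + v) y - b \<theta> y\<bar> \<le> \<kappa> * norm v" "\<bar>\<sigma> (\<theta> + v) y - \<sigma> \<theta> y\<bar> \<le> \<kappa> * norm v"
    "\<bar>deriv (\<sigma> (\<theta> + v)) y - deriv (\<sigma> \<theta>) y\<bar> \<le> \<kappa> * norm v" for y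
    using Cb_iter_deriv_abs_le[of 0 "b (\<theta> + v) - b \<theta>" y] Cb_iter_deriv_abs_le[of 0 "\<sigma> (\<theta> + v) - \<sigma> \<theta>" y]
      Cb_iter_deriv_abs_le[of 1 "\<sigma> (\<theta> + v) - \<sigma> \<theta>" y] Cb_iter_deriv_diff[of 1 "\<sigma> (\<theta> + v)" "\<sigma> \<theta>" y]
      param_lipschitz[OF assms]
    by (auto simp: minus_Cb.rep_eq)
  note d = gen[OF coefficient_lipschitz(1)[OF A(1)] this(1)] gen[OF coefficient_lipschitz(2)[OF A(1)] this(2)]
    gen[OF coefficient_lipschitz(3)[OF A(1)] this(3)]
  have "?\<delta> = \<kappa> / L * norm v + high\<^sup>2 / low\<^sup>2 * \<kappa> * (\<bar>z\<bar> * norm v)" by simp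
  also have "\<dots> \<le> \<kappa> / L * ((1 + \<bar>z\<bar>) * norm v) + high\<^sup>2 / low\<^sup>2 * \<kappa> * ((1 + \<bar>z\<bar>) * norm v)"
    using L_pos[OF A(1)] \<kappa>_nonneg by (intro add_mono mult_left_mono) (auto simp: algebra_simps)
  also have "\<dots> = sens * (1 + \<bar>z\<bar>) * norm v" by (simp add: sens_def algebra_simps)
  finally have le: "Lip * ?\<delta> \<le> Lip * (sens * (1 + \<bar>z\<bar>) * norm v)"
    using Lip_nonneg A by (intro mult_left_mono) auto
  show "\<bar>B (\<theta> + v, z) - B (\<theta>, z)\<bar> \<le> Lip * (sens * (1 + \<bar>z\<bar>) * norm v)"
    using order_trans[OF hat_diff_le(1)[OF A d \<delta>] le] by simp
  show "\<bar>C (\<theta> + v, z) - C (\<theta>, z)\<bar> \<le> Lip * (sens * (1 + \<bar>z\<bar>) * norm v)"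
    using order_trans[OF hat_diff_le(2)[OF A d \<delta>] le] by simp
  show "\<bar>F (\<theta> + v, z) - F (\<theta>, z)\<bar> \<le> \<kappa> / low\<^sup>2 * \<bar>z\<bar> * norm v"
    using lamperti_param_diff[of z] by (simp add: mult_ac)
  show "\<bar>G (\<theta> + v, z) - G (\<theta>, z)\<bar> \<le> high\<^sup>2 / low\<^sup>2 * \<kappa> * \<bar>z\<bar> * norm v"
    using lamperti_inv_param_diff[of z] by (simp add: mult_ac)
qed

text \<open>\<open>g\<close> is the density of \<open>dq\<close>, which exists because \<open>q\<close> is Lipschitz.\<close>

definition bracket_density :: "(real \<Rightarrow> real) \<Rightarrow> bool" where
  "bracket_density g \<longleftrightarrow> g \<in> borel_measurable borel \<and> (\<forall>r. 0 \<le> g r \<and> g r \<le> \<Lambda>)"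

definition drift :: "(real \<Rightarrow> real) \<Rightarrow> 'a \<Rightarrow> real \<Rightarrow> real \<Rightarrow> real" where
  "drift g \<theta> r z = B (\<theta>, z) + g r * C (\<theta>, z)"

definition solves :: "(real \<Rightarrow> real) \<Rightarrow> 'a \<Rightarrow> real \<Rightarrow> path \<Rightarrow> real \<Rightarrow> (real \<Rightarrow> real) \<Rightarrow> bool" where
  "solves g \<theta> s x y Z \<longleftrightarrow> continuous_on {s..T} Z \<and>
    (\<forall>t\<in>{s..T}. Z t = F (\<theta>, y) + x t - x s + integral {s..t} (\<lambda>r. drift g \<theta> r (Z r)))"

text \<open>The drift, its increments and its linearization errors are all of the form
  \<open>\<beta> + g r * \<gamma>\<close>. Estimating them through this lemma keeps every constant
  independent of \<open>g\<close>.\<close>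

lemma density_combination_bound:
  assumes "bracket_density g" "\<bar>\<beta>\<bar> \<le> M" "\<bar>\<gamma>\<bar> \<le> M"
  shows "\<bar>\<beta> + g r * \<gamma>\<bar> \<le> (1 + \<Lambda>) * M"
proof -
  have "\<bar>g r\<bar> * \<bar>\<gamma>\<bar> \<le> \<Lambda> * M" using assms by (intro mult_mono) (auto simp: bracket_density_def)
  with assms(2) show ?thesis
    using abs_triangle_ineq[of \<beta> "g r * \<gamma>"] by (simp add: abs_mult algebra_simps)
qed

lemma density_integrable:
  assumes "bracket_density g" "continuous_on {s..t} \<beta>" "continuous_on {s..t} \<gamma>"
  shows "(\<lambda>r. \<beta> r + g r * \<gamma> r) integrable_on {s..t}"
proof -
  have "\<bar>g r\<bar> \<le> \<Lambda>" for r using assms(1) by (auto simp: bracket_density_def)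
  then have "set_integrable lborel {s..t} (\<lambda>r. g r * \<gamma> r)"
    using assms by (intro set_integrable_bounded_times_continuous) (auto simp: bracket_density_def)
  from integrable_add[OF integrable_continuous_interval[OF assms(2)] set_borel_integral_eq_integral(1)[OF this]]
  show ?thesis .
qed

lemma continuous_on_coefficients:
  assumes "\<theta> \<in> A" "continuous_on X u"
  shows "continuous_on X (\<lambda>r. B (\<theta>, u r))" "continuous_on X (\<lambda>r. C (\<theta>, u r))"
proof -
  have 1: "continuous_on X (\<lambda>r. (\<theta>, u r))" by (intro continuous_intros assms)
  have 2: "(\<lambda>r. (\<theta>, u r)) ` X \<subseteq> A \<times> UNIV" using assms(1) by auto
  show "continuous_on X (\<lambda>r. B (\<theta>, u r))"
    by (rule continuous_on_compose2[OF C1_map_on_imp_continuous_on[OF C1_b_hat] 1 2])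
  show "continuous_on X (\<lambda>r. C (\<theta>, u r))"
    by (rule continuous_on_compose2[OF C1_map_on_imp_continuous_on[OF C1_c_hat] 1 2])
qed

lemma drift_integrable:
  assumes "bracket_density g" "\<theta> \<in> A" "continuous_on {s..t} u"
  shows "(\<lambda>r. drift g \<theta> r (u r)) integrable_on {s..t}"
  unfolding drift_def by (intro density_integrable continuous_on_coefficients assms)

lemma drift_lipschitz:
  assumes "bracket_density g" "\<theta> \<in> A"
  shows "\<bar>drift g \<theta> r z - drift g \<theta> r z'\<bar> \<le> rate * \<bar>z - z'\<bar>"
proof -
  have "\<bar>(B (\<theta>, z) - B (\<theta>, z')) + g r * (C (\<theta>, z) - C (\<theta>, z'))\<bar> \<le> (1 + \<Lambda>) * (Lip * high * \<bar>z - z'\<bar>)"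
    using hat_lipschitz[OF assms(2), of z z'] by (intro density_combination_bound assms) auto
  then show ?thesis by (simp add: drift_def rate_def algebra_simps)
qed

lemma drift_bound:
  assumes "bracket_density g" "\<theta> \<in> A"
  shows "\<bar>drift g \<theta> r z\<bar> \<le> (1 + \<Lambda>) * (L / low + L)"
proof -
  have "0 \<le> L / low" using L_nonneg[OF assms(2)] low_pos by simp
  then show ?thesis
    unfolding drift_def
    using b_hat_abs_le[OF assms(2), of z] c_hat_abs_le[OF assms(2), of z] L_nonneg[OF assms(2)]
    by (intro density_combination_bound assms) auto
qed

lemma solves_exists:
  assumes "bracket_density g" "\<theta> \<in> A" "s \<le> T"
  shows "\<exists>Z. solves g \<theta> s x y Z"
  unfolding solves_def
  using assms by (intro picard[of s T rate] drift_integrable drift_lipschitz rate_nonneg continuous_intros) auto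

lemma solves_unique:
  assumes "bracket_density g" "\<theta> \<in> A" "solves g \<theta> s x y Z" "solves g \<theta> s x y Z'" "t \<in> {s..T}"
  shows "Z t = Z' t"
  by (rule picard_unique[where K = rate and f = "drift g \<theta>" and g = "\<lambda>t. F (\<theta>, y) + x t - x s"])
    (use assms in \<open>auto intro!: drift_integrable drift_lipschitz rate_nonneg simp: solves_def\<close>)

text \<open>Existence and uniqueness together show that the definite description in
  \<open>flow_solution\<close> denotes an actual solution. One density, taken from \<open>q\<close>,
  works for all parameters, starting times, paths and starting points.\<close>

lemma flow_solution_solves:
  assumes q: "\<And>s t. 0 \<le> s \<Longrightarrow> s \<le> t \<Longrightarrow> t \<le> T \<Longrightarrow> 0 \<le> q t - q s \<and> q t - q s \<le> \<Lambda> * (t - s)"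
  obtains g where "bracket_density g"
    "\<And>\<theta> s x y. \<theta> \<in> A \<Longrightarrow> 0 \<le> s \<Longrightarrow> s \<le> T \<Longrightarrow> solves g \<theta> s x y (flow_solution T (b \<theta>) (\<sigma> \<theta>) s x q y)"
proof -
  obtain g where "g \<in> borel_measurable borel" "\<And>r. 0 \<le> g r \<and> g r \<le> \<Lambda>"
    and st: "\<And>h s t. continuous_on {s..t} h \<Longrightarrow>
      (LINT r:{s..t}|stieltjes T q. h r) = integral {s..t} (\<lambda>r. g r * h r)"
    by (rule stieltjes_density[OF \<Lambda>_pos less_imp_le[OF T_pos] q], assumption+) (rule that)
  then have g: "bracket_density g" by (simp add: bracket_density_def)
  have iff: "flow_equation T (b \<theta>) (\<sigma> \<theta>) s x q y Z \<longleftrightarrow> solves g \<theta> s x y Z" if "\<theta> \<in> A" for \<theta> s x y Z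
  proof (cases "continuous_on {s..T} Z")
    case True
    have "(LBINT r:{s..t}. b_hat (b \<theta>) (\<sigma> \<theta>) (Z r)) + (LINT r:{s..t}|stieltjes T q. c_hat (\<sigma> \<theta>) (Z r))
        = integral {s..t} (\<lambda>r. drift g \<theta> r (Z r))" if "t \<in> {s..T}" for t
    proof -
      have "continuous_on {s..t} Z" using that by (intro continuous_on_subset[OF True]) auto
      note c = continuous_on_coefficients[OF \<open>\<theta> \<in> A\<close> this]
      have gc: "(\<lambda>r. g r * C (\<theta>, Z r)) integrable_on {s..t}"
        using density_integrable[OF g continuous_on_const[of _ 0] c(2)] by simp
      have "(LBINT r:{s..t}. b_hat (b \<theta>) (\<sigma> \<theta>) (Z r)) = integral {s..t} (\<lambda>r. B (\<theta>, Z r))"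
        using c(1) by (subst set_borel_integral_eq_integral) (auto intro!: borel_integrable_atLeastAtMost')
      moreover have "(LINT r:{s..t}|stieltjes T q. c_hat (\<sigma> \<theta>) (Z r)) = integral {s..t} (\<lambda>r. g r * C (\<theta>, Z r))"
        using st[OF c(2)] by simp
      ultimately show ?thesis
        unfolding drift_def by (simp add: integral_add[OF integrable_continuous_interval[OF c(1)] gc, simplified])
    qed
    then show ?thesis
      by (auto simp: flow_equation_def solves_def algebra_simps)
  qed (auto simp: flow_equation_def solves_def)
  have "solves g \<theta> s x y (flow_solution T (b \<theta>) (\<sigma> \<theta>) s x q y)" if "\<theta> \<in> A" "0 \<le> s" "s \<le> T" for \<theta> s x y
  proof -
    obtain Z where Z: "solves g \<theta> s x y Z" using solves_exists[OF g] \<open>\<theta> \<in> A\<close> \<open>s \<le> T\<close> by blast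
    \<comment> \<open>Extensionality forces a truncation of the solution outside
      \<open>{s..T}\<close>; integrals up to \<open>t \<le> T\<close> do not see it.\<close>
    have "integral {s..t} (\<lambda>r. drift g \<theta> r (restrict Z {s..T} r)) = integral {s..t} (\<lambda>r. drift g \<theta> r (Z r))"
      if "t \<in> {s..T}" for t
      using that by (intro integral_cong) auto
    moreover have "continuous_on {s..T} (restrict Z {s..T})"
      by (rule continuous_on_cong[THEN iffD1, of "{s..T}" "{s..T}" Z]) (use Z in \<open>auto simp: solves_def\<close>)
    ultimately have Z': "solves g \<theta> s x y (restrict Z {s..T})"
      using Z by (auto simp: solves_def)
    have "\<exists>!Z. Z \<in> extensional {s..T} \<and> flow_equation T (b \<theta>) (\<sigma> \<theta>) s x q y Z"
    proof (rule ex1I[of _ "restrict Z {s..T}"])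
      show "restrict Z {s..T} \<in> extensional {s..T} \<and> flow_equation T (b \<theta>) (\<sigma> \<theta>) s x q y (restrict Z {s..T})"
        using Z' iff[OF \<open>\<theta> \<in> A\<close>] by simp
      fix Z1 assume Z1: "Z1 \<in> extensional {s..T} \<and> flow_equation T (b \<theta>) (\<sigma> \<theta>) s x q y Z1"
      then have "solves g \<theta> s x y Z1" using iff[OF \<open>\<theta> \<in> A\<close>] by simp
      from solves_unique[OF g \<open>\<theta> \<in> A\<close> this Z'] Z1 show "Z1 = restrict Z {s..T}"
        by (intro extensionalityI[of _ "{s..T}"]) auto
    qed
    from theI'[OF this] show ?thesis unfolding flow_solution_def iff[OF \<open>\<theta> \<in> A\<close>] by simp
  qed
  with g show thesis by (rule that)
qed

lemma Pair_norm_bounds: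
  fixes v :: 'a and w :: real
  shows "norm v \<le> norm (v, w)" "\<bar>w\<bar> \<le> norm (v, w)" "norm (v, w) \<le> norm v + \<bar>w\<bar>"
  using norm_fst_le[of v w] norm_snd_le[of w v] norm_Pair_le[of v w] by auto

definition "range_bound r = r / low + T * ((1 + \<Lambda>) * (L / low + L))"

text \<open>The drift is bounded, so a direct integration suffices; the path enters through the two
  values \<open>x t\<close> and \<open>x s\<close>, each at most \<open>norm x\<close>.\<close>

lemma solves_bound:
  assumes g: "bracket_density g" and \<theta>: "\<theta> \<in> A" and "0 \<le> s" "solves g \<theta> s x y Z" "t \<in> {s..T}"
  shows "\<bar>Z t\<bar> \<le> range_bound \<bar>y\<bar> + 2 * norm x"
proof -
  have c: "continuous_on {s..t} Z" using assms by (auto simp: solves_def intro: continuous_on_subset)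
  have Z: "Z t = F (\<theta>, y) + x t - x s + integral {s..t} (\<lambda>r. drift g \<theta> r (Z r))"
    using assms by (auto simp: solves_def)
  have "norm (integral {s..t} (\<lambda>r. drift g \<theta> r (Z r))) \<le> integral {s..t} (\<lambda>r. (1 + \<Lambda>) * (L / low + L))"
    using drift_bound[OF g \<theta>] by (intro integral_norm_bound_integral drift_integrable g \<theta> c) auto
  also have "\<dots> = (t - s) * ((1 + \<Lambda>) * (L / low + L))" using assms by simp
  also have "\<dots> \<le> T * ((1 + \<Lambda>) * (L / low + L))"
    using assms L_pos[OF \<theta>] low_pos \<Lambda>_pos by (intro mult_right_mono) auto
  finally have "\<bar>integral {s..t} (\<lambda>r. drift g \<theta> r (Z r))\<bar> \<le> T * ((1 + \<Lambda>) * (L / low + L))" by simp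
  moreover have "\<bar>F (\<theta>, y)\<bar> \<le> \<bar>y\<bar> / low" using elliptic.lamperti_abs_le[OF elliptic_\<sigma>[OF \<theta>]] by simp
  moreover have "\<bar>x t\<bar> \<le> norm x" "\<bar>x s\<bar> \<le> norm x" using norm_bounded[of x t] norm_bounded[of x s] by auto
  ultimately show ?thesis unfolding Z range_bound_def by linarith
qed

lemma range_bound_mono: "r \<le> r' \<Longrightarrow> range_bound r \<le> range_bound r'"
  using low_pos by (simp add: range_bound_def divide_right_mono)

text \<open>The constant depends on \<open>m\<close> alone, while density and path are quantified
  inside. The factor \<open>1 + norm x\<close> carries the linear growth of the parameter increments
  along the solution.\<close>

definition lipschitz_constant :: "real \<Rightarrow> real \<Rightarrow> bool" where
  "lipschitz_constant m c \<longleftrightarrow> (\<forall>g \<theta> s x y v w Z Z' t. bracket_density g \<longrightarrow> \<theta> \<in> \<Theta>0 \<longrightarrow> 0 \<le> s \<longrightarrow> \<bar>y\<bar> \<le> m \<longrightarrow>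
    norm (v, w) \<le> \<rho> \<longrightarrow> solves g \<theta> s x y Z \<longrightarrow> solves g (\<theta> + v) s x (y + w) Z' \<longrightarrow> t \<in> {s..T} \<longrightarrow>
    \<bar>Z' t - Z t\<bar> \<le> c * (1 + norm x) * norm (v, w))"

text \<open>The drift difference is split at the new parameter and the old solution. The change of
  state costs \<open>rate\<close> and goes into Gronwall; the change of parameter at
  \<open>Z r\<close> is a forcing term of the order of \<open>1 + \<bar>Z r\<bar>\<close>.\<close>

lemma solves_lipschitz:
  assumes "0 \<le> m"
  shows "\<exists>c\<ge>0. lipschitz_constant m c"
\<comment> \<open>The signs of the constants are derived from a point of \<open>A\<close>. For empty
  \<open>\<Theta>0\<close> there may be none, but then the claim is vacuous.\<close>
proof (cases "\<Theta>0 = {}")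
  case False
  then obtain \<theta>0 where \<theta>0: "\<theta>0 \<in> A" using in_A(2) by auto
  \<comment> \<open>Chosen so that \<open>1 + \<bar>Z r\<bar> \<le> N * (1 + norm x)\<close>: the
    summand 2 absorbs the term \<open>2 * norm x\<close> of \<open>solves_bound\<close>.\<close>
  define N where "N = 1 + range_bound m + 2"
  define \<beta>0 where "\<beta>0 = (1 + \<Lambda>) * (Lip * (sens * N))"
  define \<alpha>0 where "\<alpha>0 = 1 / low + \<kappa> / low\<^sup>2 * m"
  define c where "c = 2 * (\<alpha>0 + \<beta>0 * T) * exp ((2 * rate + 1) * T)"
  have rb: "0 \<le> range_bound m" using L_pos[OF \<theta>0] low_pos T_pos \<Lambda>_pos \<open>0 \<le> m\<close> by (auto simp: range_bound_def)
  then have N: "0 \<le> N" by (simp add: N_def)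
  have \<beta>0: "0 \<le> \<beta>0" using N sens_nonneg[OF \<theta>0] Lip_nonneg \<theta>0 \<Lambda>_pos by (auto simp: \<beta>0_def intro!: mult_nonneg_nonneg)
  have \<alpha>0: "0 \<le> \<alpha>0" using low_pos \<kappa>_nonneg \<open>0 \<le> m\<close> by (auto simp: \<alpha>0_def)
  have c: "0 \<le> c" using \<alpha>0 \<beta>0 T_pos by (auto simp: c_def)
  have "\<bar>Z' t - Z t\<bar> \<le> c * (1 + norm x) * norm (v, w)"
    if g: "bracket_density g" and \<theta>: "\<theta> \<in> \<Theta>0" and "0 \<le> s" "\<bar>y\<bar> \<le> m" and v: "norm (v, w) \<le> \<rho>"
      and Z: "solves g \<theta> s x y Z" and Z': "solves g (\<theta> + v) s x (y + w) Z'" and t: "t \<in> {s..T}"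
    for g \<theta> s and x :: path and y v w Z Z' t
  proof -
    have v': "norm v \<le> \<rho>" using v Pair_norm_bounds[where v = v and w = w] by linarith
    note A = in_A(2)[OF \<theta>] in_A(1)[OF \<theta> v']
    have cZ: "continuous_on {s..T} Z" "continuous_on {s..T} Z'" using Z Z' by (auto simp: solves_def)
    define n where "n = (1 + norm x) * norm (v, w)"
    have n: "norm (v, w) \<le> n" unfolding n_def by (simp add: algebra_simps)
    then have n0: "0 \<le> n" using norm_ge_zero order_trans by blast
    let ?h = "\<lambda>r. drift g (\<theta> + v) r (Z' r) - drift g \<theta> r (Z r)"
    let ?a = "F (\<theta> + v, y + w) - F (\<theta>, y)"
    have a: "\<bar>?a\<bar> \<le> \<alpha>0 * n"
    proof -
      have "\<bar>F (\<theta> + v, y + w) - F (\<theta> + v, y)\<bar> \<le> \<bar>w\<bar> / low"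
        using elliptic.lamperti_diff_le[OF elliptic_\<sigma>[OF A(2)], of "y + w" y] by simp
      moreover have "\<bar>F (\<theta> + v, y) - F (\<theta>, y)\<bar> \<le> \<kappa> / low\<^sup>2 * m * norm v"
      proof (rule order_trans[OF param_diff(3)[OF \<theta> v']])
        show "\<kappa> / low\<^sup>2 * \<bar>y\<bar> * norm v \<le> \<kappa> / low\<^sup>2 * m * norm v"
          using \<kappa>_nonneg \<open>\<bar>y\<bar> \<le> m\<close> by (intro mult_right_mono mult_left_mono) auto
      qed
      moreover have "\<bar>w\<bar> / low \<le> n / low"
        using Pair_norm_bounds(2)[where v = v and w = w] n low_pos by (intro divide_right_mono) auto
      moreover have "\<kappa> / low\<^sup>2 * m * norm v \<le> \<kappa> / low\<^sup>2 * m * n"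
        using Pair_norm_bounds(1)[where v = v and w = w] n \<kappa>_nonneg \<open>0 \<le> m\<close> by (intro mult_left_mono) auto
      ultimately have "\<bar>?a\<bar> \<le> n / low + \<kappa> / low\<^sup>2 * m * n" by linarith
      then show ?thesis by (simp add: \<alpha>0_def algebra_simps)
    qed
    have h: "\<bar>?h r\<bar> \<le> \<beta>0 * n + rate * \<bar>Z' r - Z r\<bar>" if r: "r \<in> {s..T}" for r
    proof -
      have "1 + \<bar>Z r\<bar> \<le> N * (1 + norm x)"
      proof -
        have "1 + \<bar>Z r\<bar> \<le> 1 + range_bound m + 2 * norm x"
          using solves_bound[OF g A(1) \<open>0 \<le> s\<close> Z r] range_bound_mono[OF \<open>\<bar>y\<bar> \<le> m\<close>] by linarith
        also have "\<dots> \<le> N * (1 + norm x)"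
          using mult_nonneg_nonneg[OF rb norm_ge_zero[of x]] norm_ge_zero[of x] by (simp add: N_def algebra_simps)
        finally show ?thesis .
      qed
      then have "sens * (1 + \<bar>Z r\<bar>) * norm v \<le> sens * (N * (1 + norm x)) * norm (v, w)"
        using sens_nonneg[OF \<theta>0] Pair_norm_bounds(1)[where v = v and w = w] N by (intro mult_mono mult_left_mono) auto
      then have le: "Lip * (sens * (1 + \<bar>Z r\<bar>) * norm v) \<le> Lip * (sens * N * n)"
        using Lip_nonneg \<theta>0 by (intro mult_left_mono) (auto simp: n_def mult.assoc)
      have "\<bar>drift g (\<theta> + v) r (Z r) - drift g \<theta> r (Z r)\<bar>
          = \<bar>(B (\<theta> + v, Z r) - B (\<theta>, Z r)) + g r * (C (\<theta> + v, Z r) - C (\<theta>, Z r))\<bar>"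
        by (simp add: drift_def algebra_simps)
      also have "\<dots> \<le> (1 + \<Lambda>) * (Lip * (sens * N * n))"
        by (intro density_combination_bound g order_trans[OF param_diff(1)[OF \<theta> v'] le]
            order_trans[OF param_diff(2)[OF \<theta> v'] le])
      also have "\<dots> = \<beta>0 * n" by (simp add: \<beta>0_def)
      finally show ?thesis
        using drift_lipschitz[OF g A(2), of r "Z' r" "Z r"] by linarith
    qed
    have "\<bar>Z' t - Z t\<bar> \<le> 2 * (\<alpha>0 * n + \<beta>0 * n * (T - s)) * exp ((2 * rate + 1) * (T - s))"
    proof (rule gronwall[where u = "\<lambda>t. Z' t - Z t" and h = ?h])
      show "?h integrable_on {s..T}" by (intro integrable_diff drift_integrable g A cZ)
      fix t assume t: "t \<in> {s..T}"
      then have "{s..t} \<subseteq> {s..T}" by auto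
      note c' = continuous_on_subset[OF cZ(1) this] continuous_on_subset[OF cZ(2) this]
      have "Z' t - Z t = ?a + integral {s..t} ?h"
        using Z Z' t by (subst integral_diff) (auto intro!: drift_integrable g A c' simp: solves_def)
      then show "\<bar>Z' t - Z t\<bar> \<le> \<alpha>0 * n + \<bar>integral {s..t} ?h\<bar>" using a by linarith
    qed (use h n0 \<alpha>0 \<beta>0 t cZ rate_nonneg[OF \<theta>0] in \<open>auto intro!: continuous_intros\<close>)
    also have "\<dots> \<le> 2 * (\<alpha>0 * n + \<beta>0 * n * T) * exp ((2 * rate + 1) * T)"
      using n0 \<alpha>0 \<beta>0 \<open>0 \<le> s\<close> t rate_nonneg[OF \<theta>0] T_pos
      by (intro mult_mono) (auto intro!: add_left_mono mult_left_mono)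
    also have "\<dots> = c * (1 + norm x) * norm (v, w)" by (simp add: c_def n_def algebra_simps)
    finally show ?thesis .
  qed
  then have "lipschitz_constant m c" unfolding lipschitz_constant_def by blast
  with c show ?thesis by blast
next
  case True
  then have "lipschitz_constant m 0" unfolding lipschitz_constant_def by blast
  then show ?thesis by (intro exI[of _ 0]) simp
qed

section \<open>The linearized equation and the first-order expansion of the flow\<close>

abbreviation "dF \<equiv> \<lambda>u. frechet_derivative F (at u)"
abbreviation "dG \<equiv> \<lambda>u. frechet_derivative G (at u)"
abbreviation "dB \<equiv> \<lambda>u. frechet_derivative B (at u)"
abbreviation "dC \<equiv> \<lambda>u. frechet_derivative C (at u)"

lemmas dF = C1_map_on_has_frechet_derivative[OF C1_lamperti]
lemmas dG = C1_map_on_has_frechet_derivative[OF C1_lamperti_inv]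
lemmas dB = C1_map_on_has_frechet_derivative[OF C1_b_hat]
lemmas dC = C1_map_on_has_frechet_derivative[OF C1_c_hat]

lemma linear_dF: "\<theta> \<in> A \<Longrightarrow> linear (dF (\<theta>, z))" and linear_dG: "\<theta> \<in> A \<Longrightarrow> linear (dG (\<theta>, z))"
  and linear_dB: "\<theta> \<in> A \<Longrightarrow> linear (dB (\<theta>, z))" and linear_dC: "\<theta> \<in> A \<Longrightarrow> linear (dC (\<theta>, z))"
  using dF[of "(\<theta>, z)"] dG[of "(\<theta>, z)"] dB[of "(\<theta>, z)"] dC[of "(\<theta>, z)"]
  by (auto intro: has_derivative_linear)

text \<open>In the state direction the derivatives inherit the global Lipschitz constants, uniformly
  in \<open>z\<close>. This makes the linearized equation globally Lipschitz in its unknown, with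
  the same \<open>rate\<close> as the flow.\<close>

lemma partial_bound:
  assumes f: "(f has_derivative f') (at (\<theta> :: 'a, z :: real))"
    and lip: "\<And>z'. \<bar>f (\<theta>, z') - f (\<theta>, z)\<bar> \<le> M * \<bar>z' - z\<bar>"
  shows "\<bar>f' (0, r)\<bar> \<le> M * \<bar>r\<bar>"
proof -
  have "\<bar>f' (0, 1)\<bar> \<le> M"
    by (rule has_derivative_directional_bound[OF f]) (use lip[of "z + _"] in simp)
  moreover have "f' (0, r) = r * f' (0, 1)"
    using linear_scale[OF has_derivative_linear[OF f], of r "(0, 1)"] by simp
  ultimately show ?thesis
    using mult_left_mono[of "\<bar>f' (0, 1)\<bar>" M "\<bar>r\<bar>"] by (simp add: abs_mult mult.commute)
qed

lemma dB_partial: "\<theta> \<in> A \<Longrightarrow> \<bar>dB (\<theta>, z) (0, r)\<bar> \<le> Lip * high * \<bar>r\<bar>"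
  by (rule partial_bound[OF dB]) (simp_all add: hat_lipschitz)

lemma dC_partial: "\<theta> \<in> A \<Longrightarrow> \<bar>dC (\<theta>, z) (0, r)\<bar> \<le> Lip * high * \<bar>r\<bar>"
  by (rule partial_bound[OF dC]) (simp_all add: hat_lipschitz)

lemma dG_partial: "\<theta> \<in> A \<Longrightarrow> \<bar>dG (\<theta>, z) (0, r)\<bar> \<le> high * \<bar>r\<bar>"
  by (rule partial_bound[OF dG]) (simp_all add: elliptic.lamperti_inv_lipschitz[OF elliptic_\<sigma>])

definition dDrift :: "(real \<Rightarrow> real) \<Rightarrow> 'a \<Rightarrow> real \<Rightarrow> real \<Rightarrow> 'a \<times> real \<Rightarrow> real" where
  "dDrift g \<theta> r z h = dB (\<theta>, z) h + g r * dC (\<theta>, z) h"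

lemma dDrift_add: "\<theta> \<in> A \<Longrightarrow> dDrift g \<theta> r z (h + k) = dDrift g \<theta> r z h + dDrift g \<theta> r z k"
  by (simp add: dDrift_def linear_add[OF linear_dB] linear_add[OF linear_dC] algebra_simps)

lemma dDrift_diff: "\<theta> \<in> A \<Longrightarrow> dDrift g \<theta> r z (h - k) = dDrift g \<theta> r z h - dDrift g \<theta> r z k"
  by (simp add: dDrift_def linear_diff[OF linear_dB] linear_diff[OF linear_dC] algebra_simps)

lemma dDrift_scaleR: "\<theta> \<in> A \<Longrightarrow> dDrift g \<theta> r z (a *\<^sub>R h) = a * dDrift g \<theta> r z h"
  by (simp add: dDrift_def linear_scale[OF linear_dB] linear_scale[OF linear_dC] algebra_simps)

lemma dDrift_partial:
  assumes "bracket_density g" "\<theta> \<in> A"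
  shows "\<bar>dDrift g \<theta> r z (0, u)\<bar> \<le> rate * \<bar>u\<bar>"
  using density_combination_bound[OF assms(1) dB_partial[OF assms(2)] dC_partial[OF assms(2)]]
  by (simp add: dDrift_def rate_def mult_ac)

lemma dDrift_integrable:
  assumes "bracket_density g" "\<theta> \<in> A" "continuous_on {s..t} Z" "continuous_on {s..t} u"
  shows "(\<lambda>r. dDrift g \<theta> r (Z r) (v, u r)) integrable_on {s..t}"
  unfolding dDrift_def
  by (intro density_integrable assms(1) C1_map_on_frechet_continuous[OF C1_b_hat] C1_map_on_frechet_continuous[OF C1_c_hat]
      continuous_intros assms) (use assms(2) in auto)

text \<open>The formal derivative of \<open>solves\<close> in the direction \<open>\<eta>\<close>:
  the path increment drops out, the starting term contributes \<open>dF\<close>, and the drift is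
  differentiated along \<open>(fst \<eta>, J r)\<close>.\<close>

definition solves_linearized :: "(real \<Rightarrow> real) \<Rightarrow> 'a \<Rightarrow> real \<Rightarrow> real \<Rightarrow> (real \<Rightarrow> real) \<Rightarrow> 'a \<times> real \<Rightarrow> (real \<Rightarrow> real) \<Rightarrow> bool" where
  "solves_linearized g \<theta> s y Z \<eta> J \<longleftrightarrow> continuous_on {s..T} J \<and>
    (\<forall>t\<in>{s..T}. J t = dF (\<theta>, y) \<eta> + integral {s..t} (\<lambda>r. dDrift g \<theta> r (Z r) (fst \<eta>, J r)))"

lemma dDrift_lipschitz:
  assumes "bracket_density g" "\<theta> \<in> A"
  shows "\<bar>dDrift g \<theta> r z (v, u) - dDrift g \<theta> r z (v, u')\<bar> \<le> rate * \<bar>u - u'\<bar>"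
  using dDrift_partial[OF assms, of r z "u - u'"] by (simp flip: dDrift_diff[OF assms(2)])

lemma solves_linearized_exists:
  assumes "bracket_density g" "\<theta> \<in> A" "s \<le> T" "continuous_on {s..T} Z"
  shows "\<exists>J. solves_linearized g \<theta> s y Z \<eta> J"
  unfolding solves_linearized_def
  using assms by (intro picard[of s T rate] dDrift_integrable dDrift_lipschitz rate_nonneg continuous_intros)

lemma solves_linearized_unique:
  assumes "bracket_density g" "\<theta> \<in> A" "continuous_on {s..T} Z"
    and "solves_linearized g \<theta> s y Z \<eta> J" "solves_linearized g \<theta> s y Z \<eta> J'" "t \<in> {s..T}"
  shows "J t = J' t"
  by (rule picard_unique[where K = rate and f = "\<lambda>r u. dDrift g \<theta> r (Z r) (fst \<eta>, u)" and g = "\<lambda>_. dF (\<theta>, y) \<eta>"])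
    (use assms in \<open>auto intro!: dDrift_integrable dDrift_lipschitz rate_nonneg simp: solves_linearized_def\<close>)

text \<open>Solutions are picked separately for each direction. Linearity follows from uniqueness,
  because sums and multiples of the picked solutions solve the equation for the summed or scaled
  direction.\<close>

lemma linearized_flow:
  assumes g: "bracket_density g" and \<theta>: "\<theta> \<in> A" and "s \<le> T" and Z: "continuous_on {s..T} Z"
  obtains J where "\<And>\<eta>. solves_linearized g \<theta> s y Z \<eta> (J \<eta>)"
    "\<And>t. t \<in> {s..T} \<Longrightarrow> linear (\<lambda>\<eta>. J \<eta> t)"
proof -
  define J where "J \<eta> = (SOME J. solves_linearized g \<theta> s y Z \<eta> J)" for \<eta>
  have J: "solves_linearized g \<theta> s y Z \<eta> (J \<eta>)" for \<eta>
    unfolding J_def by (rule someI_ex[OF solves_linearized_exists[OF assms]])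
  have c: "continuous_on {s..T} (J \<eta>)" for \<eta> using J[of \<eta>] by (simp add: solves_linearized_def)
  have c': "continuous_on {s..t} (J \<eta>)" "continuous_on {s..t} Z" if "t \<in> {s..T}" for t \<eta>
    using that by (auto intro!: continuous_on_subset[OF c] continuous_on_subset[OF Z])
  have eq: "J \<eta> t = dF (\<theta>, y) \<eta> + integral {s..t} (\<lambda>r. dDrift g \<theta> r (Z r) (fst \<eta>, J \<eta> r))"
    if "t \<in> {s..T}" for \<eta> t using J[of \<eta>] that by (simp add: solves_linearized_def)
  have "solves_linearized g \<theta> s y Z (\<eta> + \<xi>) (\<lambda>t. J \<eta> t + J \<xi> t)" for \<eta> \<xi>
    unfolding solves_linearized_def
  proof (intro conjI ballI)
    fix t assume t: "t \<in> {s..T}"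
    have "dDrift g \<theta> r (Z r) (fst (\<eta> + \<xi>), J \<eta> r + J \<xi> r)
        = dDrift g \<theta> r (Z r) (fst \<eta>, J \<eta> r) + dDrift g \<theta> r (Z r) (fst \<xi>, J \<xi> r)" for r
      by (simp flip: dDrift_add[OF \<theta>])
    then show "J \<eta> t + J \<xi> t = dF (\<theta>, y) (\<eta> + \<xi>) + integral {s..t} (\<lambda>r. dDrift g \<theta> r (Z r) (fst (\<eta> + \<xi>), J \<eta> r + J \<xi> r))"
      using t by (simp add: eq linear_add[OF linear_dF[OF \<theta>]] integral_add dDrift_integrable g \<theta> c')
  qed (intro continuous_intros c)
  from solves_linearized_unique[OF g \<theta> Z J this]
  have add: "J (\<eta> + \<xi>) t = J \<eta> t + J \<xi> t" if "t \<in> {s..T}" for \<eta> \<xi> t using that .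
  have "solves_linearized g \<theta> s y Z (a *\<^sub>R \<eta>) (\<lambda>t. a * J \<eta> t)" for a \<eta>
    unfolding solves_linearized_def
  proof (intro conjI ballI)
    fix t assume t: "t \<in> {s..T}"
    have "dDrift g \<theta> r (Z r) (fst (a *\<^sub>R \<eta>), a * J \<eta> r) = a * dDrift g \<theta> r (Z r) (fst \<eta>, J \<eta> r)" for r
      by (simp flip: dDrift_scaleR[OF \<theta>])
    then show "a * J \<eta> t = dF (\<theta>, y) (a *\<^sub>R \<eta>) + integral {s..t} (\<lambda>r. dDrift g \<theta> r (Z r) (fst (a *\<^sub>R \<eta>), a * J \<eta> r))"
      using t by (simp add: eq[OF t] linear_scale[OF linear_dF[OF \<theta>]] distrib_left)
  qed (intro continuous_intros c)
  from solves_linearized_unique[OF g \<theta> Z J this]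
  have scale: "J (a *\<^sub>R \<eta>) t = a * J \<eta> t" if "t \<in> {s..T}" for a \<eta> t using that .
  have "linear (\<lambda>\<eta>. J \<eta> t)" if "t \<in> {s..T}" for t
    by (rule linearI) (auto simp: add[OF that] scale[OF that])
  with J show thesis by (rule that)
qed

text \<open>Unlike in \<open>lipschitz_constant\<close> the path is bounded by \<open>M\<close>;
  this keeps the solutions in a compact interval, where the coefficients have uniform expansions.
  Density and starting time remain quantified inside.\<close>

definition expansion_radius :: "real \<Rightarrow> real \<Rightarrow> real \<Rightarrow> real \<Rightarrow> bool" where
  "expansion_radius \<epsilon> m M \<delta> \<longleftrightarrow> (\<forall>g \<theta> s x y v w Z Z' J t. bracket_density g \<longrightarrow> \<theta> \<in> \<Theta>0 \<longrightarrow> 0 \<le> s \<longrightarrow> \<bar>y\<bar> \<le> m \<longrightarrow>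
    norm x \<le> M \<longrightarrow> norm (v, w) \<le> \<delta> \<longrightarrow> solves g \<theta> s x y Z \<longrightarrow> solves g (\<theta> + v) s x (y + w) Z' \<longrightarrow>
    solves_linearized g \<theta> s y Z (v, w) J \<longrightarrow> t \<in> {s..T} \<longrightarrow>
    \<bar>G (\<theta> + v, Z' t) - G (\<theta>, Z t) - dG (\<theta>, Z t) (v, J t)\<bar> \<le> \<epsilon> * norm (v, w))"

text \<open>With \<open>R = Z' - Z - J\<close>, the drift is expanded along the true increment
  \<open>(v, Z' r - Z r)\<close>, which is of order \<open>norm (v, w)\<close> by the Lipschitz
  bound. This increment is \<open>(v, J r) + (0, R r)\<close>, so after subtracting the linearized
  drift only a small error and a term bounded by \<open>rate * \<bar>R r\<bar>\<close> remain for
  Gronwall. The expansion of the inverse transform finishes in the same way.\<close>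

lemma solves_expansion:
  assumes "0 < \<epsilon>" "0 \<le> m" "0 \<le> M"
  shows "\<exists>\<delta>>0. \<delta> \<le> \<rho> \<and> expansion_radius \<epsilon> m M \<delta>"
proof (cases "\<Theta>0 = {}")
  case False
  then obtain \<theta>0 where \<theta>0: "\<theta>0 \<in> A" using in_A(2) by auto
  obtain c where c: "0 \<le> c" and "lipschitz_constant m c"
    using solves_lipschitz[OF \<open>0 \<le> m\<close>] by auto
  note lip = this(2)[unfolded lipschitz_constant_def, rule_format]
  define M1 where "M1 = range_bound m + 2 * M"
  \<comment> \<open>With this \<open>k\<close>, the increment \<open>(v, Z' r - Z r)\<close> has
    norm at most \<open>k * norm (v, w)\<close>.\<close>
  define k where "k = 1 + c * (1 + M)"
  define E where "E = exp ((2 * rate + 1) * T)"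
  define k2 where "k2 = 2 * (1 + (1 + \<Lambda>) * k * T) * E"
  \<comment> \<open>The errors add up to \<open>\<epsilon>1 * k\<close> from expanding the inverse
    transform and \<open>\<epsilon>1 * high * k2\<close> from \<open>R\<close>; their sum is to be
    \<open>\<epsilon>\<close>.\<close>
  define \<epsilon>1 where "\<epsilon>1 = \<epsilon> / (k + high * k2)"
  have k: "1 \<le> k" using c \<open>0 \<le> M\<close> by (simp add: k_def)
  have k2: "0 \<le> k2" using k T_pos \<Lambda>_pos by (auto simp: k2_def E_def)
  have den: "0 < k + high * k2" using k k2 high_pos[OF \<theta>0] by (intro add_pos_nonneg) auto
  then have \<epsilon>1: "0 < \<epsilon>1" using \<open>0 < \<epsilon>\<close> by (simp add: \<epsilon>1_def)
  have cpt: "compact (\<Theta>0 \<times> {-r..r})" and sub: "\<Theta>0 \<times> {-r..r} \<subseteq> A \<times> UNIV" for r :: real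
    using in_A(2) by (auto intro: compact_Times compact_\<Theta>0)
  obtain d1 where d1: "0 < d1"
    and F: "\<forall>u\<in>\<Theta>0 \<times> {-m..m}. \<forall>h. norm h \<le> d1 \<longrightarrow> \<bar>F (u + h) - F u - dF u h\<bar> \<le> \<epsilon>1 * norm h"
    using C1_map_on_frechet_expansion[OF open_AU cpt sub \<epsilon>1 C1_lamperti, of m] by (elim exE conjE) (rule that)
  obtain d2 where d2: "0 < d2"
    and G: "\<forall>u\<in>\<Theta>0 \<times> {-M1..M1}. \<forall>h. norm h \<le> d2 \<longrightarrow> \<bar>G (u + h) - G u - dG u h\<bar> \<le> \<epsilon>1 * norm h"
    using C1_map_on_frechet_expansion[OF open_AU cpt sub \<epsilon>1 C1_lamperti_inv, of M1] by (elim exE conjE) (rule that)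
  obtain d3 where d3: "0 < d3"
    and B: "\<forall>u\<in>\<Theta>0 \<times> {-M1..M1}. \<forall>h. norm h \<le> d3 \<longrightarrow> \<bar>B (u + h) - B u - dB u h\<bar> \<le> \<epsilon>1 * norm h"
    using C1_map_on_frechet_expansion[OF open_AU cpt sub \<epsilon>1 C1_b_hat, of M1] by (elim exE conjE) (rule that)
  obtain d4 where d4: "0 < d4"
    and C: "\<forall>u\<in>\<Theta>0 \<times> {-M1..M1}. \<forall>h. norm h \<le> d4 \<longrightarrow> \<bar>C (u + h) - C u - dC u h\<bar> \<le> \<epsilon>1 * norm h"
    using C1_map_on_frechet_expansion[OF open_AU cpt sub \<epsilon>1 C1_c_hat, of M1] by (elim exE conjE) (rule that)
  \<comment> \<open>Division by \<open>k\<close> keeps the increments of the solutions, and not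
    merely \<open>(v, w)\<close>, within the four radii.\<close>
  define \<delta> where "\<delta> = min \<rho> (min (min d1 d2) (min d3 d4) / k)"
  have \<delta>: "0 < \<delta>" "\<delta> \<le> \<rho>" using d1 d2 d3 d4 k \<rho>_pos by (auto simp: \<delta>_def)
  have "\<bar>G (\<theta> + v, Z' t) - G (\<theta>, Z t) - dG (\<theta>, Z t) (v, J t)\<bar> \<le> \<epsilon> * norm (v, w)"
    if g: "bracket_density g" and \<theta>: "\<theta> \<in> \<Theta>0" and "0 \<le> s" "\<bar>y\<bar> \<le> m" and x: "norm x \<le> M" and \<eta>: "norm (v, w) \<le> \<delta>"
      and Z: "solves g \<theta> s x y Z" and Z': "solves g (\<theta> + v) s x (y + w) Z'"
      and J: "solves_linearized g \<theta> s y Z (v, w) J" and t: "t \<in> {s..T}"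
    for g \<theta> s x y v w Z Z' J t
  proof -
    define n where "n = norm (v, w)"
    have n: "0 \<le> n" "norm v \<le> n" "n \<le> \<rho>" using \<eta> \<delta>_def Pair_norm_bounds(1)[where v = v and w = w] by (auto simp: n_def)
    have v': "norm v \<le> \<rho>" using n by linarith
    note A = in_A(2)[OF \<theta>] in_A(1)[OF \<theta> v']
    have cZ: "continuous_on {s..T} Z" "continuous_on {s..T} Z'" and cJ: "continuous_on {s..T} J"
      using Z Z' J by (auto simp: solves_def solves_linearized_def)
    have "n \<le> min (min d1 d2) (min d3 d4) / k" using \<eta> by (simp add: n_def \<delta>_def)
    then have kn: "k * n \<le> min (min d1 d2) (min d3 d4)" using k by (simp add: pos_le_divide_eq mult.commute)
    have nk: "n \<le> k * n" using k n(1) by (simp add: mult_le_cancel_right1)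
    have D: "norm (v, Z' r - Z r) \<le> k * n" if r: "r \<in> {s..T}" for r
    proof -
      have "norm (v, Z' r - Z r) \<le> norm v + \<bar>Z' r - Z r\<bar>" by (rule Pair_norm_bounds(3))
      also have "\<dots> \<le> n + c * (1 + norm x) * n"
        using lip[OF g \<theta> \<open>0 \<le> s\<close> \<open>\<bar>y\<bar> \<le> m\<close> _ Z Z' r] n unfolding n_def by (intro add_mono) auto
      also have "\<dots> \<le> n + c * (1 + M) * n"
        using x c n(1) by (intro add_left_mono mult_right_mono mult_left_mono) auto
      also have "\<dots> = k * n" by (simp add: k_def algebra_simps)
      finally show ?thesis .
    qed
    have inZ: "(\<theta>, Z r) \<in> \<Theta>0 \<times> {-M1..M1}" if r: "r \<in> {s..T}" for r
      using solves_bound[OF g A(1) \<open>0 \<le> s\<close> Z r] range_bound_mono[OF \<open>\<bar>y\<bar> \<le> m\<close>] x \<theta> by (auto simp: M1_def abs_le_iff)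
    define R where "R r = Z' r - Z r - J r" for r
    let ?a = "F (\<theta> + v, y + w) - F (\<theta>, y) - dF (\<theta>, y) (v, w)"
    let ?h = "\<lambda>r. drift g (\<theta> + v) r (Z' r) - drift g \<theta> r (Z r) - dDrift g \<theta> r (Z r) (v, J r)"
    have a: "\<bar>?a\<bar> \<le> \<epsilon>1 * n"
      using F[rule_format, of "(\<theta>, y)" "(v, w)"] \<theta> \<open>\<bar>y\<bar> \<le> m\<close> kn nk by (auto simp: n_def abs_le_iff)
    have h: "\<bar>?h r\<bar> \<le> (1 + \<Lambda>) * (\<epsilon>1 * (k * n)) + rate * \<bar>R r\<bar>" if r: "r \<in> {s..T}" for r
    proof -
      let ?u = "(\<theta>, Z r)" and ?k = "(v, Z' r - Z r)"
      have "\<bar>B (?u + ?k) - B ?u - dB ?u ?k\<bar> \<le> \<epsilon>1 * (k * n)" "\<bar>C (?u + ?k) - C ?u - dC ?u ?k\<bar> \<le> \<epsilon>1 * (k * n)"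
        using B[rule_format, OF inZ[OF r], of ?k] C[rule_format, OF inZ[OF r], of ?k] D[OF r] kn \<epsilon>1
        by (auto intro: order_trans mult_left_mono)
      from density_combination_bound[OF g this, of r]
      have 1: "\<bar>drift g (\<theta> + v) r (Z' r) - drift g \<theta> r (Z r) - dDrift g \<theta> r (Z r) ?k\<bar> \<le> (1 + \<Lambda>) * (\<epsilon>1 * (k * n))"
        by (simp add: drift_def dDrift_def algebra_simps)
      have "?k = (v, J r) + (0, R r)" by (simp add: R_def)
      then have "dDrift g \<theta> r (Z r) ?k = dDrift g \<theta> r (Z r) (v, J r) + dDrift g \<theta> r (Z r) (0, R r)"
        by (metis dDrift_add[OF A(1)])
      with 1 dDrift_partial[OF g A(1), of r "Z r" "R r"] show ?thesis by linarith
    qed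
    have "\<bar>R t\<bar> \<le> 2 * (\<epsilon>1 * n + (1 + \<Lambda>) * (\<epsilon>1 * (k * n)) * (T - s)) * exp ((2 * rate + 1) * (T - s))"
    proof (rule gronwall[where u = R and h = ?h])
      show "continuous_on {s..T} R" unfolding R_def by (intro continuous_intros cZ cJ)
      show "?h integrable_on {s..T}" by (intro integrable_diff drift_integrable dDrift_integrable g A cZ cJ)
      fix t assume t: "t \<in> {s..T}"
      then have "{s..t} \<subseteq> {s..T}" by auto
      note c' = continuous_on_subset[OF cZ(1) this] continuous_on_subset[OF cZ(2) this] continuous_on_subset[OF cJ this]
      have "integral {s..t} ?h = integral {s..t} (\<lambda>r. drift g (\<theta> + v) r (Z' r)) - integral {s..t} (\<lambda>r. drift g \<theta> r (Z r))
          - integral {s..t} (\<lambda>r. dDrift g \<theta> r (Z r) (v, J r))"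
        by (simp add: integral_diff integrable_diff drift_integrable dDrift_integrable g A c')
      then have "R t = ?a + integral {s..t} ?h"
        using Z Z' J t by (simp add: R_def solves_def solves_linearized_def)
      then show "\<bar>R t\<bar> \<le> \<epsilon>1 * n + \<bar>integral {s..t} ?h\<bar>" using a by linarith
    qed (use h n(1) \<epsilon>1 k \<Lambda>_pos t rate_nonneg[OF \<theta>0] in auto)
    also have "\<dots> \<le> 2 * (\<epsilon>1 * n + (1 + \<Lambda>) * (\<epsilon>1 * (k * n)) * T) * E"
      unfolding E_def using n(1) \<epsilon>1 k \<Lambda>_pos \<open>0 \<le> s\<close> t rate_nonneg[OF \<theta>0] T_pos
      by (intro mult_mono) (auto intro!: add_left_mono mult_left_mono)
    also have "\<dots> = \<epsilon>1 * n * k2" by (simp add: k2_def algebra_simps)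
    finally have R: "\<bar>R t\<bar> \<le> \<epsilon>1 * n * k2" .
    let ?u = "(\<theta>, Z t)" and ?k = "(v, Z' t - Z t)"
    have "\<bar>G (?u + ?k) - G ?u - dG ?u ?k\<bar> \<le> \<epsilon>1 * (k * n)"
      using G[rule_format, OF inZ[OF t], of ?k] D[OF t] kn \<epsilon>1 by (auto intro: order_trans mult_left_mono)
    moreover have "?k = (v, J t) + (0, R t)" by (simp add: R_def)
    then have "dG ?u ?k = dG ?u (v, J t) + dG ?u (0, R t)" by (metis linear_add[OF linear_dG[OF A(1)]])
    moreover have "\<bar>dG ?u (0, R t)\<bar> \<le> high * (\<epsilon>1 * n * k2)"
      using R high_pos[OF \<theta>0] by (intro order_trans[OF dG_partial[OF A(1)]] mult_left_mono) auto
    ultimately have "\<bar>G (\<theta> + v, Z' t) - G ?u - dG ?u (v, J t)\<bar> \<le> \<epsilon>1 * (k * n) + high * (\<epsilon>1 * n * k2)"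
      by (simp only: add_Pair add_diff_cancel_left' add_diff_eq)
    also have "\<dots> = \<epsilon>1 * (k + high * k2) * n" by (simp add: algebra_simps)
    also have "\<dots> = \<epsilon> * n" using den by (simp add: \<epsilon>1_def)
    finally show ?thesis by (simp add: n_def)
  qed
  then have "expansion_radius \<epsilon> m M \<delta>" unfolding expansion_radius_def by blast
  with \<delta> show ?thesis by blast
next
  case True
  then have "expansion_radius \<epsilon> m M \<rho>" unfolding expansion_radius_def by blast
  then show ?thesis using \<rho>_pos by blast
qed

text \<open>The Frechet derivative and \<^const>\<open>deriv\<close> in \<^const>\<open>tangent\<close> are identified with the linearized
  solution, which also shows that they are not junk values.\<close>

lemma flow_tangent:
  assumes \<theta>: "\<theta> \<in> \<Theta>0" and st: "0 \<le> s" "s \<le> t" "t \<le> T"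
  obtains g J where "bracket_density g"
    "\<And>\<theta> y. \<theta> \<in> A \<Longrightarrow> solves g \<theta> s x y (flow_solution T (b \<theta>) (\<sigma> \<theta>) s x (bracket_functional T \<Lambda> x) y)"
    "\<And>\<eta>. solves_linearized g \<theta> s y (flow_solution T (b \<theta>) (\<sigma> \<theta>) s x (bracket_functional T \<Lambda> x) y) \<eta> (J \<eta>)"
    "linear (tangent T \<Lambda> b \<sigma> \<theta> y s t x)"
    "\<And>\<eta>. tangent T \<Lambda> b \<sigma> \<theta> y s t x \<eta> = dG (\<theta>, flow_solution T (b \<theta>) (\<sigma> \<theta>) s x (bracket_functional T \<Lambda> x) y t) (fst \<eta>, J \<eta> t)"
proof -
  let ?Q = "bracket_functional T \<Lambda> x"
  have "0 \<le> ?Q t - ?Q s \<and> ?Q t - ?Q s \<le> \<Lambda> * (t - s)" if "0 \<le> s" "s \<le> t" "t \<le> T" for s t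
    using that T_pos \<Lambda>_pos by (intro bracket_functional_lipschitz) auto
  then obtain g where g: "bracket_density g"
    and sol: "\<And>\<theta> s x y. \<theta> \<in> A \<Longrightarrow> 0 \<le> s \<Longrightarrow> s \<le> T \<Longrightarrow> solves g \<theta> s x y (flow_solution T (b \<theta>) (\<sigma> \<theta>) s x ?Q y)"
    using flow_solution_solves[of ?Q] by metis
  define Z where "Z \<theta> y = flow_solution T (b \<theta>) (\<sigma> \<theta>) s x ?Q y" for \<theta> y
  have sT: "s \<le> T" and t: "t \<in> {s..T}" using st by auto
  have Z: "solves g \<theta> s x y (Z \<theta> y)" if "\<theta> \<in> A" for \<theta> y
    unfolding Z_def using sol[OF that st(1) sT] .
  note A = in_A(2)[OF \<theta>]
  have cZ: "continuous_on {s..T} (Z \<theta> y)" using Z[OF A, of y] by (simp add: solves_def)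
  obtain J where J: "\<And>\<eta>. solves_linearized g \<theta> s y (Z \<theta> y) \<eta> (J \<eta>)"
    and lin: "\<And>t. t \<in> {s..T} \<Longrightarrow> linear (\<lambda>\<eta>. J \<eta> t)"
    by (rule linearized_flow[OF g A sT cZ]) (rule that)
  define \<L> where "\<L> \<eta> = dG (\<theta>, Z \<theta> y t) (fst \<eta>, J \<eta> t)" for \<eta>
  have lin\<L>: "linear \<L>"
  proof (rule linearI)
    fix \<eta> \<xi> :: "'a \<times> real" and c :: real
    show "\<L> (\<eta> + \<xi>) = \<L> \<eta> + \<L> \<xi>"
      by (simp add: \<L>_def linear_add[OF lin[OF t]] flip: linear_add[OF linear_dG[OF A]])
    have "(fst (c *\<^sub>R \<eta>), J (c *\<^sub>R \<eta>) t) = c *\<^sub>R (fst \<eta>, J \<eta> t)"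
      by (simp add: linear_scale[OF lin[OF t]])
    then show "\<L> (c *\<^sub>R \<eta>) = c *\<^sub>R \<L> \<eta>"
      by (simp only: \<L>_def linear_scale[OF linear_dG[OF A]])
  qed
  define S where "S \<eta> = G (\<theta> + fst \<eta>, Z (\<theta> + fst \<eta>) (y + snd \<eta>) t)" for \<eta>
  \<comment> \<open>One joint expansion serves both partial derivatives: restricted to directions
    \<open>(v, 0)\<close> it gives the Frechet derivative in the parameter, restricted to
    \<open>(0, w)\<close> the derivative in the starting point.\<close>
  have expand: "\<exists>\<delta>>0. \<forall>\<eta>. norm \<eta> \<le> \<delta> \<longrightarrow> \<bar>S \<eta> - S 0 - \<L> \<eta>\<bar> \<le> \<epsilon> * norm \<eta>" if eps: "0 < \<epsilon>" for \<epsilon>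
  proof -
    obtain \<delta> where \<delta>: "0 < \<delta>" "\<delta> \<le> \<rho>" and "expansion_radius \<epsilon> \<bar>y\<bar> (norm x) \<delta>"
      using solves_expansion[OF eps abs_ge_zero[of y] norm_ge_zero[of x]] by auto
    note * = this(3)[unfolded expansion_radius_def, rule_format]
    have "\<bar>S \<eta> - S 0 - \<L> \<eta>\<bar> \<le> \<epsilon> * norm \<eta>" if "norm \<eta> \<le> \<delta>" for \<eta>
    proof (cases \<eta>)
      case (Pair v w)
      then have n: "norm (v, w) \<le> \<delta>" using that by simp
      then have "norm v \<le> \<rho>" using Pair_norm_bounds(1)[where v = v and w = w] \<delta> by linarith
      from *[OF g \<theta> st(1) _ _ n Z[OF A] Z[OF in_A(1)[OF \<theta> this]] J t]
      show ?thesis by (simp add: S_def \<L>_def Pair)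
    qed
    with \<delta>(1) show ?thesis by blast
  qed
  have S_raw: "S (v, w) = raw_flow T \<Lambda> (b (\<theta> + v)) (\<sigma> (\<theta> + v)) s t x (y + w)" for v w
    by (simp add: S_def raw_flow_def flow_def Z_def)
  have "((\<lambda>\<theta>'. flow T (b \<theta>') (\<sigma> \<theta>') s t x ?Q y) has_derivative (\<lambda>v. \<L> (v, 0))) (at \<theta>)"
    unfolding has_derivative_at_alt
  proof (intro conjI allI impI)
    have "linear (\<lambda>v::'a. (v, 0::real))" by (intro linearI) auto
    from linear_compose[OF this lin\<L>] show "bounded_linear (\<lambda>v. \<L> (v, 0))"
      by (simp add: o_def linear_conv_bounded_linear)
    fix \<epsilon> :: real assume "0 < \<epsilon>"
    then obtain \<delta> where \<delta>: "0 < \<delta>" "\<And>\<eta>. norm \<eta> \<le> \<delta> \<Longrightarrow> \<bar>S \<eta> - S 0 - \<L> \<eta>\<bar> \<le> \<epsilon> * norm \<eta>"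
      using expand by blast
    have "norm (flow T (b \<theta>') (\<sigma> \<theta>') s t x ?Q y - flow T (b \<theta>) (\<sigma> \<theta>) s t x ?Q y - \<L> (\<theta>' - \<theta>, 0)) \<le> \<epsilon> * norm (\<theta>' - \<theta>)"
      if "norm (\<theta>' - \<theta>) < \<delta>" for \<theta>'
      using \<delta>(2)[of "(\<theta>' - \<theta>, 0)"] that S_raw[of "\<theta>' - \<theta>" 0] S_raw[of 0 0]
      by (simp add: raw_flow_def norm_Pair zero_prod_def)
    with \<delta>(1) show "\<exists>d>0. \<forall>\<theta>'. norm (\<theta>' - \<theta>) < d \<longrightarrow>
        norm (flow T (b \<theta>') (\<sigma> \<theta>') s t x ?Q y - flow T (b \<theta>) (\<sigma> \<theta>) s t x ?Q y - \<L> (\<theta>' - \<theta>, 0)) \<le> \<epsilon> * norm (\<theta>' - \<theta>)"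
      by blast
  qed
  from frechet_derivative_at[OF this]
  have 1: "frechet_derivative (\<lambda>\<theta>'. flow T (b \<theta>') (\<sigma> \<theta>') s t x ?Q y) (at \<theta>) v = \<L> (v, 0)" for v
    by (simp add: fun_eq_iff)
  have scale: "\<L> (0, w) = w * \<L> (0, 1)" for w using linear_scale[OF lin\<L>, of w "(0, 1)"] by simp
  have "((\<lambda>z. raw_flow T \<Lambda> (b \<theta>) (\<sigma> \<theta>) s t x z) has_derivative (\<lambda>w. \<L> (0, 1) * w)) (at y)"
    unfolding has_derivative_at_alt
  proof (intro conjI allI impI bounded_linear_mult_right)
    fix \<epsilon> :: real assume "0 < \<epsilon>"
    then obtain \<delta> where \<delta>: "0 < \<delta>" "\<And>\<eta>. norm \<eta> \<le> \<delta> \<Longrightarrow> \<bar>S \<eta> - S 0 - \<L> \<eta>\<bar> \<le> \<epsilon> * norm \<eta>"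
      using expand by blast
    have "norm (raw_flow T \<Lambda> (b \<theta>) (\<sigma> \<theta>) s t x z - raw_flow T \<Lambda> (b \<theta>) (\<sigma> \<theta>) s t x y - \<L> (0, 1) * (z - y)) \<le> \<epsilon> * norm (z - y)"
      if "norm (z - y) < \<delta>" for z
      using \<delta>(2)[of "(0, z - y)"] that S_raw[of 0 "z - y"] S_raw[of 0 0] scale[of "z - y"]
      by (simp add: norm_Pair zero_prod_def mult.commute)
    with \<delta>(1) show "\<exists>d>0. \<forall>z. norm (z - y) < d \<longrightarrow>
        norm (raw_flow T \<Lambda> (b \<theta>) (\<sigma> \<theta>) s t x z - raw_flow T \<Lambda> (b \<theta>) (\<sigma> \<theta>) s t x y - \<L> (0, 1) * (z - y)) \<le> \<epsilon> * norm (z - y)"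
      by blast
  qed
  then have "(raw_flow T \<Lambda> (b \<theta>) (\<sigma> \<theta>) s t x has_real_derivative \<L> (0, 1)) (at y)"
    by (simp add: has_field_derivative_def)
  from DERIV_imp_deriv[OF this] have 2: "deriv (\<lambda>z. raw_flow T \<Lambda> (b \<theta>) (\<sigma> \<theta>) s t x z) y = \<L> (0, 1)" .
  have tan: "tangent T \<Lambda> b \<sigma> \<theta> y s t x \<eta> = \<L> \<eta>" for \<eta>
  proof -
    have "\<L> \<eta> = \<L> (fst \<eta>, 0) + \<L> (0, snd \<eta>)" by (simp flip: linear_add[OF lin\<L>])
    then show ?thesis by (simp add: tangent_def 1 2 scale[of "snd \<eta>"])
  qed
  then have "tangent T \<Lambda> b \<sigma> \<theta> y s t x = \<L>" by (simp add: fun_eq_iff)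
  with lin\<L> have "linear (tangent T \<Lambda> b \<sigma> \<theta> y s t x)" by simp
  from that[OF g Z[unfolded Z_def] J[unfolded Z_def] this tan[unfolded \<L>_def Z_def]] show thesis .
qed

section \<open>Smallness and linear growth of the remainder\<close>

lemma remainder_small:
  assumes "0 < \<epsilon>" "0 \<le> m" "0 \<le> M"
  obtains \<delta> where "0 < \<delta>"
    "\<And>\<theta> s t x y \<eta>. \<theta> \<in> \<Theta>0 \<Longrightarrow> 0 \<le> s \<Longrightarrow> s \<le> t \<Longrightarrow> t \<le> T \<Longrightarrow> \<bar>y\<bar> \<le> m \<Longrightarrow> norm x \<le> M \<Longrightarrow> norm \<eta> \<le> \<delta> \<Longrightarrow>
      \<bar>remainder T \<Lambda> b \<sigma> \<theta> y s t x \<eta>\<bar> \<le> \<epsilon> * norm \<eta>"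
proof -
  obtain \<delta> where \<delta>: "0 < \<delta>" "\<delta> \<le> \<rho>" and "expansion_radius \<epsilon> m M \<delta>"
    using solves_expansion[OF assms] by auto
  note * = this(3)[unfolded expansion_radius_def, rule_format]
  show thesis
  proof (rule that[OF \<delta>(1)])
    fix \<theta> s t x y \<eta>
    assume \<theta>: "\<theta> \<in> \<Theta>0" and st: "0 \<le> s" "s \<le> t" "t \<le> T" and y: "\<bar>y\<bar> \<le> m" and x: "norm (x :: path) \<le> M"
      and \<eta>: "norm (\<eta> :: 'a \<times> real) \<le> \<delta>"
    obtain v w where vw: "\<eta> = (v, w)" by (cases \<eta>)
    let ?Z = "\<lambda>\<theta> y. flow_solution T (b \<theta>) (\<sigma> \<theta>) s x (bracket_functional T \<Lambda> x) y"
    obtain g J where g: "bracket_density g" and Z: "\<And>\<theta> y. \<theta> \<in> A \<Longrightarrow> solves g \<theta> s x y (?Z \<theta> y)"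
      and J: "\<And>\<eta>. solves_linearized g \<theta> s y (?Z \<theta> y) \<eta> (J \<eta>)"
      and tan: "\<And>\<eta>. tangent T \<Lambda> b \<sigma> \<theta> y s t x \<eta> = dG (\<theta>, ?Z \<theta> y t) (fst \<eta>, J \<eta> t)"
      by (rule flow_tangent[OF \<theta> st]) (rule that)
    have n: "norm (v, w) \<le> \<delta>" using \<eta> vw by simp
    then have v: "norm v \<le> \<rho>" using Pair_norm_bounds(1)[where v = v and w = w] \<delta> by linarith
    have t: "t \<in> {s..T}" using st by auto
    from *[OF g \<theta> st(1) y x n Z[OF in_A(2)[OF \<theta>]] Z[OF in_A(1)[OF \<theta> v]] J t]
    show "\<bar>remainder T \<Lambda> b \<sigma> \<theta> y s t x \<eta>\<bar> \<le> \<epsilon> * norm \<eta>"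
      by (simp add: remainder_def tan raw_flow_def flow_def vw)
  qed
qed

text \<open>The inverse transform changes in parameter and in argument. The intermediate value takes
  the new parameter at the old solution, so that the growing parameter increment is evaluated at a
  state controlled by \<open>solves_bound\<close>.\<close>

lemma raw_flow_lipschitz:
  assumes "0 \<le> m"
  obtains c where "0 \<le> c"
    "\<And>\<theta> s t x y v w. \<theta> \<in> \<Theta>0 \<Longrightarrow> 0 \<le> s \<Longrightarrow> s \<le> t \<Longrightarrow> t \<le> T \<Longrightarrow> \<bar>y\<bar> \<le> m \<Longrightarrow> norm (v, w) \<le> \<rho> \<Longrightarrow>
      \<bar>raw_flow T \<Lambda> (b (\<theta> + v)) (\<sigma> (\<theta> + v)) s t x (y + w) - raw_flow T \<Lambda> (b \<theta>) (\<sigma> \<theta>) s t x y\<bar>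
        \<le> c * (1 + norm x) * norm (v, w)"
proof -
  obtain c where c: "0 \<le> c" and "lipschitz_constant m c"
    using solves_lipschitz[OF assms] by auto
  note lip = this(2)[unfolded lipschitz_constant_def, rule_format]
  define k where "k = high\<^sup>2 / low\<^sup>2 * \<kappa>"
  have k: "0 \<le> k" using \<kappa>_nonneg by (simp add: k_def)
  \<comment> \<open>The absolute values secure \<open>0 \<le> c'\<close> before any parameter is at
    hand to fix the signs of \<open>high\<close> and \<open>range_bound m\<close>.\<close>
  define c' where "c' = \<bar>high\<bar> * c + k * (\<bar>range_bound m\<bar> + 2)"
  show thesis
  proof (rule that)
    show "0 \<le> c'" using c k by (simp add: c'_def)
    fix \<theta> s t x y v w
    assume \<theta>: "\<theta> \<in> \<Theta>0" and st: "0 \<le> s" "s \<le> t" "t \<le> T" and y: "\<bar>y\<bar> \<le> m" and \<eta>: "norm (v :: 'a, w :: real) \<le> \<rho>"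
    let ?Z = "\<lambda>\<theta> y. flow_solution T (b \<theta>) (\<sigma> \<theta>) s x (bracket_functional T \<Lambda> x) y"
    obtain g where g: "bracket_density g" and Z: "\<And>\<theta> y. \<theta> \<in> A \<Longrightarrow> solves g \<theta> s x y (?Z \<theta> y)"
      by (rule flow_tangent[OF \<theta> st]) (rule that)
    have v: "norm v \<le> \<rho>" using Pair_norm_bounds(1)[where v = v and w = w] \<eta> by linarith
    have t: "t \<in> {s..T}" using st by auto
    note A = in_A(2)[OF \<theta>] in_A(1)[OF \<theta> v]
    let ?z = "?Z \<theta> y t" and ?z' = "?Z (\<theta> + v) (y + w) t" and ?n = "norm (v, w)"
    have "\<bar>G (\<theta> + v, ?z') - G (\<theta> + v, ?z)\<bar> \<le> high * \<bar>?z' - ?z\<bar>"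
      using elliptic.lamperti_inv_lipschitz[OF elliptic_\<sigma>[OF A(2)]] by simp
    also have "\<dots> \<le> high * (c * (1 + norm x) * ?n)"
      using lip[OF g \<theta> st(1) y \<eta> Z[OF A(1)] Z[OF A(2)] t] high_pos[OF A(1)] by (intro mult_left_mono) auto
    finally have 1: "\<bar>G (\<theta> + v, ?z') - G (\<theta> + v, ?z)\<bar> \<le> \<bar>high\<bar> * c * (1 + norm x) * ?n"
      using high_pos[OF A(1)] by (simp add: mult.assoc)
    have "\<bar>?z\<bar> \<le> \<bar>range_bound m\<bar> + 2 * norm x"
      using solves_bound[OF g A(1) st(1) Z[OF A(1), of y] t] range_bound_mono[OF y] by linarith
    also have "\<dots> \<le> (\<bar>range_bound m\<bar> + 2) * (1 + norm x)" by (simp add: algebra_simps)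
    finally have "k * \<bar>?z\<bar> * norm v \<le> k * ((\<bar>range_bound m\<bar> + 2) * (1 + norm x)) * ?n"
      using k Pair_norm_bounds(1)[where v = v and w = w] by (intro mult_mono mult_left_mono) auto
    with param_diff(4)[OF \<theta> v, of ?z]
    have "\<bar>G (\<theta> + v, ?z) - G (\<theta>, ?z)\<bar> \<le> k * (\<bar>range_bound m\<bar> + 2) * (1 + norm x) * ?n"
      by (simp add: k_def mult.assoc)
    with 1 have "\<bar>G (\<theta> + v, ?z') - G (\<theta>, ?z)\<bar> \<le> \<bar>high\<bar> * c * (1 + norm x) * ?n + k * (\<bar>range_bound m\<bar> + 2) * (1 + norm x) * ?n"
      by linarith
    also have "\<dots> = c' * (1 + norm x) * ?n" by (simp add: c'_def algebra_simps)
    finally show "\<bar>raw_flow T \<Lambda> (b (\<theta> + v)) (\<sigma> (\<theta> + v)) s t x (y + w) - raw_flow T \<Lambda> (b \<theta>) (\<sigma> \<theta>) s t x y\<bar>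
        \<le> c' * (1 + norm x) * ?n"
      by (simp add: raw_flow_def flow_def)
  qed
qed

text \<open>The flow increment grows at most linearly in the path, so only the tangent has to be
  bounded. Near 0 the tangent is the flow increment minus a remainder of size at most
  \<open>norm \<xi>\<close>, and linearity extends the bound from there to all directions.\<close>

lemma remainder_growth:
  assumes m: "0 \<le> m"
  obtains c where "0 \<le> c"
    "\<And>\<theta> s t x y \<eta>. \<theta> \<in> \<Theta>0 \<Longrightarrow> 0 \<le> s \<Longrightarrow> s \<le> t \<Longrightarrow> t \<le> T \<Longrightarrow> \<bar>y\<bar> \<le> m \<Longrightarrow> norm \<eta> \<le> \<rho> \<Longrightarrow>
      \<bar>remainder T \<Lambda> b \<sigma> \<theta> y s t x \<eta>\<bar> \<le> c * (1 + norm x) * norm \<eta>"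
proof -
  obtain c where c: "0 \<le> c" and lip: "\<And>\<theta> s t x y v w. \<theta> \<in> \<Theta>0 \<Longrightarrow> 0 \<le> s \<Longrightarrow> s \<le> t \<Longrightarrow> t \<le> T \<Longrightarrow> \<bar>y\<bar> \<le> m \<Longrightarrow> norm (v, w) \<le> \<rho> \<Longrightarrow>
      \<bar>raw_flow T \<Lambda> (b (\<theta> + v)) (\<sigma> (\<theta> + v)) s t x (y + w) - raw_flow T \<Lambda> (b \<theta>) (\<sigma> \<theta>) s t x y\<bar>
        \<le> c * (1 + norm x) * norm (v, w)"
    by (rule raw_flow_lipschitz[OF m]) (rule that)
  show thesis
  proof (rule that)
    show "0 \<le> 2 * c + 1" using c by simp
    fix \<theta> s t x y \<eta>
    assume \<theta>: "\<theta> \<in> \<Theta>0" and st: "0 \<le> s" "s \<le> t" "t \<le> T" and y: "\<bar>y\<bar> \<le> m" and \<eta>: "norm (\<eta> :: 'a \<times> real) \<le> \<rho>"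
    let ?tan = "tangent T \<Lambda> b \<sigma> \<theta> y s t x" and ?rem = "remainder T \<Lambda> b \<sigma> \<theta> y s t x"
    have lin: "linear ?tan" by (rule flow_tangent[OF \<theta> st])
    have flow: "\<bar>?rem \<xi> + ?tan \<xi>\<bar> \<le> c * (1 + norm x) * norm \<xi>" if "norm \<xi> \<le> \<rho>" for \<xi>
      using lip[OF \<theta> st y, of "fst \<xi>" "snd \<xi>" x] that by (simp add: remainder_def)
    obtain \<delta> where \<delta>: "0 < \<delta>" and small: "\<And>\<xi>. norm \<xi> \<le> \<delta> \<Longrightarrow> \<bar>?rem \<xi>\<bar> \<le> 1 * norm \<xi>"
      by (rule remainder_small[OF zero_less_one m norm_ge_zero[of x]]) (use \<theta> st y in blast)
    \<comment> \<open>Scaling moves \<open>\<eta>\<close> into the ball of radius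
      \<open>\<delta>\<close>. That radius depends on \<open>x\<close>, but \<open>\<tau>\<close>
      cancels by linearity, so the resulting constant does not.\<close>
    define \<tau> where "\<tau> = min 1 (\<delta> / \<rho>)"
    have \<tau>: "0 < \<tau>" "\<tau> \<le> 1" using \<delta> \<rho>_pos by (auto simp: \<tau>_def)
    have "\<tau> * norm \<eta> \<le> \<delta> / \<rho> * \<rho>" using \<eta> \<delta> \<rho>_pos by (intro mult_mono) (auto simp: \<tau>_def)
    then have 1: "norm (\<tau> *\<^sub>R \<eta>) \<le> \<delta>" using \<rho>_pos \<tau> by simp
    have "\<tau> * norm \<eta> \<le> 1 * norm \<eta>" using \<tau> by (intro mult_right_mono) auto
    then have 2: "norm (\<tau> *\<^sub>R \<eta>) \<le> \<rho>" using \<tau> \<eta> by simp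
    have "\<bar>?tan (\<tau> *\<^sub>R \<eta>)\<bar> \<le> (1 + c * (1 + norm x)) * norm (\<tau> *\<^sub>R \<eta>)"
      using flow[OF 2] small[OF 1] by (simp add: distrib_right)
    then have "\<tau> * \<bar>?tan \<eta>\<bar> \<le> \<tau> * ((1 + c * (1 + norm x)) * norm \<eta>)"
      using \<tau> by (simp add: linear_scale[OF lin] abs_mult mult.left_commute)
    then have "\<bar>?tan \<eta>\<bar> \<le> (1 + c * (1 + norm x)) * norm \<eta>" using \<tau> by simp
    with flow[OF \<eta>] have "\<bar>?rem \<eta>\<bar> \<le> (1 + c * (1 + norm x)) * norm \<eta> + c * (1 + norm x) * norm \<eta>" by linarith
    also have "\<dots> \<le> (2 * c + 1) * (1 + norm x) * norm \<eta>"
      by (simp add: algebra_simps)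
    finally show "\<bar>?rem \<eta>\<bar> \<le> (2 * c + 1) * (1 + norm x) * norm \<eta>" .
  qed
qed

end

section \<open>Exponential moments of martingales with bounded bracket\<close>

text \<open>The second-moment content of a square-integrable martingale on a grid. In
  \<open>orthogonal\<close> the squared displacement from time \<open>i\<close> is a submartingale,
  stopped at \<open>j\<close> and at the end; \<open>variance\<close> is the conditional variance
  bound, integrated over an event.\<close>

locale discrete_increments = prob_space M for M :: "'a measure" +
  fixes Fs :: "nat \<Rightarrow> 'a measure" and Y :: "nat \<Rightarrow> 'a \<Rightarrow> real" and n :: nat and V a :: real
  assumes a_pos: "0 < a" and V_nonneg: "0 \<le> V"
    and sub: "i \<le> n \<Longrightarrow> subalgebra M (Fs i)"
    and filtration: "i \<le> j \<Longrightarrow> j \<le> n \<Longrightarrow> sets (Fs i) \<subseteq> sets (Fs j)"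
    and adapted: "i \<le> n \<Longrightarrow> Y i \<in> borel_measurable (Fs i)"
    and integrable_sq: "i \<le> n \<Longrightarrow> j \<le> n \<Longrightarrow> integrable M (\<lambda>x. (Y j x - Y i x)\<^sup>2)"
    and orthogonal: "i \<le> j \<Longrightarrow> j \<le> n \<Longrightarrow> D \<in> sets (Fs j) \<Longrightarrow>
      (\<integral>x. indicator D x * (Y j x - Y i x)\<^sup>2 \<partial>M) \<le> (\<integral>x. indicator D x * (Y n x - Y i x)\<^sup>2 \<partial>M)"
    and variance: "i \<le> n \<Longrightarrow> D \<in> sets (Fs i) \<Longrightarrow>
      (\<integral>x. indicator D x * (Y n x - Y i x)\<^sup>2 \<partial>M) \<le> V * prob D"
begin

text \<open>\<open>hit D i l\<close>: on \<open>D\<close>, the first displacement by \<open>a\<close> after time \<open>i\<close> happens at time \<open>l\<close>.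
  Below, \<open>moves k l\<close> is the event that the \<open>k\<close>-th of these successive displacements happens at \<open>l\<close>.\<close>

definition hit :: "'a set \<Rightarrow> nat \<Rightarrow> nat \<Rightarrow> 'a set" where
  "hit D i l = {x \<in> D. i < l \<and> a \<le> \<bar>Y l x - Y i x\<bar> \<and> (\<forall>m\<in>{i<..<l}. \<bar>Y m x - Y i x\<bar> < a)}"

lemma sets_Fs: "i \<le> n \<Longrightarrow> D \<in> sets (Fs i) \<Longrightarrow> D \<in> sets M"
  using sub by (auto simp: subalgebra_def)

lemma adapted': "i \<le> j \<Longrightarrow> j \<le> n \<Longrightarrow> Y i \<in> borel_measurable (Fs j)"
proof (rule measurable_from_subalg[OF _ adapted])
  show "i \<le> j \<Longrightarrow> j \<le> n \<Longrightarrow> subalgebra (Fs j) (Fs i)"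
    using sub[of i] sub[of j] filtration[of i j] by (auto simp: subalgebra_def)
qed auto

lemma hit_sets:
  assumes "i \<le> n" "l \<le> n" "D \<in> sets (Fs i)"
  shows "hit D i l \<in> sets (Fs l)"
proof (cases "i < l")
  case True
  have D: "D \<in> sets (Fs l)" using filtration[of i l] assms True by auto
  have Y [measurable]: "Y m \<in> borel_measurable (Fs l)" if "m \<le> l" for m using adapted' that assms by blast
  have "{x \<in> space (Fs l). a \<le> \<bar>Y l x - Y i x\<bar> \<and> (\<forall>m\<in>{i<..<l}. \<bar>Y m x - Y i x\<bar> < a)} \<in> sets (Fs l)"
  proof (intro sets.sets_Collect_conj sets.sets_Collect_finite_All)
    show "{x \<in> space (Fs l). a \<le> \<bar>Y l x - Y i x\<bar>} \<in> sets (Fs l)"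
      using Y[OF order_refl] Y[OF less_imp_le[OF True]] by measurable
    show "{x \<in> space (Fs l). \<bar>Y m x - Y i x\<bar> < a} \<in> sets (Fs l)" if "m \<in> {i<..<l}" for m
    proof -
      have "m \<le> l" using that by simp
      from Y[OF this] Y[OF less_imp_le[OF True]] show ?thesis by measurable
    qed
  qed (use True in auto)
  moreover have "hit D i l = D \<inter> {x \<in> space (Fs l). a \<le> \<bar>Y l x - Y i x\<bar> \<and> (\<forall>m\<in>{i<..<l}. \<bar>Y m x - Y i x\<bar> < a)}"
    using True sets.sets_into_space[OF D] by (auto simp: hit_def)
  ultimately show ?thesis using D by simp
qed (simp add: hit_def)

lemma hit_disjoint: "disjoint_family (hit D i)"
  unfolding disjoint_family_on_def
proof (intro ballI impI)
  fix l m :: nat assume "l \<noteq> m"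
  then show "hit D i l \<inter> hit D i m = {}"
    by (cases l m rule: linorder_cases) (force simp: hit_def)+
qed

text \<open>Kolmogorov's maximal inequality, conditionally on the event \<open>D\<close> of the \<open>\<sigma>\<close>-algebra at time \<open>i\<close>.\<close>

lemma hit_prob:
  assumes i: "i \<le> n" and D: "D \<in> sets (Fs i)"
  shows "(\<Sum>l\<le>n. prob (hit D i l)) \<le> V / a\<^sup>2 * prob D"
proof -
  have Dn: "D \<in> sets M" and hitM: "l \<le> n \<Longrightarrow> hit D i l \<in> sets M" for l
    using sets_Fs hit_sets i D by blast+
  have int: "integrable M (\<lambda>x. indicator E x * (Y j x - Y i x)\<^sup>2)" if "E \<in> sets M" "j \<le> n" for E j
    using integrable_mult_indicator[OF that(1) integrable_sq[OF i that(2)]] by simp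
  have "a\<^sup>2 * prob (hit D i l) \<le> (\<integral>x. indicator (hit D i l) x * (Y n x - Y i x)\<^sup>2 \<partial>M)" if l: "l \<le> n" for l
  proof (cases "i < l")
    case True
    have "a\<^sup>2 * prob (hit D i l) = (\<integral>x. indicator (hit D i l) x * a\<^sup>2 \<partial>M)"
      using hitM[OF l] by simp
    also have "\<dots> \<le> (\<integral>x. indicator (hit D i l) x * (Y l x - Y i x)\<^sup>2 \<partial>M)"
    proof (rule integral_mono)
      show "integrable M (\<lambda>x. indicator (hit D i l) x * a\<^sup>2)"
        using hitM[OF l] by (intro integrable_mult_left integrable_real_indicator) (auto simp: emeasure_eq_measure)
      fix x
      show "indicator (hit D i l) x * a\<^sup>2 \<le> indicator (hit D i l) x * (Y l x - Y i x)\<^sup>2"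
        using power_mono[of a "\<bar>Y l x - Y i x\<bar>" 2] a_pos by (auto simp: indicator_def hit_def)
    qed (rule int[OF hitM[OF l] l])
    also have "\<dots> \<le> (\<integral>x. indicator (hit D i l) x * (Y n x - Y i x)\<^sup>2 \<partial>M)"
      using True l by (intro orthogonal hit_sets i D) auto
    finally show ?thesis .
  qed (simp add: hit_def)
  then have "a\<^sup>2 * (\<Sum>l\<le>n. prob (hit D i l)) \<le> (\<Sum>l\<le>n. (\<integral>x. indicator (hit D i l) x * (Y n x - Y i x)\<^sup>2 \<partial>M))"
    by (auto simp: sum_distrib_left intro!: sum_mono)
  also have "\<dots> = (\<integral>x. (\<Sum>l\<le>n. indicator (hit D i l) x * (Y n x - Y i x)\<^sup>2) \<partial>M)"
    using int hitM by (intro Bochner_Integration.integral_sum[symmetric]) auto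
  also have "\<dots> \<le> (\<integral>x. indicator D x * (Y n x - Y i x)\<^sup>2 \<partial>M)"
  proof (rule integral_mono)
    show "integrable M (\<lambda>x. \<Sum>l\<le>n. indicator (hit D i l) x * (Y n x - Y i x)\<^sup>2)"
      using int hitM by (intro Bochner_Integration.integrable_sum) auto
    fix x
    have "(\<Sum>l\<le>n. indicator (hit D i l) x) = (indicator (\<Union>l\<le>n. hit D i l) x :: real)"
      using hit_disjoint[of D i] by (intro indicator_UN_disjoint[symmetric]) (auto simp: disjoint_family_on_def)
    also have "\<dots> \<le> indicator D x" by (auto simp: indicator_def hit_def)
    finally show "(\<Sum>l\<le>n. indicator (hit D i l) x * (Y n x - Y i x)\<^sup>2) \<le> indicator D x * (Y n x - Y i x)\<^sup>2"
      by (simp add: mult_right_mono flip: sum_distrib_right)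
  qed (use int Dn in auto)
  also have "\<dots> \<le> V * prob D" by (rule variance[OF i D])
  finally show ?thesis using a_pos by (simp add: field_simps)
qed

fun moves :: "nat \<Rightarrow> nat \<Rightarrow> 'a set" where
  "moves 0 j = (if j = 0 then space M else {})"
| "moves (Suc k) l = (\<Union>j\<le>n. hit (moves k j) j l)"

lemma moves_sets: "j \<le> n \<Longrightarrow> moves k j \<in> sets (Fs j)"
proof (induction k arbitrary: j)
  case 0
  then show ?case using sub[of j] sets.top[of "Fs j"] by (auto simp: subalgebra_def)
qed (auto intro!: sets.finite_UN hit_sets)

text \<open>Splitting by the time \<open>j\<close> of the previous displacement replaces a strong
  Markov or optional stopping argument: \<open>moves k j\<close> is known at time \<open>j\<close>,
  so \<open>hit_prob\<close> applies to each piece, and exchanging the sums gives one more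
  factor.\<close>

lemma moves_prob: "(\<Sum>j\<le>n. prob (moves k j)) \<le> (V / a\<^sup>2) ^ k"
proof (induction k)
  case 0
  have "(\<Sum>j\<le>n. prob (moves 0 j)) = (\<Sum>j\<le>n. if j = 0 then 1 else 0)"
    by (intro sum.cong) (auto simp: prob_space)
  then show ?case by simp
next
  case (Suc k)
  have "(\<Sum>l\<le>n. prob (moves (Suc k) l)) \<le> (\<Sum>l\<le>n. \<Sum>j\<le>n. prob (hit (moves k j) j l))"
  proof (rule sum_mono)
    fix l assume "l \<in> {..n}"
    then have "(\<lambda>j. hit (moves k j) j l) ` {..n} \<subseteq> sets M"
      using sets_Fs hit_sets moves_sets by auto
    from finite_measure_subadditive_finite[OF _ this]
    show "prob (moves (Suc k) l) \<le> (\<Sum>j\<le>n. prob (hit (moves k j) j l))" by simp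
  qed
  also have "\<dots> = (\<Sum>j\<le>n. \<Sum>l\<le>n. prob (hit (moves k j) j l))" by (rule sum.swap)
  also have "\<dots> \<le> (\<Sum>j\<le>n. V / a\<^sup>2 * prob (moves k j))"
    by (intro sum_mono hit_prob moves_sets) auto
  also have "\<dots> \<le> V / a\<^sup>2 * (V / a\<^sup>2) ^ k"
    using V_nonneg by (subst sum_distrib_left[symmetric]) (intro mult_left_mono[OF Suc], simp)
  finally show ?case by simp
qed

text \<open>When a displacement is first noticed, the value one step earlier was still within
  \<open>a\<close>, and the step itself is shorter than \<open>a\<close>. So each displacement
  carries the process by at most \<open>2 * a\<close>, and travelling \<open>2 * a * k\<close> takes
  at least \<open>k\<close> of them.\<close>

lemma moves_reached:
  assumes x: "x \<in> space M" and step: "\<And>m. m < n \<Longrightarrow> \<bar>Y (Suc m) x - Y m x\<bar> < a"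
    and "i \<le> n" "2 * a * real k \<le> \<bar>Y i x - Y 0 x\<bar>"
  shows "\<exists>j\<le>i. x \<in> moves k j \<and> \<bar>Y j x - Y 0 x\<bar> \<le> 2 * a * real k"
  using assms(4)
proof (induction k)
  case 0
  then show ?case using x by auto
next
  case (Suc k)
  then have "2 * a * real k \<le> \<bar>Y i x - Y 0 x\<bar>" using a_pos by (simp add: algebra_simps)
  with Suc obtain j where j: "j \<le> i" "x \<in> moves k j" "\<bar>Y j x - Y 0 x\<bar> \<le> 2 * a * real k" by auto
  \<comment> \<open>At \<open>j\<close> the process is within \<open>2 * a * k\<close> of its start
    and at \<open>i\<close> it is at least \<open>2 * a\<close> further away, so another
    displacement occurs by time \<open>i\<close>.\<close>
  have "a \<le> \<bar>Y i x - Y j x\<bar>" using Suc.prems j(3) a_pos by (simp add: algebra_simps)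
  define l where "l = (LEAST l. j < l \<and> a \<le> \<bar>Y l x - Y j x\<bar>)"
  have "j < i" using \<open>a \<le> \<bar>Y i x - Y j x\<bar>\<close> j(1) a_pos by (cases "i = j") auto
  then have l: "j < l" "a \<le> \<bar>Y l x - Y j x\<bar>" "l \<le> i"
    using LeastI[of "\<lambda>l. j < l \<and> a \<le> \<bar>Y l x - Y j x\<bar>" i] Least_le[of "\<lambda>l. j < l \<and> a \<le> \<bar>Y l x - Y j x\<bar>" i]
      \<open>a \<le> \<bar>Y i x - Y j x\<bar>\<close> by (auto simp: l_def)
  have before: "\<bar>Y m x - Y j x\<bar> < a" if "j < m" "m < l" for m
    using not_less_Least[of m "\<lambda>l. j < l \<and> a \<le> \<bar>Y l x - Y j x\<bar>"] that by (auto simp: l_def)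
  have "x \<in> hit (moves k j) j l" using j(2) l before by (auto simp: hit_def)
  then have "x \<in> moves (Suc k) l" using j(1) \<open>i \<le> n\<close> by auto
  moreover obtain m where m: "l = Suc m" "j \<le> m" using l(1) by (cases l) auto
  \<comment> \<open>The predecessor of \<open>l\<close> may be \<open>j\<close> itself, in which
    case the displacement is 0.\<close>
  have "\<bar>Y m x - Y j x\<bar> \<le> a" using before[of m] m a_pos by (cases "m = j") auto
  with step[of m] m l(3) \<open>i \<le> n\<close> j(3) have "\<bar>Y l x - Y 0 x\<bar> \<le> 2 * a * real (Suc k)"
    by (simp add: algebra_simps)
  ultimately show ?case using l(3) by auto
qed

text \<open>Stated through a covering event, so that \<open>E\<close> may be any set.\<close>

lemma large_deviation:
  assumes "E \<subseteq> {x \<in> space M. (\<forall>m<n. \<bar>Y (Suc m) x - Y m x\<bar> < a) \<and> (\<exists>i\<le>n. 2 * a * real k \<le> \<bar>Y i x - Y 0 x\<bar>)}"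
  shows "\<exists>H\<in>sets M. E \<subseteq> H \<and> prob H \<le> (V / a\<^sup>2) ^ k"
proof (rule bexI[of _ "\<Union>j\<le>n. moves k j"])
  have s: "moves k ` {..n} \<subseteq> sets M" using sets_Fs moves_sets by blast
  then show "(\<Union>j\<le>n. moves k j) \<in> sets M" by (intro sets.finite_UN) auto
  have "E \<subseteq> (\<Union>j\<le>n. moves k j)"
  proof
    fix x assume "x \<in> E"
    with assms obtain i where x: "x \<in> space M" "\<And>m. m < n \<Longrightarrow> \<bar>Y (Suc m) x - Y m x\<bar> < a"
      and i: "i \<le> n" "2 * a * real k \<le> \<bar>Y i x - Y 0 x\<bar>" by blast
    from moves_reached[OF x i] i(1) show "x \<in> (\<Union>j\<le>n. moves k j)" by auto
  qed
  moreover have "prob (\<Union>j\<le>n. moves k j) \<le> (V / a\<^sup>2) ^ k"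
    by (rule order_trans[OF finite_measure_subadditive_finite[OF _ s] moves_prob]) simp
  ultimately show "E \<subseteq> (\<Union>j\<le>n. moves k j) \<and> prob (\<Union>j\<le>n. moves k j) \<le> (V / a\<^sup>2) ^ k" ..
qed

end

section \<open>Second moments of the coordinate martingale under one model\<close>

locale bounded_bracket =
  fixes T \<Lambda> :: real and P :: "path measure"
  assumes T_pos: "0 < T" and \<Lambda>_pos: "0 < \<Lambda>" and P: "P \<in> model_class T \<Lambda>"

sublocale bounded_bracket \<subseteq> P: prob_space P
  using P by (simp add: model_class_def)

sublocale bounded_bracket \<subseteq> prob_space "completion P"
  by (rule P.prob_space_completion)

context bounded_bracket
begin

abbreviation "aug \<equiv> usual_augmentation T P"

lemma sets_P: "sets P = sets (path_borel T)"
  using P by (simp add: model_class_def)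

lemma space_P: "space P = paths T"
  using sets_eq_imp_space_eq[OF sets_P] by (simp add: path_borel_def space_restrict_space)

lemma eval_measurable: "(\<lambda>x. apply_bcontfun x t) \<in> borel_measurable P"
proof -
  have "continuous_on UNIV (\<lambda>x :: path. apply_bcontfun x t)"
    unfolding continuous_on_iff by (metis dist_bounded le_less_trans)
  then have "(\<lambda>x. apply_bcontfun x t) \<in> borel_measurable (path_borel T)"
    unfolding path_borel_def by (intro measurable_restrict_space1 borel_measurable_continuous_onI)
  then show ?thesis by (simp cong: measurable_cong_sets add: sets_P)
qed

lemma space_aug: "space (aug s) = paths T"
  by (simp add: usual_augmentation_def space_measure_of_conv)

text \<open>The \<open>\<sigma>\<close>-algebra inside the intersection of
  \<open>usual_augmentation\<close>. It lies in the completed one, which is all that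
  \<open>subalgebra_aug\<close> needs of a single later time, taken as \<open>s + 1\<close>.\<close>

definition "gen u = sigma_sets (paths T) (sets (natural_filtration T (min u T)) \<union> null_sets (completion P))"

lemma gen_sets: "gen u \<subseteq> sets (completion P)"
proof -
  have "sets (natural_filtration T u) \<subseteq> sets (completion P)" for u
  proof -
    have "{x \<in> paths T. apply_bcontfun x s \<in> B} \<in> sets P" if "B \<in> sets borel" for s B
      using measurable_sets[OF eval_measurable[of s] that] by (simp add: space_P vimage_def Int_def conj_commute)
    then have "sigma_sets (paths T) {{x \<in> paths T. apply_bcontfun x s \<in> B} |s B. s \<in> {0..u} \<and> B \<in> sets borel} \<subseteq> sets P"
      by (subst space_P[symmetric], intro sets.sigma_sets_subset) (auto simp: space_P)
    then show ?thesis
      unfolding natural_filtration_def by (subst sets_measure_of) auto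
  qed
  moreover have "null_sets (completion P) \<subseteq> sets (completion P)" by auto
  ultimately show ?thesis
    unfolding gen_def using space_P sets.sigma_sets_subset[of _ "completion P"] by (metis Un_least space_completion)
qed

lemma sets_aug: "sets (aug s) = sigma_sets (paths T) (\<Inter>u\<in>{s<..}. gen u)"
proof -
  have "(\<Inter>u\<in>{s<..}. gen u) \<subseteq> gen (s + 1)" by (intro INF_lower) simp
  also have "\<dots> \<subseteq> Pow (paths T)"
    using gen_sets[of "s + 1"] sets.sets_into_space[of _ "completion P"] by (auto simp: space_P)
  finally show ?thesis unfolding usual_augmentation_def gen_def[symmetric] by (rule sets_measure_of)
qed

lemma subalgebra_aug: "subalgebra (completion P) (aug s)"
proof -
  have "(\<Inter>u\<in>{s<..}. gen u) \<subseteq> gen (s + 1)" by (intro INF_lower) simp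
  then have "(\<Inter>u\<in>{s<..}. gen u) \<subseteq> sets (completion P)" using gen_sets by blast
  then have "sets (aug s) \<subseteq> sets (completion P)"
    unfolding sets_aug using space_P sets.sigma_sets_subset[of _ "completion P"] by (metis space_completion)
  then show ?thesis by (simp add: subalgebra_def space_aug space_P)
qed

lemma aug_mono: "s \<le> t \<Longrightarrow> sets (aug s) \<subseteq> sets (aug t)"
  unfolding sets_aug by (intro sigma_sets_mono') (auto intro: le_less_trans)

lemma finite_measure_subalgebra_aug: "finite_measure_subalgebra (completion P) (aug s)"
  by unfold_locales (rule subalgebra_aug)

text \<open>The weight is any function known at time \<open>s\<close> whose product with
  \<open>N t\<close> is integrable, not just an indicator: the cross term below needs an indicator
  times an earlier value of the path.\<close>

lemma martingale_integral:
  assumes N: "martingale T P N" and st: "0 \<le> s" "s \<le> t" "t \<le> T"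
    and f: "f \<in> borel_measurable (aug s)" and int: "integrable (completion P) (\<lambda>x. f x * N t x)"
  shows "(\<integral>x. f x * N t x \<partial>completion P) = (\<integral>x. f x * N s x \<partial>completion P)"
proof -
  interpret finite_measure_subalgebra "completion P" "aug s" by (rule finite_measure_subalgebra_aug)
  have m: "N r \<in> borel_measurable (completion P)" if "r \<in> {0..T}" for r
    using N that measurable_from_subalg[OF subalgebra_aug] by (auto simp: martingale_def)
  have fm: "f \<in> borel_measurable (completion P)" by (rule measurable_from_subalg[OF subalgebra_aug f])
  have "(\<integral>x. f x * N t x \<partial>completion P) = (\<integral>x. f x * real_cond_exp (completion P) (aug s) (N t) x \<partial>completion P)"
    using st by (intro real_cond_exp_intg(2)[symmetric] int f m) auto
  also have "\<dots> = (\<integral>x. f x * N s x \<partial>completion P)"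
  proof (rule integral_cong_AE)
    have "AE x in completion P. real_cond_exp (completion P) (aug s) (N t) x = N s x"
      using N st by (auto simp: martingale_def)
    then show "AE x in completion P. f x * real_cond_exp (completion P) (aug s) (N t) x = f x * N s x"
      by eventually_elim simp
    show "(\<lambda>x. f x * N s x) \<in> borel_measurable (completion P)" using fm m[of s] st by auto
    have "real_cond_exp (completion P) (aug s) (N t) \<in> borel_measurable (completion P)"
      by (rule measurable_from_subalg[OF subalgebra_aug borel_measurable_cond_exp])
    then show "(\<lambda>x. f x * real_cond_exp (completion P) (aug s) (N t) x) \<in> borel_measurable (completion P)" using fm by auto
  qed
  finally show ?thesis .
qed

abbreviation "X \<equiv> \<lambda>t x. apply_bcontfun x t"

lemma X_martingale: "martingale T P X"
  and X_integrable_sq: "t \<in> {0..T} \<Longrightarrow> integrable (completion P) (\<lambda>x. (X t x)\<^sup>2)"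
  using P by (auto simp: model_class_def square_integrable_martingale_def)

lemma X_aug: "t \<in> {0..T} \<Longrightarrow> X t \<in> borel_measurable (aug t)"
  using X_martingale by (simp add: martingale_def)

lemma X_aug': "0 \<le> s \<Longrightarrow> s \<le> t \<Longrightarrow> t \<le> T \<Longrightarrow> X s \<in> borel_measurable (aug t)"
proof (rule measurable_from_subalg[OF _ X_aug])
  assume "s \<le> t"
  then show "subalgebra (aug t) (aug s)" using aug_mono[of s t] by (simp add: subalgebra_def space_aug)
qed auto

lemma X_measurable: "X t \<in> borel_measurable (completion P)"
  by (rule measurable_completion[OF eval_measurable])

lemma X_product_integrable:
  assumes "s \<in> {0..T}" "t \<in> {0..T}" "D \<in> sets (completion P)"
  shows "integrable (completion P) (\<lambda>x. indicator D x * (X s x * X t x))"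
proof (rule Bochner_Integration.integrable_bound)
  show "integrable (completion P) (\<lambda>x. (X s x)\<^sup>2 + (X t x)\<^sup>2)"
    using assms by (intro Bochner_Integration.integrable_add X_integrable_sq)
  show "(\<lambda>x. indicator D x * (X s x * X t x)) \<in> borel_measurable (completion P)"
    using X_measurable[of s] X_measurable[of t] assms(3) by measurable
  have "\<bar>p * q\<bar> \<le> p\<^sup>2 + q\<^sup>2" for p q :: real
  proof -
    have "2 * \<bar>p\<bar> * \<bar>q\<bar> \<le> p\<^sup>2 + q\<^sup>2" using sum_squares_bound[of "\<bar>p\<bar>" "\<bar>q\<bar>"] by simp
    moreover have "0 \<le> \<bar>p\<bar> * \<bar>q\<bar>" by simp
    ultimately show ?thesis unfolding abs_mult by linarith
  qed
  then show "AE x in completion P. norm (indicator D x * (X s x * X t x)) \<le> norm ((X s x)\<^sup>2 + (X t x)\<^sup>2)"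
    by (auto simp: indicator_def)
qed

lemma increment_integrable:
  assumes "s \<in> {0..T}" "t \<in> {0..T}" "D \<in> sets (completion P)"
  shows "integrable (completion P) (\<lambda>x. indicator D x * (X t x - X s x)\<^sup>2)"
proof -
  have "integrable (completion P) (\<lambda>x. indicator D x * (X t x * X t x) - 2 * (indicator D x * (X s x * X t x))
      + indicator D x * (X s x * X s x))"
    using assms by (intro Bochner_Integration.integrable_add Bochner_Integration.integrable_diff
        integrable_mult_right X_product_integrable)
  then show ?thesis by (simp add: power2_eq_square algebra_simps)
qed

abbreviation "E D f \<equiv> (\<integral>x. indicator D x * f x \<partial>completion P)"

text \<open>Expanding the square leaves the cross term \<open>X u x * (X t x - X s x)\<close> on
  \<open>D\<close>, which integrates to 0 because \<open>D\<close> and \<open>X u\<close> are known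
  at time \<open>s\<close>. For \<open>u = s\<close> the identity equates the squared increment with
  the increment of the squares.\<close>

lemma increment_orthogonal:
  assumes st: "0 \<le> u" "u \<le> s" "s \<le> t" "t \<le> T" and D: "D \<in> sets (aug s)"
  shows "E D (\<lambda>x. (X t x - X u x)\<^sup>2)
    = E D (\<lambda>x. (X s x - X u x)\<^sup>2) + E D (\<lambda>x. ((X t x)\<^sup>2 - (X s x)\<^sup>2))"
proof -
  have Dc: "D \<in> sets (completion P)" using D subalgebra_aug[of s] by (auto simp: subalgebra_def)
  have int: "integrable (completion P) (\<lambda>x. indicator D x * (X p x * X q x))" if "p \<in> {u, s, t}" "q \<in> {u, s, t}" for p q
    using that st by (intro X_product_integrable Dc) auto
  have "(\<integral>x. (indicator D x * X u x) * X t x \<partial>completion P) = (\<integral>x. (indicator D x * X u x) * X s x \<partial>completion P)"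
  proof (rule martingale_integral[OF X_martingale])
    show "(\<lambda>x. indicator D x * X u x) \<in> borel_measurable (aug s)"
      using X_aug'[OF st(1,2) order_trans[OF st(3,4)]] D by measurable
    show "integrable (completion P) (\<lambda>x. (indicator D x * X u x) * X t x)"
      using int[of u t] by (simp add: mult.assoc)
  qed (use st in auto)
  then have cross: "E D (\<lambda>x. (X u x * X t x)) = E D (\<lambda>x. (X u x * X s x))"
    by (simp add: mult.assoc)
  have "E D (\<lambda>x. (X t x - X u x)\<^sup>2)
    = (\<integral>x. indicator D x * (X s x - X u x)\<^sup>2 + indicator D x * ((X t x)\<^sup>2 - (X s x)\<^sup>2)
      - 2 * (indicator D x * (X u x * X t x) - indicator D x * (X u x * X s x)) \<partial>completion P)"
    by (intro Bochner_Integration.integral_cong) (auto simp: power2_eq_square algebra_simps)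
  also have "\<dots> = E D (\<lambda>x. (X s x - X u x)\<^sup>2) + E D (\<lambda>x. ((X t x)\<^sup>2 - (X s x)\<^sup>2))
      - 2 * (E D (\<lambda>x. (X u x * X t x)) - E D (\<lambda>x. (X u x * X s x)))"
  proof -
    have i1: "integrable (completion P) (\<lambda>x. indicator D x * (X s x - X u x)\<^sup>2)"
      using st by (intro increment_integrable Dc) auto
    have i2: "integrable (completion P) (\<lambda>x. indicator D x * ((X t x)\<^sup>2 - (X s x)\<^sup>2))"
      using Bochner_Integration.integrable_diff[OF int[of t t] int[of s s]] by (simp add: power2_eq_square right_diff_distrib)
    show ?thesis by (simp add: i1 i2 int)
  qed
  finally show ?thesis unfolding cross by simp
qed

text \<open>Nonnegativity is the previous identity with \<open>u = s\<close>. For the upper bound,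
  \<open>(X t x)\<^sup>2 - A t x\<close> is a martingale, so on \<open>D\<close> the increment of
  the squares has the same mean as that of \<open>A\<close>, which is at most
  \<open>\<Lambda> * (t - s)\<close> almost surely.\<close>

lemma square_increment:
  assumes st: "0 \<le> s" "s \<le> t" "t \<le> T" and D: "D \<in> sets (aug s)"
  shows "0 \<le> E D (\<lambda>x. ((X t x)\<^sup>2 - (X s x)\<^sup>2))"
    and "E D (\<lambda>x. ((X t x)\<^sup>2 - (X s x)\<^sup>2)) \<le> \<Lambda> * (t - s) * prob D"
proof -
  have Dc: "D \<in> sets (completion P)" using D subalgebra_aug[of s] by (auto simp: subalgebra_def)
  have "E D (\<lambda>x. ((X t x)\<^sup>2 - (X s x)\<^sup>2)) = E D (\<lambda>x. (X t x - X s x)\<^sup>2)"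
    using increment_orthogonal[OF st(1) order_refl st(2,3) D] by simp
  also have "0 \<le> \<dots>" by (intro Bochner_Integration.integral_nonneg) auto
  finally show "0 \<le> E D (\<lambda>x. ((X t x)\<^sup>2 - (X s x)\<^sup>2))" .
  obtain A where A: "martingale T P (\<lambda>t x. (X t x)\<^sup>2 - A t x)"
    and "AE x in P. \<forall>s t. 0 \<le> s \<and> s \<le> t \<and> t \<le> T \<longrightarrow> A t x - A s x \<le> \<Lambda> * (t - s)"
    using P by (auto simp: model_class_def is_bracket_def)
  then have AE: "AE x in completion P. A t x - A s x \<le> \<Lambda> * (t - s)"
    using st by (intro AE_completion) (auto elim!: eventually_mono)
  let ?N = "\<lambda>t x. (X t x)\<^sup>2 - A t x"
  have N: "integrable (completion P) (?N r)" and NX: "integrable (completion P) (\<lambda>x. (X r x)\<^sup>2)" if "r \<in> {0..T}" for r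
    using A that X_integrable_sq by (auto simp: martingale_def)
  have Ai: "integrable (completion P) (A r)" if "r \<in> {0..T}" for r
    using Bochner_Integration.integrable_diff[OF NX[OF that] N[OF that]] by simp
  have ind: "integrable (completion P) (\<lambda>x. indicator D x * f x)" if "integrable (completion P) f" for f :: "path \<Rightarrow> real"
    using integrable_mult_indicator[OF Dc that] by simp
  have r: "s \<in> {0..T}" "t \<in> {0..T}" using st by auto
  have "(\<integral>x. indicator D x * ?N t x \<partial>completion P) = (\<integral>x. indicator D x * ?N s x \<partial>completion P)"
    using st D by (intro martingale_integral[OF A] ind N) auto
  then have "E D (\<lambda>x. ((X t x)\<^sup>2 - (X s x)\<^sup>2)) = E D (\<lambda>x. (A t x - A s x))"
    using ind[OF NX[OF r(1)]] ind[OF NX[OF r(2)]] ind[OF Ai[OF r(1)]] ind[OF Ai[OF r(2)]]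
    by (simp add: right_diff_distrib)
  also have "\<dots> \<le> E D (\<lambda>x. (\<Lambda> * (t - s)))"
  proof (rule integral_mono_AE)
    show "AE x in completion P. indicator D x * (A t x - A s x) \<le> indicator D x * (\<Lambda> * (t - s))"
      using AE by eventually_elim (auto simp: indicator_def)
    show "integrable (completion P) (\<lambda>x. indicator D x * (\<Lambda> * (t - s)))" by (intro ind) simp
    show "integrable (completion P) (\<lambda>x. indicator D x * (A t x - A s x))"
      by (intro ind Bochner_Integration.integrable_diff Ai r)
  qed
  also have "\<dots> = \<Lambda> * (t - s) * prob D"
    using Dc sets.sets_into_space[OF Dc] by (simp add: Int_absorb2)
  finally show "E D (\<lambda>x. ((X t x)\<^sup>2 - (X s x)\<^sup>2)) \<le> \<Lambda> * (t - s) * prob D" .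
qed

text \<open>With these constants \<open>V\<close> divided by the square of \<open>a\<close> is
  \<open>1 / 2\<close>, independently of the number of grid points.\<close>

lemma grid_increments:
  assumes "0 < n"
  shows "discrete_increments (completion P) (\<lambda>i. aug (real i * T / real n)) (\<lambda>i. X (real i * T / real n)) n
    (\<Lambda> * T) (sqrt (2 * \<Lambda> * T))"
proof
  let ?t = "\<lambda>i::nat. real i * T / real n"
  have mono: "?t i \<le> ?t j" if "i \<le> j" for i j
    using that T_pos by (intro divide_right_mono mult_right_mono) auto
  have t0: "0 \<le> ?t i" for i using T_pos by simp
  have tn: "?t n = T" using assms by simp
  have r: "?t i \<in> {0..T}" if "i \<le> n" for i using t0[of i] mono[OF that] tn by simp
  show "0 < sqrt (2 * \<Lambda> * T)" "0 \<le> \<Lambda> * T" using T_pos \<Lambda>_pos by auto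
  show "subalgebra (completion P) (aug (?t i))" for i by (rule subalgebra_aug)
  show "sets (aug (?t i)) \<subseteq> sets (aug (?t j))" if "i \<le> j" for i j by (rule aug_mono[OF mono[OF that]])
  show "X (?t i) \<in> borel_measurable (aug (?t i))" if "i \<le> n" for i by (rule X_aug[OF r[OF that]])
  show "integrable (completion P) (\<lambda>x. (X (?t j) x - X (?t i) x)\<^sup>2)" if "i \<le> n" "j \<le> n" for i j
    using increment_integrable[OF r[OF that(1)] r[OF that(2)] sets.top]
    by (rule Bochner_Integration.integrable_cong[THEN iffD1, rotated -1]) auto
  fix D
  show "E D (\<lambda>x. (X (?t j) x - X (?t i) x)\<^sup>2) \<le> E D (\<lambda>x. (X (?t n) x - X (?t i) x)\<^sup>2)"
    if "i \<le> j" "j \<le> n" "D \<in> sets (aug (?t j))" for i j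
  proof -
    have T: "?t n \<le> T" using tn by simp
    show ?thesis
      unfolding increment_orthogonal[OF t0 mono[OF that(1)] mono[OF that(2)] T that(3)]
      using square_increment(1)[OF t0 mono[OF that(2)] T that(3)] by simp
  qed
  show "E D (\<lambda>x. (X (?t n) x - X (?t i) x)\<^sup>2) \<le> \<Lambda> * T * prob D"
    if "i \<le> n" "D \<in> sets (aug (?t i))" for i
  proof -
    have T: "?t n \<le> T" using tn by simp
    have "E D (\<lambda>x. (X (?t n) x - X (?t i) x)\<^sup>2) = E D (\<lambda>x. ((X (?t n) x)\<^sup>2 - (X (?t i) x)\<^sup>2))"
      using increment_orthogonal[OF t0 order_refl mono[OF that(1)] T that(2)] by simp
    also have "\<dots> \<le> \<Lambda> * (?t n - ?t i) * prob D" by (rule square_increment(2)[OF t0 mono[OF that(1)] T that(2)])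
    also have "\<dots> \<le> \<Lambda> * T * prob D"
      using \<Lambda>_pos t0[of i] tn by (intro mult_right_mono mult_left_mono) auto
    finally show ?thesis .
  qed
qed

section \<open>Tails and the exponential moment of the norm\<close>

lemma norm_measurable: "norm \<in> borel_measurable P"
proof -
  have "norm \<in> borel_measurable (path_borel T)"
    unfolding path_borel_def by (intro measurable_restrict_space1) simp
  then show ?thesis by (simp cong: measurable_cong_sets add: sets_P)
qed

lemma large_norm_sets: "{x \<in> paths T. c < norm x} \<in> sets P"
  using measurable_sets[OF norm_measurable, of "{c<..}"]
  by (simp add: space_P vimage_def Int_def conj_commute)

text \<open>By uniform continuity a fine grid has steps shorter than \<open>a\<close> and nearly
  sees the supremum of the path; the strict inequality in the hypothesis leaves room for the
  loss.\<close>

lemma grid_approximation: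
  assumes x: "x \<in> paths T" and "2 * a * real k < norm x" "0 < a"
  shows "\<exists>N. \<forall>n\<ge>N. 0 < n \<longrightarrow> (\<forall>m<n. \<bar>X (real (Suc m) * T / real n) x - X (real m * T / real n) x\<bar> < a)
    \<and> (\<exists>i\<le>n. 2 * a * real k \<le> \<bar>X (real i * T / real n) x - X (real 0 * T / real n) x\<bar>)"
proof -
  have clamp: "x t = x (max 0 (min T t))" for t using x unfolding paths_def by blast
  have "\<exists>t. 2 * a * real k < \<bar>x t\<bar>"
  proof (rule ccontr)
    assume "\<nexists>t. 2 * a * real k < \<bar>x t\<bar>"
    then have "norm x \<le> 2 * a * real k" by (intro norm_bound) (auto simp: not_less)
    with assms(2) show False by simp
  qed
  then obtain t where t: "t \<in> {0..T}" "2 * a * real k < \<bar>x t\<bar>"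
    using clamp T_pos by (metis atLeastAtMost_iff max.bounded_iff max.cobounded1 max_def min.cobounded1 order_less_imp_le)
  \<comment> \<open>One tolerance for both purposes: it bounds the steps by \<open>a\<close>, and it
    is at most the excess of the path over the level.\<close>
  define e where "e = min a (\<bar>x t\<bar> - 2 * a * real k)"
  have e: "0 < e" using t assms by (simp add: e_def)
  have "uniformly_continuous_on {0..T} (apply_bcontfun x)"
    by (intro compact_uniformly_continuous) auto
  then obtain d where d: "0 < d" "\<And>r u. r \<in> {0..T} \<Longrightarrow> u \<in> {0..T} \<Longrightarrow> \<bar>u - r\<bar> < d \<Longrightarrow> \<bar>x u - x r\<bar> < e"
    using e unfolding uniformly_continuous_on_def dist_real_def by meson
  obtain N where N: "T / d < real N" using reals_Archimedean2 by blast
  have "(\<forall>m<n. \<bar>X (real (Suc m) * T / real n) x - X (real m * T / real n) x\<bar> < a)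
    \<and> (\<exists>i\<le>n. 2 * a * real k \<le> \<bar>X (real i * T / real n) x - X (real 0 * T / real n) x\<bar>)"
    if n: "N \<le> n" "0 < n" for n
  proof (intro conjI allI impI)
    have "T / d < real n" using N n by linarith
    then have mesh: "T / real n < d" using d(1) n by (simp add: field_simps)
    have grid: "real i * T / real n \<in> {0..T}" if "i \<le> n" for i
      using that n T_pos by (auto simp: field_simps)
    fix m assume "m < n"
    have "real (Suc m) * T / real n - real m * T / real n = T / real n" using n by (simp add: field_simps)
    then show "\<bar>X (real (Suc m) * T / real n) x - X (real m * T / real n) x\<bar> < a"
      using d(2)[OF grid[of m] grid[of "Suc m"]] \<open>m < n\<close> mesh T_pos by (simp add: e_def)
  next
    have "T / d < real n" using N n by linarith
    then have mesh: "T / real n < d" using d(1) n by (simp add: field_simps)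
    \<comment> \<open>The last grid point not after \<open>t\<close>; it is less than one mesh width
      away.\<close>
    define i where "i = nat \<lfloor>t * real n / T\<rfloor>"
    have tn: "0 \<le> t * real n / T" using t T_pos by simp
    have i: "real i \<le> t * real n / T" "t * real n / T < real i + 1"
      using tn unfolding i_def by linarith+
    have "t * real n / T \<le> real n" using t T_pos n by (simp add: field_simps)
    with i have "i \<le> n" by linarith
    have le: "real i * T / real n \<le> t" using i(1) n T_pos by (simp add: field_simps)
    have "t < real i * T / real n + T / real n" using i(2) n T_pos by (simp add: field_simps)
    with le mesh have "\<bar>t - real i * T / real n\<bar> < d" by linarith
    moreover have "real i * T / real n \<in> {0..T}" using le t T_pos by auto
    ultimately have "\<bar>x t - x (real i * T / real n)\<bar> < e" using d(2) t(1) by blast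
    moreover have "e \<le> \<bar>x t\<bar> - 2 * a * real k" by (simp add: e_def)
    ultimately have "2 * a * real k \<le> \<bar>x (real i * T / real n)\<bar>" by linarith
    moreover have "x 0 = 0" using x by (simp add: paths_def)
    ultimately show "\<exists>i\<le>n. 2 * a * real k \<le> \<bar>X (real i * T / real n) x - X (real 0 * T / real n) x\<bar>"
      using \<open>i \<le> n\<close> by auto
  qed
  then show ?thesis by blast
qed

text \<open>The events \<open>W N\<close>, on which every grid with more than \<open>N\<close>
  points detects the excursion, increase to the whole event. Each of them is contained in the event
  for the single grid of size \<open>Suc N\<close>, where the discrete estimate applies, and
  continuity from below passes the bound to the limit.\<close>

lemma norm_tail:
  "P.prob {x \<in> paths T. 2 * sqrt (2 * \<Lambda> * T) * real k < norm x} \<le> (1 / 2) ^ k"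
proof -
  let ?a = "sqrt (2 * \<Lambda> * T)"
  have a: "0 < ?a" "?a\<^sup>2 = 2 * \<Lambda> * T" using T_pos \<Lambda>_pos by auto
  then have half: "\<Lambda> * T / ?a\<^sup>2 = 1 / 2" using T_pos \<Lambda>_pos by simp
  define S where "S = {x \<in> paths T. 2 * ?a * real k < norm x}"
  have S: "S \<in> sets P" unfolding S_def by (rule large_norm_sets)
  define Q where "Q n = {x \<in> S. (\<forall>m<n. \<bar>X (real (Suc m) * T / real n) x - X (real m * T / real n) x\<bar> < ?a)
    \<and> (\<exists>i\<le>n. 2 * ?a * real k \<le> \<bar>X (real i * T / real n) x - X (real 0 * T / real n) x\<bar>)}" for n
  \<comment> \<open>Starting at \<open>Suc N\<close> avoids the grid with \<open>n = 0\<close>,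
    where the mesh would be a division by zero.\<close>
  define W where "W N = (\<Inter>n\<in>{Suc N..}. Q n)" for N
  have Q: "Q n \<in> sets P" for n
  proof -
    have [measurable]: "X t \<in> borel_measurable P" for t by (rule eval_measurable)
    have "{x \<in> space P. (\<forall>m<n. \<bar>X (real (Suc m) * T / real n) x - X (real m * T / real n) x\<bar> < ?a)
      \<and> (\<exists>i\<le>n. 2 * ?a * real k \<le> \<bar>X (real i * T / real n) x - X (real 0 * T / real n) x\<bar>)} \<in> sets P"
      by measurable
    from sets.Int[OF S this] show ?thesis
      by (rule back_subst[of "\<lambda>X. X \<in> sets P"]) (auto simp: Q_def S_def space_P)
  qed
  then have W: "range W \<subseteq> sets P" unfolding W_def by (auto intro!: sets.countable_INT')
  have "incseq W" unfolding W_def by (intro monoI INF_superset_mono) auto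
  have "(\<Union>N. W N) = S"
  proof
    show "(\<Union>N. W N) \<subseteq> S" unfolding W_def Q_def by auto
    show "S \<subseteq> (\<Union>N. W N)"
    proof
      fix x assume "x \<in> S"
      then have "x \<in> paths T" "2 * ?a * real k < norm x" by (auto simp: S_def)
      from grid_approximation[OF this a(1)] \<open>x \<in> S\<close> obtain N where "\<And>n. N \<le> n \<Longrightarrow> 0 < n \<Longrightarrow> x \<in> Q n"
        unfolding Q_def by blast
      then have "x \<in> W N" by (auto simp: W_def)
      then show "x \<in> (\<Union>N. W N)" by blast
    qed
  qed
  moreover have "(\<lambda>N. P.prob (W N)) \<longlonglongrightarrow> P.prob (\<Union>N. W N)"
    by (rule P.finite_Lim_measure_incseq[OF W \<open>incseq W\<close>])
  moreover have "P.prob (W N) \<le> (1 / 2) ^ k" for N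
  proof -
    interpret discrete_increments "completion P" "\<lambda>i. aug (real i * T / real (Suc N))" "\<lambda>i. X (real i * T / real (Suc N))"
      "Suc N" "\<Lambda> * T" ?a
      by (rule grid_increments) simp
    have "\<exists>H\<in>sets (completion P). Q (Suc N) \<subseteq> H \<and> prob H \<le> (\<Lambda> * T / ?a\<^sup>2) ^ k"
      by (rule large_deviation) (auto simp: Q_def S_def space_P)
    then obtain H where H: "H \<in> sets (completion P)" "Q (Suc N) \<subseteq> H" "prob H \<le> (1 / 2) ^ k"
      unfolding half by blast
    have "P.prob (W N) \<le> P.prob (Q (Suc N))"
      using Q by (intro P.finite_measure_mono) (auto simp: W_def)
    also have "\<dots> = prob (Q (Suc N))" using Q by simp
    also have "\<dots> \<le> prob H" by (rule finite_measure_mono[OF H(2,1)])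
    finally show ?thesis using H(3) by simp
  qed
  ultimately show ?thesis unfolding S_def[symmetric] by (intro LIMSEQ_le_const2[of "\<lambda>N. P.prob (W N)"]) auto
qed

text \<open>On the shell with \<open>norm x\<close> between \<open>2 * a * k\<close> and
  \<open>2 * a * (k + 1)\<close> the integrand is at most \<open>(3 / 2) ^ Suc k\<close>, while the
  tail is at most \<open>(1 / 2) ^ k\<close>. The series with terms
  \<open>3 / 2 * (3 / 4) ^ k\<close> sums to 6.\<close>

lemma exponential_moment:
  "(\<integral>\<^sup>+x. ennreal (exp (ln (3 / 2) / (2 * sqrt (2 * \<Lambda> * T)) * norm x)) \<partial>P) \<le> 6"
proof -
  define a where "a = sqrt (2 * \<Lambda> * T)"
  have a: "0 < a" using T_pos \<Lambda>_pos by (simp add: a_def)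
  \<comment> \<open>For \<open>k = 0\<close> the strict inequality would miss the zero path, so all
    paths are added.\<close>
  define S where "S k = {x \<in> paths T. 2 * a * real k < norm x} \<union> (if k = 0 then paths T else {})" for k
  have S: "S k \<in> sets P" for k
    using large_norm_sets[of "2 * a * real k"] sets.top[of P] by (auto simp: S_def space_P)
  have prob: "P.prob (S k) \<le> (1 / 2) ^ k" for k
    using norm_tail[of k] P.prob_le_1 by (auto simp: S_def a_def)
  have "ennreal (exp (ln (3 / 2) / (2 * a) * norm x)) \<le> (\<Sum>k. ennreal ((3 / 2) ^ Suc k) * indicator (S k) x)"
    if "x \<in> space P" for x
  proof -
    define k where "k = nat (\<lceil>norm x / (2 * a)\<rceil> - 1)"
    have k: "norm x / (2 * a) \<le> real (Suc k)" unfolding k_def by linarith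
    have "x \<in> S k"
    proof (cases "k = 0")
      case False
      then have "real k < norm x / (2 * a)" unfolding k_def by linarith
      then show ?thesis using a that by (simp add: S_def space_P field_simps)
    qed (use that in \<open>simp add: S_def space_P\<close>)
    have "ln (3 / 2) / (2 * a) * norm x = ln (3 / 2) * (norm x / (2 * a))" by simp
    also have "\<dots> \<le> ln (3 / 2) * real (Suc k)" using k by (intro mult_left_mono) auto
    finally have "exp (ln (3 / 2) / (2 * a) * norm x) \<le> exp (real (Suc k) * ln (3 / 2))" by (simp add: mult.commute)
    also have "\<dots> = (3 / 2) ^ Suc k" unfolding exp_of_nat_mult by simp
    finally have "ennreal (exp (ln (3 / 2) / (2 * a) * norm x)) \<le> ennreal ((3 / 2) ^ Suc k) * indicator (S k) x"
      using \<open>x \<in> S k\<close> by (simp add: ennreal_leI)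
    also have "\<dots> \<le> (\<Sum>k. ennreal ((3 / 2) ^ Suc k) * indicator (S k) x)"
    proof -
      define f where "f k = ennreal ((3 / 2) ^ Suc k) * indicator (S k) x" for k
      have "sum f {k} \<le> suminf f" by (intro sum_le_suminf summableI) auto
      then show ?thesis by (simp add: f_def[symmetric] del: power_Suc)
    qed
    finally show ?thesis .
  qed
  then have "(\<integral>\<^sup>+x. ennreal (exp (ln (3 / 2) / (2 * a) * norm x)) \<partial>P) \<le> (\<integral>\<^sup>+x. (\<Sum>k. ennreal ((3 / 2) ^ Suc k) * indicator (S k) x) \<partial>P)"
    by (rule nn_integral_mono)
  also have "\<dots> = (\<Sum>k. ennreal ((3 / 2) ^ Suc k) * emeasure P (S k))"
    using S by (subst nn_integral_suminf) (auto simp: nn_integral_cmult)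
  also have "\<dots> \<le> (\<Sum>k. ennreal (3 / 2 * (3 / 4) ^ k))"
  proof (intro suminf_le summableI)
    fix k
    have "ennreal ((3 / 2) ^ Suc k) * emeasure P (S k) = ennreal ((3 / 2) ^ Suc k * P.prob (S k))"
      unfolding P.emeasure_eq_measure by (rule ennreal_mult[symmetric]) auto
    also have "\<dots> \<le> ennreal ((3 / 2) ^ Suc k * (1 / 2) ^ k)" by (intro ennreal_leI mult_left_mono prob) simp
    also have "(3 / 2) ^ Suc k * (1 / 2) ^ k = 3 / 2 * (3 / 4 :: real) ^ k" by (simp flip: power_mult_distrib)
    finally show "ennreal ((3 / 2) ^ Suc k) * emeasure P (S k) \<le> ennreal (3 / 2 * (3 / 4) ^ k)" .
  qed
  also have "\<dots> = ennreal (\<Sum>k. 3 / 2 * (3 / 4) ^ k)"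
    by (intro suminf_ennreal2 summable_mult summable_geometric) auto
  also have "(\<Sum>k. 3 / 2 * (3 / 4 :: real) ^ k) = 6"
    by (subst suminf_mult) (auto simp: suminf_geometric)
  finally show ?thesis by (simp add: a_def)
qed

end

section \<open>The expansion\<close>

lemma tendsto_ennreal_0_at_right:
  fixes f :: "real \<Rightarrow> ennreal"
  assumes "\<And>\<epsilon>. 0 < \<epsilon> \<Longrightarrow> \<exists>d>0. \<forall>\<delta>. 0 < \<delta> \<longrightarrow> \<delta> \<le> d \<longrightarrow> f \<delta> \<le> ennreal \<epsilon>"
  shows "(f \<longlongrightarrow> 0) (at_right 0)"
proof (rule order_tendstoI)
  fix a :: ennreal assume "0 < a"
  obtain \<epsilon> where \<epsilon>: "0 < \<epsilon>" "ennreal \<epsilon> < a"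
  proof (cases a)
    case (real r)
    then show ?thesis using that[of "r / 2"] \<open>0 < a\<close> by (auto simp: ennreal_less_iff)
  qed (use that[of 1] in auto)
  from assms[OF \<epsilon>(1)] obtain d where d: "d > 0" "\<And>\<delta>. 0 < \<delta> \<Longrightarrow> \<delta> \<le> d \<Longrightarrow> f \<delta> \<le> ennreal \<epsilon>" by blast
  have "f \<delta> < a" if "0 < \<delta>" "\<delta> < d" for \<delta>
    using le_less_trans[OF d(2) \<epsilon>(2), of \<delta>] that by simp
  with d(1) show "\<forall>\<^sub>F \<delta> in at_right 0. f \<delta> < a"
    unfolding eventually_at_right_field by (intro exI[of _ d]) simp
qed auto

lemma ennreal_powr_le:
  assumes "a \<le> ennreal r" "0 \<le> r" "0 \<le> q"
  shows "ennreal_powr a q \<le> ennreal (r powr q)"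
proof -
  have "enn2real a \<le> r" using assms enn2real_mono[of a "ennreal r"] by simp
  moreover have "a \<noteq> top" using assms(1) by (auto simp: top_unique)
  ultimately show ?thesis
    using assms by (auto simp: ennreal_powr_def intro!: ennreal_leI powr_mono2)
qed

text \<open>The inequality between \<open>1 + z\<close> and \<open>exp z\<close> at
  \<open>z = \<gamma> / p * (1 + u)\<close>, raised to the power \<open>p\<close>.\<close>

lemma powr_le_exp:
  fixes p \<gamma> u :: real
  assumes "0 < p" "0 < \<gamma>" "0 \<le> u"
  shows "(1 + u) powr p \<le> (p / \<gamma>) powr p * exp \<gamma> * exp (\<gamma> * u)"
proof -
  have "\<gamma> / p * (1 + u) \<le> exp (\<gamma> / p * (1 + u))" using exp_ge_add_one_self[of "\<gamma> / p * (1 + u)"] by linarith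
  then have "1 + u \<le> p / \<gamma> * exp (\<gamma> / p * (1 + u))" using assms by (simp add: field_simps)
  then have "(1 + u) powr p \<le> (p / \<gamma> * exp (\<gamma> / p * (1 + u))) powr p"
    using assms by (intro powr_mono2) auto
  also have "\<dots> = (p / \<gamma>) powr p * exp (\<gamma> / p * (1 + u)) powr p"
    by (rule powr_mult)
  also have "exp (\<gamma> / p * (1 + u)) powr p = exp (\<gamma> * (1 + u))"
    unfolding exp_powr_real using assms by simp
  finally have "(1 + u) powr p \<le> (p / \<gamma>) powr p * exp (\<gamma> * (1 + u))" .
  then show ?thesis by (simp add: distrib_left exp_add mult.assoc)
qed

context flow_family begin

text \<open>The remainder is small on \<open>norm x \<le> M\<close> and grows linearly beyond. There
  its \<open>p\<close>-th power is bounded by \<open>exp (\<gamma> * norm x)\<close>, which on large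
  paths is at most \<open>exp (- (\<gamma> * M)) * exp (2 * \<gamma> * norm x)\<close>: a small
  factor times an integrable function with a model-free bound.\<close>

lemma moment_expansion:
  assumes p: "1 \<le> p" and m: "0 \<le> m" and \<epsilon>: "0 < \<epsilon>"
  shows "\<exists>\<delta>>0. \<forall>P\<in>model_class T \<Lambda>. \<forall>\<theta>\<in>\<Theta>0. \<forall>y s \<eta>. \<bar>y\<bar> \<le> m \<longrightarrow> 0 \<le> s \<longrightarrow> s \<le> T \<longrightarrow> 0 < norm \<eta> \<longrightarrow> norm \<eta> \<le> \<delta> \<longrightarrow> norm \<eta> \<le> \<rho> \<longrightarrow>
    ennreal (1 / norm \<eta>) * ennreal_powr (\<integral>\<^sup>+ X. (SUP t\<in>{s..T}. ennreal (\<bar>remainder T \<Lambda> b \<sigma> \<theta> y s t X \<eta>\<bar> powr p)) \<partial>P) (1 / p)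
      \<le> ennreal \<epsilon>"
proof -
  \<comment> \<open>Half of the rate of the exponential moment; the other half is what yields decay
    in \<open>M\<close>.\<close>
  define \<gamma> where "\<gamma> = ln (3 / 2) / (2 * sqrt (2 * \<Lambda> * T)) / 2"
  have \<gamma>: "0 < \<gamma>" using T_pos \<Lambda>_pos by (simp add: \<gamma>_def)
  obtain c where c: "0 \<le> c" and growth: "\<And>\<theta> s t x y \<eta>. \<theta> \<in> \<Theta>0 \<Longrightarrow> 0 \<le> s \<Longrightarrow> s \<le> t \<Longrightarrow> t \<le> T \<Longrightarrow> \<bar>y\<bar> \<le> m \<Longrightarrow> norm \<eta> \<le> \<rho> \<Longrightarrow>
      \<bar>remainder T \<Lambda> b \<sigma> \<theta> y s t x \<eta>\<bar> \<le> c * (1 + norm x) * norm \<eta>"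
    by (rule remainder_growth[OF m]) (rule that)
  define D where "D = c powr p * ((p / \<gamma>) powr p * exp \<gamma>)"
  have D: "0 \<le> D" by (simp add: D_def)
  \<comment> \<open>The bounded and the unbounded paths each get half of the budget
    \<open>\<epsilon> powr p\<close>.\<close>
  define r where "r = \<epsilon> powr p / 2"
  have r: "0 < r" using \<epsilon> by (simp add: r_def)
  \<comment> \<open>Solves \<open>D * exp (- (\<gamma> * M)) * 6 \<le> r\<close>, with 6 from the
    exponential moment; the summand 1 keeps the argument of the logarithm positive if
    \<open>D\<close> is 0.\<close>
  define M where "M = max 0 (ln ((6 * D + 1) / r) / \<gamma>)"
  have "ln ((6 * D + 1) / r) / \<gamma> \<le> M" by (simp add: M_def)
  then have "ln ((6 * D + 1) / r) \<le> \<gamma> * M" unfolding pos_divide_le_eq[OF \<gamma>] by (simp only: mult.commute)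
  then have "exp (ln ((6 * D + 1) / r)) \<le> exp (\<gamma> * M)" by (simp only: exp_le_cancel_iff)
  moreover have "0 < (6 * D + 1) / r" using D r by simp
  ultimately have "(6 * D + 1) / r \<le> exp (\<gamma> * M)" by (simp only: exp_ln)
  then have "D * 6 \<le> r * exp (\<gamma> * M)" using r by (simp add: pos_divide_le_eq mult.commute)
  then have M: "D * exp (- (\<gamma> * M)) * 6 \<le> r"
    by (simp add: exp_minus inverse_eq_divide pos_divide_le_eq)
  define \<epsilon>1 where "\<epsilon>1 = r powr (1 / p)"
  have \<epsilon>1: "0 < \<epsilon>1" "\<epsilon>1 powr p = r" using r p by (auto simp: \<epsilon>1_def powr_powr)
  have M0: "0 \<le> M" by (simp add: M_def)
  obtain \<delta> where \<delta>: "0 < \<delta>" and small: "\<And>\<theta> s t x y \<eta>. \<theta> \<in> \<Theta>0 \<Longrightarrow> 0 \<le> s \<Longrightarrow> s \<le> t \<Longrightarrow> t \<le> T \<Longrightarrow> \<bar>y\<bar> \<le> m \<Longrightarrow> norm x \<le> M \<Longrightarrow> norm \<eta> \<le> \<delta> \<Longrightarrow>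
      \<bar>remainder T \<Lambda> b \<sigma> \<theta> y s t x \<eta>\<bar> \<le> \<epsilon>1 * norm \<eta>"
    by (rule remainder_small[OF \<epsilon>1(1) m M0]) (rule that)
  have "ennreal (1 / norm \<eta>) * ennreal_powr (\<integral>\<^sup>+ X. (SUP t\<in>{s..T}. ennreal (\<bar>remainder T \<Lambda> b \<sigma> \<theta> y s t X \<eta>\<bar> powr p)) \<partial>P) (1 / p)
      \<le> ennreal \<epsilon>"
    if P: "P \<in> model_class T \<Lambda>" and \<theta>: "\<theta> \<in> \<Theta>0" and y: "\<bar>y\<bar> \<le> m" and s: "0 \<le> s" "s \<le> T"
      and \<eta>: "0 < norm \<eta>" "norm \<eta> \<le> \<delta>" "norm \<eta> \<le> \<rho>" for P \<theta> y s \<eta>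
  proof -
    interpret bounded_bracket T \<Lambda> P by unfold_locales (use T_pos \<Lambda>_pos P in auto)
    let ?I = "\<integral>\<^sup>+ X. (SUP t\<in>{s..T}. ennreal (\<bar>remainder T \<Lambda> b \<sigma> \<theta> y s t X \<eta>\<bar> powr p)) \<partial>P"
    define n where "n = norm \<eta> powr p"
    define k where "k = n * (D * exp (- (\<gamma> * M)))"
    have n: "0 \<le> n" and k: "0 \<le> k" using D by (auto simp: n_def k_def)
    have bound: "\<bar>remainder T \<Lambda> b \<sigma> \<theta> y s t x \<eta>\<bar> powr p \<le> n * r + k * exp (2 * \<gamma> * norm x)"
      if t: "t \<in> {s..T}" for t x
    proof (cases "norm x \<le> M")
      case True
      then have "\<bar>remainder T \<Lambda> b \<sigma> \<theta> y s t x \<eta>\<bar> powr p \<le> (\<epsilon>1 * norm \<eta>) powr p"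
        using small[OF \<theta> s(1) _ _ y True \<eta>(2), of t] t p by (intro powr_mono2) auto
      also have "\<dots> = n * r" using \<epsilon>1 by (simp add: powr_mult n_def)
      finally show ?thesis using k by (intro add_increasing2 mult_nonneg_nonneg) auto
    next
      case False
      have "\<bar>remainder T \<Lambda> b \<sigma> \<theta> y s t x \<eta>\<bar> powr p \<le> (c * (1 + norm x) * norm \<eta>) powr p"
        using growth[OF \<theta> s(1) _ _ y \<eta>(3), of t x] t p by (intro powr_mono2) auto
      also have "\<dots> = c powr p * (1 + norm x) powr p * n" using c by (simp add: powr_mult n_def)
      also have "\<dots> \<le> c powr p * ((p / \<gamma>) powr p * exp \<gamma> * exp (\<gamma> * norm x)) * n"
        using powr_le_exp[of p \<gamma> "norm x"] p \<gamma> n by (intro mult_right_mono mult_left_mono) auto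
      also have "\<dots> = n * (D * exp (\<gamma> * norm x))" by (simp add: D_def)
      also have "\<dots> \<le> n * (D * (exp (- (\<gamma> * M)) * exp (2 * \<gamma> * norm x)))"
      proof -
        have "\<gamma> * norm x \<le> - (\<gamma> * M) + 2 * \<gamma> * norm x" using False \<gamma> by (simp add: algebra_simps)
        then have "exp (\<gamma> * norm x) \<le> exp (- (\<gamma> * M)) * exp (2 * \<gamma> * norm x)" by (simp flip: exp_add)
        then show ?thesis using n D by (intro mult_left_mono) auto
      qed
      also have "\<dots> = k * exp (2 * \<gamma> * norm x)" by (simp add: k_def)
      finally show ?thesis using n r by (intro add_increasing mult_nonneg_nonneg) auto
    qed
    have "?I \<le> (\<integral>\<^sup>+ X. ennreal (n * r) + ennreal k * ennreal (exp (2 * \<gamma> * norm X)) \<partial>P)"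
    proof (intro nn_integral_mono SUP_least)
      fix x t assume "t \<in> {s..T}"
      from ennreal_leI[OF bound[OF this]]
      show "ennreal (\<bar>remainder T \<Lambda> b \<sigma> \<theta> y s t x \<eta>\<bar> powr p) \<le> ennreal (n * r) + ennreal k * ennreal (exp (2 * \<gamma> * norm x))"
        using n r k by (simp add: ennreal_plus ennreal_mult)
    qed
    also have "\<dots> = ennreal (n * r) + ennreal k * (\<integral>\<^sup>+ X. ennreal (exp (2 * \<gamma> * norm X)) \<partial>P)"
      using norm_measurable by (subst nn_integral_add) (auto simp: nn_integral_cmult P.emeasure_space_1)
    also have "\<dots> \<le> ennreal (n * r) + ennreal k * 6"
      using exponential_moment by (intro add_left_mono mult_left_mono) (auto simp: \<gamma>_def)
    also have "\<dots> = ennreal (n * r + k * 6)"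
      using n r k by (simp add: ennreal_plus ennreal_mult)
    also have "\<dots> \<le> ennreal (n * r + n * r)"
      using mult_left_mono[OF M n] by (intro ennreal_leI) (simp add: k_def mult.assoc)
    also have "n * r + n * r = (norm \<eta> * \<epsilon>) powr p" using \<epsilon> by (simp add: n_def r_def powr_mult)
    finally have "ennreal_powr ?I (1 / p)
        \<le> ennreal (((norm \<eta> * \<epsilon>) powr p) powr (1 / p))"
      using p by (intro ennreal_powr_le) auto
    also have "((norm \<eta> * \<epsilon>) powr p) powr (1 / p) = norm \<eta> * \<epsilon>" using p \<epsilon> by (simp add: powr_powr)
    finally have "ennreal (1 / norm \<eta>) * ennreal_powr ?I (1 / p)
        \<le> ennreal (1 / norm \<eta>) * ennreal (norm \<eta> * \<epsilon>)"
      by (rule mult_left_mono) simp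
    also have "\<dots> = ennreal (1 / norm \<eta> * (norm \<eta> * \<epsilon>))" using \<epsilon> by (intro ennreal_mult[symmetric]) auto
    also have "1 / norm \<eta> * (norm \<eta> * \<epsilon>) = \<epsilon>" using \<eta>(1) by simp
    finally show ?thesis .
  qed
  with \<delta> show ?thesis by blast
qed

end

theorem proposition4p8:
  fixes T \<Lambda> \<rho> L \<sigma>_low \<sigma>_high :: real
    and U \<Theta> \<Theta>1 \<Theta>0 :: "(real ^ 'd) set"
    and b :: "real ^ 'd \<Rightarrow> 2 Cb"
    and \<sigma> :: "real ^ 'd \<Rightarrow> 3 Cb"
    and K :: "nat \<Rightarrow> path set"
  assumes "0 < T" "0 < \<Lambda>"
    and core: "capacity_core T \<Lambda> K"
    and sets: "compact \<Theta>" "open U" "compact \<Theta>1" "\<Theta>1 \<subseteq> U" "\<Theta> \<subseteq> interior \<Theta>1"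
    and C1: "C1_map_on U (\<lambda>\<theta>. (b \<theta>, \<sigma> \<theta>))"
    and bound: "\<And>\<theta>. \<theta> \<in> \<Theta>1 \<Longrightarrow> norm (b \<theta>) + norm (\<sigma> \<theta>) \<le> L"
    and "0 < \<sigma>_low" "\<sigma>_low \<le> \<sigma>_high"
    and ellipticity: "\<And>\<theta> y. \<theta> \<in> \<Theta>1 \<Longrightarrow> \<sigma>_low \<le> \<sigma> \<theta> y \<and> \<sigma> \<theta> y \<le> \<sigma>_high"
    and deriv_bound: "bdd_above ((\<lambda>\<theta>. onorm (frechet_derivative b (at \<theta>))
                                     + onorm (frechet_derivative \<sigma> (at \<theta>))) ` \<Theta>1)"
    and "compact \<Theta>0" "\<Theta>0 \<subseteq> interior \<Theta>1"
    and "0 < \<rho>" "closed_nbhd \<Theta>0 \<rho> \<subseteq> interior \<Theta>1"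
  shows "(\<forall>R\<ge>1. \<forall>m::real.
           ((\<lambda>\<delta>. SUP (x, \<theta>, y, s, t, \<eta>) \<in>
                {(x, \<theta>, y, s, t, \<eta>). x \<in> K R \<and> \<theta> \<in> \<Theta>0 \<and> \<bar>y\<bar> \<le> m \<and> 0 \<le> s \<and> s \<le> t \<and> t \<le> T
                   \<and> 0 < norm \<eta> \<and> norm \<eta> \<le> min \<delta> (min \<rho> 1)}.
                ennreal (\<bar>remainder T \<Lambda> b \<sigma> \<theta> y s t x \<eta>\<bar> / norm \<eta>))
            \<longlongrightarrow> 0) (at_right 0))
       \<and> (\<forall>p\<ge>1. \<forall>m::real.
           ((\<lambda>\<delta>. SUP (P, \<theta>, y, s, \<eta>) \<in>
                {(P, \<theta>, y, s, \<eta>). P \<in> model_class T \<Lambda> \<and> \<theta> \<in> \<Theta>0 \<and> \<bar>y\<bar> \<le> m \<and> 0 \<le> s \<and> s \<le> T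
                   \<and> 0 < norm \<eta> \<and> norm \<eta> \<le> min \<delta> (min \<rho> 1)}.
                ennreal (1 / norm \<eta>) *
                ennreal_powr
                  (\<integral>\<^sup>+ X. (SUP t\<in>{s..T}. ennreal (\<bar>remainder T \<Lambda> b \<sigma> \<theta> y s t X \<eta>\<bar> powr p)) \<partial>P)
                  (1 / p))
            \<longlongrightarrow> 0) (at_right 0))"
proof -
  obtain M where M: "\<And>\<theta>. \<theta> \<in> \<Theta>1 \<Longrightarrow> onorm (frechet_derivative b (at \<theta>)) + onorm (frechet_derivative \<sigma> (at \<theta>)) \<le> M"
    using deriv_bound by (auto simp: bdd_above_def)
  \<comment> \<open>The maximum makes the constant nonnegative even if \<open>\<Theta>1\<close> is
    empty and \<open>M\<close> arbitrary.\<close>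
  define \<kappa> where "\<kappa> = max M 0"
  have \<Theta>1: "interior \<Theta>1 \<subseteq> \<Theta>1" by (rule interior_subset)
  have "C1_map_on (interior \<Theta>1) (\<lambda>\<theta>. (b \<theta>, \<sigma> \<theta>))"
    using C1_map_on_subset[OF C1] \<Theta>1 \<open>\<Theta>1 \<subseteq> U\<close> by simp
  note C1_map_on_compose[OF C1_map_on_linear[OF bounded_linear_fst] this subset_UNIV]
    and C1_map_on_compose[OF C1_map_on_linear[OF bounded_linear_snd] this subset_UNIV]
  then have C1b: "C1_map_on (interior \<Theta>1) b" and C1\<sigma>: "C1_map_on (interior \<Theta>1) \<sigma>" by simp_all
  have cball: "cball \<theta> \<rho> \<subseteq> interior \<Theta>1" if "\<theta> \<in> \<Theta>0" for \<theta>
  proof -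
    have "cball \<theta> \<rho> \<subseteq> closed_nbhd \<Theta>0 \<rho>"
      using that by (auto simp: closed_nbhd_def dist_commute intro: order_trans[OF infdist_le])
    then show ?thesis using assms by simp
  qed
  have \<kappa>: "onorm (frechet_derivative b (at \<theta>)) \<le> \<kappa>" "onorm (frechet_derivative \<sigma> (at \<theta>)) \<le> \<kappa>"
    if "\<theta> \<in> interior \<Theta>1" for \<theta>
  proof -
    have "0 \<le> onorm (frechet_derivative b (at \<theta>))" "0 \<le> onorm (frechet_derivative \<sigma> (at \<theta>))"
      using C1_map_on_has_frechet_derivative[OF C1b that] C1_map_on_has_frechet_derivative[OF C1\<sigma> that]
      by (auto intro!: onorm_pos_le has_derivative_bounded_linear)
    with M[of \<theta>] that \<Theta>1 show "onorm (frechet_derivative b (at \<theta>)) \<le> \<kappa>" "onorm (frechet_derivative \<sigma> (at \<theta>)) \<le> \<kappa>"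
      by (auto simp: \<kappa>_def)
  qed
  \<comment> \<open>The mean value inequality needs a convex set; the ball of radius
    \<open>\<rho>\<close> around a point of \<open>\<Theta>0\<close> is one and stays in the
    interior of \<open>\<Theta>1\<close>, where the derivatives are bounded by
    \<open>\<kappa>\<close>.\<close>
  have diff: "norm (b (\<theta> + v) - b \<theta>) \<le> \<kappa> * norm v" "norm (\<sigma> (\<theta> + v) - \<sigma> \<theta>) \<le> \<kappa> * norm v"
    if "\<theta> \<in> \<Theta>0" "norm v \<le> \<rho>" for \<theta> v
  proof -
    have in_cball: "\<theta> + v \<in> cball \<theta> \<rho>" "\<theta> \<in> cball \<theta> \<rho>" using that \<open>0 < \<rho>\<close> by (auto simp: dist_norm)
    have sub: "\<And>\<theta>'. \<theta>' \<in> cball \<theta> \<rho> \<Longrightarrow> \<theta>' \<in> interior \<Theta>1" using cball[OF that(1)] by blast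
    have "norm (b (\<theta> + v) - b \<theta>) \<le> \<kappa> * norm (\<theta> + v - \<theta>)"
      by (rule differentiable_bound[OF convex_cball has_derivative_at_withinI[OF C1_map_on_has_frechet_derivative[OF C1b sub]] \<kappa>(1)[OF sub] in_cball])
    then show "norm (b (\<theta> + v) - b \<theta>) \<le> \<kappa> * norm v" by simp
    have "norm (\<sigma> (\<theta> + v) - \<sigma> \<theta>) \<le> \<kappa> * norm (\<theta> + v - \<theta>)"
      by (rule differentiable_bound[OF convex_cball has_derivative_at_withinI[OF C1_map_on_has_frechet_derivative[OF C1\<sigma> sub]] \<kappa>(2)[OF sub] in_cball])
    then show "norm (\<sigma> (\<theta> + v) - \<sigma> \<theta>) \<le> \<kappa> * norm v" by simp
  qed
  interpret flow_family "interior \<Theta>1" b \<sigma> L \<sigma>_low \<sigma>_high T \<Lambda> \<kappa> \<rho> \<Theta>0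
  proof
    fix \<theta> assume "\<theta> \<in> interior \<Theta>1"
    then have \<theta>: "\<theta> \<in> \<Theta>1" using \<Theta>1 by blast
    show "norm (b \<theta>) \<le> L" "norm (\<sigma> \<theta>) \<le> L"
      using bound[OF \<theta>] norm_ge_zero[of "b \<theta>"] norm_ge_zero[of "\<sigma> \<theta>"] by linarith+
    show "\<sigma>_low \<le> \<sigma> \<theta> y" "\<sigma> \<theta> y \<le> \<sigma>_high" for y using ellipticity[OF \<theta>] by auto
  qed (use assms C1b C1\<sigma> cball diff in \<open>auto simp: \<kappa>_def\<close>)
  show ?thesis
  proof (intro conjI allI impI tendsto_ennreal_0_at_right)
    fix R :: nat and m \<epsilon> :: real assume "1 \<le> R" "0 < \<epsilon>"
    have "bounded (K R)" using core \<open>1 \<le> R\<close> by (auto simp: capacity_core_def compact_imp_bounded)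
    then obtain M where M: "\<And>x. x \<in> K R \<Longrightarrow> norm x \<le> M" by (auto simp: bounded_iff)
    \<comment> \<open>The bound \<open>m\<close> is an arbitrary real and \<open>M\<close> may be
      negative for empty \<open>K R\<close>, hence the maxima with 0.\<close>
    obtain \<delta> where "0 < \<delta>" and small: "\<And>\<theta> s t x y \<eta>. \<theta> \<in> \<Theta>0 \<Longrightarrow> 0 \<le> s \<Longrightarrow> s \<le> t \<Longrightarrow> t \<le> T \<Longrightarrow> \<bar>y\<bar> \<le> max m 0 \<Longrightarrow>
        norm x \<le> max M 0 \<Longrightarrow> norm \<eta> \<le> \<delta> \<Longrightarrow> \<bar>remainder T \<Lambda> b \<sigma> \<theta> y s t x \<eta>\<bar> \<le> \<epsilon> * norm \<eta>"
      by (rule remainder_small[OF \<open>0 < \<epsilon>\<close> max.cobounded2 max.cobounded2]) (rule that)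
    have "ennreal (\<bar>remainder T \<Lambda> b \<sigma> \<theta> y s t x \<eta>\<bar> / norm \<eta>) \<le> ennreal \<epsilon>"
      if "x \<in> K R" "\<theta> \<in> \<Theta>0" "\<bar>y\<bar> \<le> m" "0 \<le> s" "s \<le> t" "t \<le> T" "0 < norm \<eta>" "norm \<eta> \<le> \<delta>" for x \<theta> y s t \<eta>
      using small[OF that(2,4,5,6), of y x \<eta>] that M[OF that(1)] by (intro ennreal_leI) (simp add: pos_divide_le_eq)
    then show "\<exists>d>0. \<forall>\<delta>. 0 < \<delta> \<longrightarrow> \<delta> \<le> d \<longrightarrow> (SUP (x, \<theta>, y, s, t, \<eta>) \<in>
                {(x, \<theta>, y, s, t, \<eta>). x \<in> K R \<and> \<theta> \<in> \<Theta>0 \<and> \<bar>y\<bar> \<le> m \<and> 0 \<le> s \<and> s \<le> t \<and> t \<le> T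
                   \<and> 0 < norm \<eta> \<and> norm \<eta> \<le> min \<delta> (min \<rho> 1)}.
                ennreal (\<bar>remainder T \<Lambda> b \<sigma> \<theta> y s t x \<eta>\<bar> / norm \<eta>)) \<le> ennreal \<epsilon>"
      using \<open>0 < \<delta>\<close> by (intro exI[of _ \<delta>] conjI allI impI SUP_least) auto
  next
    fix p m \<epsilon> :: real assume "1 \<le> p" "0 < \<epsilon>"
    from moment_expansion[OF this(1) max.cobounded2[of 0 m] this(2)]
    obtain \<delta> where "0 < \<delta>" and *: "\<And>P \<theta> y s \<eta>. P \<in> model_class T \<Lambda> \<Longrightarrow> \<theta> \<in> \<Theta>0 \<Longrightarrow> \<bar>y\<bar> \<le> max m 0 \<Longrightarrow> 0 \<le> s \<Longrightarrow> s \<le> T \<Longrightarrow>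
        0 < norm \<eta> \<Longrightarrow> norm \<eta> \<le> \<delta> \<Longrightarrow> norm \<eta> \<le> \<rho> \<Longrightarrow>
        ennreal (1 / norm \<eta>) * ennreal_powr (\<integral>\<^sup>+ X. (SUP t\<in>{s..T}. ennreal (\<bar>remainder T \<Lambda> b \<sigma> \<theta> y s t X \<eta>\<bar> powr p)) \<partial>P) (1 / p)
          \<le> ennreal \<epsilon>"
      by blast
    show "\<exists>d>0. \<forall>\<delta>. 0 < \<delta> \<longrightarrow> \<delta> \<le> d \<longrightarrow> (SUP (P, \<theta>, y, s, \<eta>) \<in>
                {(P, \<theta>, y, s, \<eta>). P \<in> model_class T \<Lambda> \<and> \<theta> \<in> \<Theta>0 \<and> \<bar>y\<bar> \<le> m \<and> 0 \<le> s \<and> s \<le> T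
                   \<and> 0 < norm \<eta> \<and> norm \<eta> \<le> min \<delta> (min \<rho> 1)}.
                ennreal (1 / norm \<eta>) *
                ennreal_powr
                  (\<integral>\<^sup>+ X. (SUP t\<in>{s..T}. ennreal (\<bar>remainder T \<Lambda> b \<sigma> \<theta> y s t X \<eta>\<bar> powr p)) \<partial>P)
                  (1 / p)) \<le> ennreal \<epsilon>"
      using \<open>0 < \<delta>\<close> by (intro exI[of _ \<delta>] conjI allI impI SUP_least) (auto intro!: *)
  qed
qed

end
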